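(* For any $s>0$, the test procedure $\Delta_s^*$ is asymptotically minimax and the minimax rate separating $\mathcal H_0$ and $\mathcal H_1$ is $r_n=n^{-\frac{2s}{1+4s}}$. That is, for every $0<\gamma<1$, with $r_n=n^{-\frac{2s}{1+4s}}$ in the definition of $\Theta_1(R,C,n,s)$: (1) there is a constant $C_\gamma$ such that for all $C>C_\gamma$, $$\limsup_{n\to\infty}\left(\sup_{(\overrightarrow p,\overrightarrow q)\in\Theta_0(R)}\mathbb P_{\overrightarrow p,\overrightarrow q}(\Delta_s^*=1)+\sup_{(\overrightarrow p,\overrightarrow q)\in\Theta_1(R,C,n,s)}\mathbb P_{\overrightarrow p,\overrightarrow q}(\Delta_s^*=0)\right)\le\gamma;$$ (2) there is a constant $c_\gamma>0$ such that for all $C<c_\gamma$ (with $C>0$), $$\liminf_{n\to\infty}\ \inf_{\Delta}\left(\sup_{(\overrightarrow p,\overrightarrow q)\in\Theta_0(R)}\mathbb P_{\overrightarrow p,\overrightarrow q}(\Delta=1)+\sup_{(\overrightarrow p,\overrightarrow q)\in\Theta_1(R,C,n,s)}\mathbb P_{\overrightarrow p,\overrightarrow q}(\Delta=0)\right)>\gamma,$$ where the infimum is taken over all test procedures $\Delta$ (i.e. $\{0,1\}$-valued functions of the observations).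
   Context: Wavelets. $\phi,\psi$ are compactly supported functions of $L_2(\mathbb R)$ (scaling function and associated wavelet) with $\mathrm{support}(\phi)\cup\mathrm{support}(\psi)\subset[-L,L[$ for some $L>0$; $\|\phi\|_\infty$ is the sup norm of $\phi$. For $j\in\mathbb N$, $k\in\mathbb Z$, $\phi_{jk}(x)=2^{j/2}\phi(2^jx-k)$ and $\psi_{jk}(x)=2^{j/2}\psi(2^jx-k)$; for every $j\in\mathbb N$, $\{\phi_{jk},\psi_{j'k};\ j'\ge j,\ k\in\mathbb Z\}$ is an orthonormal basis of $L_2(\mathbb R)$. The Besov body $\mathcal B^s_{2,\infty}(R)$, $R>0$, is the set of $h\in L_2(\mathbb R)$ with $\sup_{j\in\mathbb N}2^{2js}\sum_{j'\ge j}\sum_{k\in\mathbb Z}\beta_{j'k}^2\le R$, where $\beta_{j'k}=\int h\psi_{j'k}$. Model. $M\ge1$ is the number of components. $Y_1,\dots,Y_n$ and $Z_1,\dots,Z_n$ are two independent samples of independent real random variables; $Y_i$ has density $f_i=\sum_{u=1}^M\omega_u(i)p_u$ and $Z_i$ has density $g_i=\sum_{u=1}^M\sigma_u(i)q_u$. The mixing weights $\omega_u(i),\sigma_u(i)\ge0$ are known, with $\sum_u\omega_u(i)=\sum_u\sigma_u(i)=1$ for all $i$; the probability densities $p_u,q_u$ are unknown. $\overrightarrow p=(p_1,\dots,p_M)$, $\overrightarrow q=(q_1,\dots,q_M)$, and $\mathbb P_{\overrightarrow p,\overrightarrow q}$ is the law of the observations. Let $\Omega$ and $\Sigma$ be the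 $M\times n$ matrices with entries $\Omega_{u,i}=\omega_u(i)$ and $\Sigma_{u,i}=\sigma_u(i)$. Hypothesis on the weights: the smallest eigenvalues of the $M\times M$ matrices $\Gamma_n=\Omega\Omega^*$ and $\Gamma_n'=\Sigma\Sigma^*$ are both larger than or equal to $Kn$, with $0<K<1$. Dual weights. $a_l(i)=n\sum_{u=1}^M(\Gamma_n^{-1})_{lu}\,\omega_u(i)$ and $b_l(i)=n\sum_{u=1}^M(\Gamma_n'^{-1})_{lu}\,\sigma_u(i)$, so that $\frac1n\sum_{i=1}^n\omega_k(i)a_l(i)=\delta_{kl}=\frac1n\sum_{i=1}^n\sigma_k(i)b_l(i)$ ($\delta_{kl}$ the Kronecker delta). Hypotheses. $\mathcal D$ is the set of probability densities on $\mathbb R$ with respect to Lebesgue measure; $\mathbb L_\infty(R)$, $\mathbb L_2(R)$ are the sets of functions with $\|h\|_\infty\le R$, $\|h\|_2\le R$ respectively; $\mathcal S(R)=\mathcal D\cap\mathbb L_\infty(R)\cap\mathbb L_2(R)$. $\mathcal H_0$: $(\overrightarrow p,\overrightarrow q)\in\Theta_0(R)$, the set of couples with $p_u=q_u\in\mathcal S(R)$ for all $u\in\{1,\dots,M\}$. $\mathcal H_1$: $(\overrightarrow p,\overrightarrow q)\in\Theta_1(R,C,n,s)$, the set of couples with $p_u-q_u\in\mathcal B^s_{2,\infty}(R)$ for all $u\in\{1,\dots,M\}$, and such that for some $u\in\{1,\dots,M\}$, $(p_u,q_u)\in\Lambda_n(R,C)=\{(p,q)\in(\mathcal D\cap\mathbb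 L_\infty(R))^2:\|p-q\|_2\ge C r_n\}$. Test. For each level $j$, $$T_j=\frac1{n^2}\sum_{l=1}^M\sum_{k\in\mathbb Z}\sum_{i_1\ne i_2}\left[a_l(i_1)\phi_{jk}(Y_{i_1})-b_l(i_1)\phi_{jk}(Z_{i_1})\right]\left[a_l(i_2)\phi_{jk}(Y_{i_2})-b_l(i_2)\phi_{jk}(Z_{i_2})\right].$$ For a given $\gamma$, $\Delta_s^*=1$ if $T_{j_n}>t\,r_n^2$ and $\Delta_s^*=0$ otherwise, where $j_n$ is the smallest integer with $2^{-j_n}\le n^{-\frac{2}{1+4s}}$, $t=\left(2\sqrt{C_T/\gamma}+8LR^2\right)\frac MK$, and $C_T=C_T(R,L,\|\phi\|_\infty)>0$ is a constant such that, in this testing problem (under $\mathcal H_0$ or $\mathcal H_1$), for any level $j$, $$\mathrm{Var}_{\overrightarrow p,\overrightarrow q}(T_j)\le C_T\left(\frac{2^j}{n^2}+\frac1n\sum_{l}\|p_l-q_l\|_2^2+\sqrt{\frac{2^j}{n^3}}\sum_{l}\|p_l-q_l\|_2\right)\frac{M^2}{K^2}.$$ *)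

theory Defs
  imports "HOL-Probability.Probability"
begin

section \<open>Square-integrable functions and wavelets\<close>

definition L2 :: "(real \<Rightarrow> real) set" where
  "L2 = {h \<in> borel_measurable lborel. integrable lborel (\<lambda>x. (h x)\<^sup>2)}"

definition inner_L2 :: "(real \<Rightarrow> real) \<Rightarrow> (real \<Rightarrow> real) \<Rightarrow> real" where
  "inner_L2 g h = (LINT x|lborel. g x * h x)"

text \<open>Only meaningful on \<^const>\<open>L2\<close>: outside it the integral defaults to 0.\<close>

definition norm_L2 :: "(real \<Rightarrow> real) \<Rightarrow> real" where
  "norm_L2 h = sqrt (LINT x|lborel. (h x)\<^sup>2)"

text \<open>Orthonormal (Hilbert) basis: an orthonormal family whose finite linear combinations are dense.\<close>

definition orthonormal_basis_L2 :: "'i set \<Rightarrow> ('i \<Rightarrow> real \<Rightarrow> real) \<Rightarrow> bool" where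
  "orthonormal_basis_L2 I e \<longleftrightarrow>
     (\<forall>i\<in>I. e i \<in> L2) \<and>
     (\<forall>i\<in>I. \<forall>i'\<in>I. inner_L2 (e i) (e i') = (if i = i' then 1 else 0)) \<and>
     (\<forall>h\<in>L2. \<forall>\<epsilon>>0. \<exists>F c. finite F \<and> F \<subseteq> I \<and>
        norm_L2 (\<lambda>x. h x - (\<Sum>i\<in>F. c i * e i x)) < \<epsilon>)"

text \<open>\<open>dilate \<phi> j k\<close> is the function \<open>\<phi>\<^sub>j\<^sub>k\<close>.\<close>

definition dilate :: "(real \<Rightarrow> real) \<Rightarrow> nat \<Rightarrow> int \<Rightarrow> real \<Rightarrow> real" where
  "dilate \<phi> j k x = 2 powr (real j / 2) * \<phi> (2 ^ j * x - of_int k)"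

definition wavelet_family ::
  "(real \<Rightarrow> real) \<Rightarrow> (real \<Rightarrow> real) \<Rightarrow> nat \<Rightarrow> int + nat \<times> int \<Rightarrow> real \<Rightarrow> real" where
  "wavelet_family \<phi> \<psi> j i =
     (case i of Inl k \<Rightarrow> dilate \<phi> j k | Inr (j', k) \<Rightarrow> dilate \<psi> j' k)"

definition wavelet_system :: "(real \<Rightarrow> real) \<Rightarrow> (real \<Rightarrow> real) \<Rightarrow> real \<Rightarrow> bool" where
  "wavelet_system \<phi> \<psi> L \<longleftrightarrow>
     \<phi> \<in> L2 \<and> \<psi> \<in> L2 \<and> bounded (range \<phi>) \<and>
     {x. \<phi> x \<noteq> 0} \<union> {x. \<psi> x \<noteq> 0} \<subseteq> {-L..<L} \<and>
     (\<forall>j. orthonormal_basis_L2 (UNIV <+> {j..} \<times> UNIV) (wavelet_family \<phi> \<psi> j))"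

text \<open>The radius is not squared: it bounds the weighted sum of squares itself. The sums and the
  supremum are taken in \<^typ>\<open>ennreal\<close>, so that divergence means \<open>\<infinity>\<close>.\<close>

definition besov_body :: "(real \<Rightarrow> real) \<Rightarrow> real \<Rightarrow> real \<Rightarrow> (real \<Rightarrow> real) set" where
  "besov_body \<psi> s R = {h \<in> L2.
     (SUP j::nat. ennreal (2 powr (2 * real j * s)) *
        (\<Sum>\<^sub>\<infinity>j'\<in>{j..}. \<Sum>\<^sub>\<infinity>k\<in>(UNIV :: int set). ennreal ((inner_L2 h (dilate \<psi> j' k))\<^sup>2)))
     \<le> ennreal R}"

section \<open>The mixture model\<close>

text \<open>The \<open>M\<close> components are indexed by a finite type \<open>'m\<close> with \<open>M = CARD('m)\<close>, the
  observations by \<open>{1..n}\<close>. A weight function \<open>w\<close> maps a component \<open>u\<close> and an index \<open>i\<close> to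
  the mixing weight \<open>w u i\<close>.\<close>

definition mixing_weights :: "('m::finite \<Rightarrow> nat \<Rightarrow> real) \<Rightarrow> nat \<Rightarrow> bool" where
  "mixing_weights w n \<longleftrightarrow>
     (\<forall>i\<in>{1..n}. (\<forall>u. 0 \<le> w u i) \<and> (\<Sum>u\<in>UNIV. w u i) = 1)"

text \<open>\<open>gram w n\<close> is \<open>W W\<^sup>*\<close> for the \<open>M \<times> n\<close> matrix \<open>W\<close> with entries \<open>w u i\<close>.\<close>

definition gram :: "('m::finite \<Rightarrow> nat \<Rightarrow> real) \<Rightarrow> nat \<Rightarrow> real ^ 'm ^ 'm" where
  "gram w n = (\<chi> u v. \<Sum>i\<in>{1..n}. w u i * w v i)"

definition eigenvalues :: "real ^ 'm ^ 'm \<Rightarrow> real set" where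
  "eigenvalues A = {\<mu>. \<exists>v. v \<noteq> 0 \<and> A *v v = \<mu> *\<^sub>R v}"

definition smallest_eigenvalue :: "real ^ 'm ^ 'm \<Rightarrow> real" where
  "smallest_eigenvalue A = Min (eigenvalues A)"

definition dual_weight :: "('m::finite \<Rightarrow> nat \<Rightarrow> real) \<Rightarrow> nat \<Rightarrow> 'm \<Rightarrow> nat \<Rightarrow> real" where
  "dual_weight w n l i = real n * (\<Sum>u\<in>UNIV. matrix_inv (gram w n) $ l $ u * w u i)"

definition sample_law ::
  "('m::finite \<Rightarrow> nat \<Rightarrow> real) \<Rightarrow> ('m \<Rightarrow> real \<Rightarrow> real) \<Rightarrow> nat \<Rightarrow> (nat \<Rightarrow> real) measure" where
  "sample_law w p n =
     (\<Pi>\<^sub>M i\<in>{1..n}. density lborel (\<lambda>x. ennreal (\<Sum>u\<in>UNIV. w u i * p u x)))"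

type_synonym observation = "(nat \<Rightarrow> real) \<times> (nat \<Rightarrow> real)"

text \<open>The law of \<open>((Y\<^sub>1, \<dots>, Y\<^sub>n), (Z\<^sub>1, \<dots>, Z\<^sub>n))\<close>.\<close>

definition obs_law ::
  "('m::finite \<Rightarrow> nat \<Rightarrow> real) \<Rightarrow> ('m \<Rightarrow> nat \<Rightarrow> real) \<Rightarrow> nat \<Rightarrow>
   ('m \<Rightarrow> real \<Rightarrow> real) \<times> ('m \<Rightarrow> real \<Rightarrow> real) \<Rightarrow> observation measure" where
  "obs_law \<omega> \<sigma> n pq = sample_law \<omega> (fst pq) n \<Otimes>\<^sub>M sample_law \<sigma> (snd pq) n"

section \<open>Hypotheses\<close>

definition prob_densities :: "(real \<Rightarrow> real) set" where
  "prob_densities = {p \<in> borel_measurable lborel.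
     (\<forall>x. 0 \<le> p x) \<and> (\<integral>\<^sup>+x. ennreal (p x) \<partial>lborel) = 1}"

definition Linf_ball :: "real \<Rightarrow> (real \<Rightarrow> real) set" where
  "Linf_ball R = {h \<in> borel_measurable lborel. AE x in lborel. \<bar>h x\<bar> \<le> R}"

definition L2_ball :: "real \<Rightarrow> (real \<Rightarrow> real) set" where
  "L2_ball R = {h \<in> L2. norm_L2 h \<le> R}"

definition sep_rate :: "real \<Rightarrow> nat \<Rightarrow> real" where
  "sep_rate s n = real n powr (- (2 * s / (1 + 4 * s)))"

definition Theta0 :: "real \<Rightarrow> (('m \<Rightarrow> real \<Rightarrow> real) \<times> ('m \<Rightarrow> real \<Rightarrow> real)) set" where
  "Theta0 R = {(p, q). \<forall>u. p u = q u \<and> p u \<in> prob_densities \<inter> Linf_ball R \<inter> L2_ball R}"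

definition Lambda :: "real \<Rightarrow> real \<Rightarrow> nat \<Rightarrow> real \<Rightarrow> ((real \<Rightarrow> real) \<times> (real \<Rightarrow> real)) set" where
  "Lambda R C n s = {(p, q). p \<in> prob_densities \<inter> Linf_ball R \<and> q \<in> prob_densities \<inter> Linf_ball R \<and>
     norm_L2 (\<lambda>x. p x - q x) \<ge> C * sep_rate s n}"

text \<open>\<open>\<A>\<close> is the set of densities in which all the components range. With
  \<open>\<A> = prob_densities\<close> this is the alternative read literally: only the pair of components
  that is separated has to be bounded by \<open>R\<close>. With \<open>\<A> = prob_densities \<inter> Linf_ball R\<close> every
  component is. The distinction matters for \<open>variance_bound\<close> below: a constant depending on the
  densities through \<open>R\<close> alone exists for the second choice; for the first one it does not exist
  when \<open>M \<ge> 2\<close>, since a component \<open>p\<^sub>u = q\<^sub>u\<close> concentrated on an interval of length of order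
  \<open>2\<^sup>-\<^sup>j\<close> makes the variance of order \<open>4\<^sup>j\<close> for a fixed sample size.\<close>

definition Theta1 ::
  "(real \<Rightarrow> real) set \<Rightarrow> (real \<Rightarrow> real) \<Rightarrow> real \<Rightarrow> real \<Rightarrow> nat \<Rightarrow> real \<Rightarrow>
   (('m \<Rightarrow> real \<Rightarrow> real) \<times> ('m \<Rightarrow> real \<Rightarrow> real)) set" where
  "Theta1 \<A> \<psi> R C n s = {(p, q).
     (\<forall>u. p u \<in> \<A> \<and> q u \<in> \<A>) \<and>
     (\<forall>u. (\<lambda>x. p u x - q u x) \<in> besov_body \<psi> s R) \<and>
     (\<exists>u. (p u, q u) \<in> Lambda R C n s)}"

section \<open>Tests\<close>

definition tests :: "nat \<Rightarrow> (observation \<Rightarrow> nat) set" where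
  "tests n = measurable ((\<Pi>\<^sub>M i\<in>{1..n}. borel) \<Otimes>\<^sub>M (\<Pi>\<^sub>M i\<in>{1..n}. borel)) (count_space {0, 1})"

text \<open>The sum over \<open>k\<close> has finitely many nonzero terms, as \<open>\<phi>\<close> has compact support.\<close>

definition T_stat ::
  "(real \<Rightarrow> real) \<Rightarrow> ('m::finite \<Rightarrow> nat \<Rightarrow> real) \<Rightarrow> ('m \<Rightarrow> nat \<Rightarrow> real) \<Rightarrow> nat \<Rightarrow> nat \<Rightarrow>
   observation \<Rightarrow> real" where
  "T_stat \<phi> \<omega> \<sigma> n j = (\<lambda>(y, z).
     let d = (\<lambda>l k i. dual_weight \<omega> n l i * dilate \<phi> j k (y i)
                     - dual_weight \<sigma> n l i * dilate \<phi> j k (z i))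
     in 1 / (real n)\<^sup>2 *
        (\<Sum>l\<in>UNIV. \<Sum>\<^sub>\<infinity>k\<in>(UNIV :: int set).
           \<Sum>i\<^sub>1\<in>{1..n}. \<Sum>i\<^sub>2\<in>{1..n} - {i\<^sub>1}. d l k i\<^sub>1 * d l k i\<^sub>2))"

text \<open>For \<open>n \<ge> 1\<close> the least integer with this property is nonnegative, hence a natural number.\<close>

definition level :: "real \<Rightarrow> nat \<Rightarrow> nat" where
  "level s n = (LEAST j::nat. 2 powr (- real j) \<le> real n powr (- (2 / (1 + 4 * s))))"

definition threshold_const :: "real \<Rightarrow> real \<Rightarrow> real \<Rightarrow> real \<Rightarrow> nat \<Rightarrow> real \<Rightarrow> real" where
  "threshold_const C\<^sub>T \<gamma> L R M K = (2 * sqrt (C\<^sub>T / \<gamma>) + 8 * L * R\<^sup>2) * (real M / K)"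

definition Delta_star ::
  "(real \<Rightarrow> real) \<Rightarrow> ('m::finite \<Rightarrow> nat \<Rightarrow> real) \<Rightarrow> ('m \<Rightarrow> nat \<Rightarrow> real) \<Rightarrow> nat \<Rightarrow> real \<Rightarrow> real \<Rightarrow>
   observation \<Rightarrow> nat" where
  "Delta_star \<phi> \<omega> \<sigma> n s t yz =
     (if T_stat \<phi> \<omega> \<sigma> n (level s n) yz > t * (sep_rate s n)\<^sup>2 then 1 else 0)"

text \<open>The sum of the two suprema of error probabilities over \<open>\<Theta>\<^sub>0\<close> and \<open>\<Theta>\<^sub>1\<close>; in
  \<^typ>\<open>ennreal\<close> a supremum over the empty set is 0.\<close>

definition total_error ::
  "('m::finite \<Rightarrow> nat \<Rightarrow> real) \<Rightarrow> ('m \<Rightarrow> nat \<Rightarrow> real) \<Rightarrow> nat \<Rightarrow>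
   (('m \<Rightarrow> real \<Rightarrow> real) \<times> ('m \<Rightarrow> real \<Rightarrow> real)) set \<Rightarrow>
   (('m \<Rightarrow> real \<Rightarrow> real) \<times> ('m \<Rightarrow> real \<Rightarrow> real)) set \<Rightarrow> (observation \<Rightarrow> nat) \<Rightarrow> ennreal" where
  "total_error \<omega> \<sigma> n \<Theta>\<^sub>0 \<Theta>\<^sub>1 \<Delta> =
     (SUP pq\<in>\<Theta>\<^sub>0. emeasure (obs_law \<omega> \<sigma> n pq) {yz \<in> space (obs_law \<omega> \<sigma> n pq). \<Delta> yz = 1}) +
     (SUP pq\<in>\<Theta>\<^sub>1. emeasure (obs_law \<omega> \<sigma> n pq) {yz \<in> space (obs_law \<omega> \<sigma> n pq). \<Delta> yz = 0})"

text \<open>Here \<open>\<omega> n\<close> and \<open>\<sigma> n\<close> are the weights at sample size \<open>n\<close>. The constant \<open>C\<^sub>T\<close> has to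
  serve all alternatives, whatever \<open>C > 0\<close>. Only large \<open>n\<close> are considered since for \<open>n < M\<close> the
  matrices \<open>gram\<close> are singular and the dual weights are undefined.\<close>

definition variance_bound ::
  "(real \<Rightarrow> real) set \<Rightarrow> (real \<Rightarrow> real) \<Rightarrow> (real \<Rightarrow> real) \<Rightarrow> real \<Rightarrow> real \<Rightarrow>
   (nat \<Rightarrow> 'm::finite \<Rightarrow> nat \<Rightarrow> real) \<Rightarrow> (nat \<Rightarrow> 'm \<Rightarrow> nat \<Rightarrow> real) \<Rightarrow> real \<Rightarrow> real \<Rightarrow> bool" where
  "variance_bound \<A> \<phi> \<psi> R s \<omega> \<sigma> K C\<^sub>T \<longleftrightarrow>
     (\<forall>C>0. \<forall>\<^sub>F n in sequentially. \<forall>(p, q) \<in> Theta0 R \<union> Theta1 \<A> \<psi> R C n s. \<forall>j.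
        prob_space.variance (obs_law (\<omega> n) (\<sigma> n) n (p, q)) (T_stat \<phi> (\<omega> n) (\<sigma> n) n j)
        \<le> C\<^sub>T * (2 ^ j / (real n)\<^sup>2
                 + 1 / real n * (\<Sum>l\<in>UNIV. (norm_L2 (\<lambda>x. p l x - q l x))\<^sup>2)
                 + sqrt (2 ^ j / real n ^ 3) * (\<Sum>l\<in>UNIV. norm_L2 (\<lambda>x. p l x - q l x)))
             * ((real CARD('m))\<^sup>2 / K\<^sup>2))"

end

theory Submission
  imports Defs
begin

text \<open>Upper bound: the mean of \<open>T\<^sub>j\<close> is \<open>\<Sum>\<^sub>l \<parallel>\<Pi>\<^sub>j (p\<^sub>l - q\<^sub>l)\<parallel>\<^sup>2\<close>, where \<open>\<Pi>\<^sub>j\<close> projects onto the scaling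
  functions of level \<open>j\<close>, minus a bias coming from the omitted diagonal terms. The bias is
  nonnegative and, for densities bounded by \<open>R\<close>, of order \<open>1/n\<close> by Bessel's inequality and the bound on
  the dual weights; the projection loses at most \<open>R 2\<^sup>-\<^sup>2\<^sup>j\<^sup>s\<close> per component by the Besov condition.
  Chebyshev's inequality with the assumed variance bound controls both errors. If the components
  are not all bounded and there are at least two of them, no variance bound can hold.

  Lower bound: all \<open>p\<^sub>u\<close> equal one flat density, all \<open>q\<^sub>u\<close> equal that density perturbed by wavelets
  of level \<open>j\<^sub>n\<close> with random signs. The \<open>\<chi>\<^sup>2\<close>-distance between the null law and the mixture over the
  signs stays bounded by a constant which tends to 0 with \<open>C\<close>.\<close>

section \<open>Orthonormal bases of square-integrable functions\<close>

text \<open>The level \<open>level s n\<close> balances several quantities at once. With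
  \<open>r = sep_rate s n\<close>, 2^j is about n^2 r^4, so the statistic has standard deviation of
  order r^2 under the null, and 2^(-2js) is about r^2, so the projection loses no more than the
  separation to be detected. The same relations limit the perturbation in the lower bound: 2^j
  wavelets with squared coefficients C^2 r^2 / 2^j have separation C r, stay in the Besov body for
  small C, and give a chi-square distance governed by n^2 r^4 / 2^j. Two obstacles shape the
  preparation. \<open>wavelet_system\<close> states neither that the wavelet is bounded nor that it
  has mean zero, yet the perturbed function must be a bounded density; both facts are drawn from the
  orthonormal bases, boundedness only almost everywhere. And the sum over \<open>k\<close> in
  \<open>T_stat\<close> is infinite, with nonzero terms whose positions move with the observations,
  so means are computed on finite windows and passed to the limit by dominated convergence.\<close>

lemma L2_measurable: "h \<in> L2 \<Longrightarrow> h \<in> borel_measurable borel"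
  by (simp add: L2_def)

lemma L2_integrable_mult:
  assumes "g \<in> L2" "h \<in> L2"
  shows "integrable lborel (\<lambda>x. g x * h x)"
proof (rule Bochner_Integration.integrable_bound)
  show "integrable lborel (\<lambda>x. (g x)\<^sup>2 + (h x)\<^sup>2)"
    using assms by (auto simp: L2_def)
  show "(\<lambda>x. g x * h x) \<in> borel_measurable lborel"
    using assms by (auto simp: L2_def)
  show "AE x in lborel. norm (g x * h x) \<le> norm ((g x)\<^sup>2 + (h x)\<^sup>2)"
  proof (intro AE_I2)
    fix x
    have "2 * \<bar>g x\<bar> * \<bar>h x\<bar> \<le> \<bar>g x\<bar>\<^sup>2 + \<bar>h x\<bar>\<^sup>2"
      by (rule sum_squares_bound)
    moreover have "0 \<le> \<bar>g x\<bar> * \<bar>h x\<bar>" by simp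
    ultimately have "\<bar>g x\<bar> * \<bar>h x\<bar> \<le> (g x)\<^sup>2 + (h x)\<^sup>2"
      unfolding mult.assoc power2_abs by linarith
    then show "norm (g x * h x) \<le> norm ((g x)\<^sup>2 + (h x)\<^sup>2)"
      by (simp add: abs_mult)
  qed
qed

lemma L2_add:
  assumes "g \<in> L2" "h \<in> L2"
  shows "(\<lambda>x. g x + h x) \<in> L2"
proof -
  have "integrable lborel (\<lambda>x. (g x)\<^sup>2 + (h x)\<^sup>2 + 2 * (g x * h x))"
    using L2_integrable_mult[OF assms] assms by (auto simp: L2_def)
  with assms show ?thesis
    by (auto simp: L2_def power2_sum mult.assoc)
qed

lemma L2_cmult: "h \<in> L2 \<Longrightarrow> (\<lambda>x. c * h x) \<in> L2"
  by (auto simp: L2_def power_mult_distrib)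

lemma L2_diff: "g \<in> L2 \<Longrightarrow> h \<in> L2 \<Longrightarrow> (\<lambda>x. g x - h x) \<in> L2"
  using L2_add[of g "\<lambda>x. - 1 * h x"] L2_cmult[of h "-1"] by simp

lemma L2_zero: "(\<lambda>x. 0) \<in> L2"
  by (simp add: L2_def)

lemma L2_sum: "(\<And>i. i \<in> F \<Longrightarrow> f i \<in> L2) \<Longrightarrow> (\<lambda>x. \<Sum>i\<in>F. f i x) \<in> L2"
  by (induction F rule: infinite_finite_induct) (auto simp: L2_zero L2_add)

lemma norm_L2_sq: "(norm_L2 h)\<^sup>2 = inner_L2 h h"
  by (simp add: norm_L2_def inner_L2_def power2_eq_square)

lemma norm_L2_nonneg: "0 \<le> norm_L2 h"
  by (simp add: norm_L2_def)

lemma inner_L2_self_nonneg: "0 \<le> inner_L2 h h"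
  by (simp add: inner_L2_def)

lemma inner_L2_commute: "inner_L2 g h = inner_L2 h g"
  by (simp add: inner_L2_def mult.commute)

lemma inner_L2_diff_left:
  "f \<in> L2 \<Longrightarrow> g \<in> L2 \<Longrightarrow> h \<in> L2 \<Longrightarrow> inner_L2 (\<lambda>x. f x - g x) h = inner_L2 f h - inner_L2 g h"
  by (simp add: inner_L2_def left_diff_distrib L2_integrable_mult)

lemma inner_L2_cmult_left: "inner_L2 (\<lambda>x. c * g x) h = c * inner_L2 g h"
  by (simp add: inner_L2_def mult.assoc)

lemma inner_L2_sum_left:
  assumes "\<And>i. i \<in> F \<Longrightarrow> f i \<in> L2" "h \<in> L2"
  shows "inner_L2 (\<lambda>x. \<Sum>i\<in>F. f i x) h = (\<Sum>i\<in>F. inner_L2 (f i) h)"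
  using assms
  by (simp add: inner_L2_def sum_distrib_right L2_integrable_mult)

lemma inner_L2_diff_self:
  assumes "g \<in> L2" "h \<in> L2"
  shows "inner_L2 (\<lambda>x. h x - g x) (\<lambda>x. h x - g x) = inner_L2 h h - 2 * inner_L2 h g + inner_L2 g g"
proof -
  have d: "(\<lambda>x. h x - g x) \<in> L2" using assms by (intro L2_diff)
  have "inner_L2 (\<lambda>x. h x - g x) (\<lambda>x. h x - g x)
      = inner_L2 h (\<lambda>x. h x - g x) - inner_L2 g (\<lambda>x. h x - g x)"
    using assms d by (simp add: inner_L2_diff_left)
  also have "\<dots> = inner_L2 (\<lambda>x. h x - g x) h - inner_L2 (\<lambda>x. h x - g x) g"
    by (simp add: inner_L2_commute)
  also have "\<dots> = inner_L2 h h - 2 * inner_L2 h g + inner_L2 g g"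
    using assms by (simp add: inner_L2_diff_left inner_L2_commute[of g h])
  finally show ?thesis .
qed

locale orthonormal_family =
  fixes I :: "'i set" and e :: "'i \<Rightarrow> real \<Rightarrow> real"
  assumes e_L2: "i \<in> I \<Longrightarrow> e i \<in> L2"
    and e_orth: "i \<in> I \<Longrightarrow> i' \<in> I \<Longrightarrow> inner_L2 (e i) (e i') = (if i = i' then 1 else 0)"
begin

lemma comb_L2: "F \<subseteq> I \<Longrightarrow> (\<lambda>x. \<Sum>i\<in>F. c i * e i x) \<in> L2"
  by (intro L2_sum L2_cmult e_L2) auto

lemma inner_comb:
  assumes "finite F" "F \<subseteq> I" "i \<in> I"
  shows "inner_L2 (\<lambda>x. \<Sum>i\<in>F. c i * e i x) (e i) = (if i \<in> F then c i else 0)"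
proof -
  have "inner_L2 (\<lambda>x. \<Sum>i\<in>F. c i * e i x) (e i) = (\<Sum>i'\<in>F. c i' * inner_L2 (e i') (e i))"
    using assms by (subst inner_L2_sum_left) (auto intro!: L2_cmult e_L2 sum.cong simp: inner_L2_cmult_left)
  also have "\<dots> = (\<Sum>i'\<in>F. if i = i' then c i' else 0)"
    using assms by (intro sum.cong refl) (auto simp: e_orth subset_iff)
  finally show ?thesis using assms by simp
qed

lemma inner_comb_right:
  assumes "F \<subseteq> I" "h \<in> L2"
  shows "inner_L2 h (\<lambda>x. \<Sum>i\<in>F. c i * e i x) = (\<Sum>i\<in>F. c i * inner_L2 h (e i))"
proof -
  have "inner_L2 (\<lambda>x. \<Sum>i\<in>F. c i * e i x) h = (\<Sum>i\<in>F. inner_L2 (\<lambda>x. c i * e i x) h)"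
    using assms by (intro inner_L2_sum_left L2_cmult e_L2) auto
  also have "\<dots> = (\<Sum>i\<in>F. c i * inner_L2 h (e i))"
    unfolding inner_L2_cmult_left inner_L2_commute[of "e _" h] ..
  finally show ?thesis unfolding inner_L2_commute[of h] .
qed

lemma inner_comb_comb:
  assumes "finite F" "F \<subseteq> I"
  shows "inner_L2 (\<lambda>x. \<Sum>i\<in>F. c i * e i x) (\<lambda>x. \<Sum>i\<in>F. d i * e i x) = (\<Sum>i\<in>F. c i * d i)"
proof -
  have "inner_L2 (\<lambda>x. \<Sum>i\<in>F. c i * e i x) (e i) = c i" if "i \<in> F" for i
    using inner_comb[OF assms, of i c] that assms by auto
  then show ?thesis
    by (subst inner_comb_right) (auto intro!: sum.cong comb_L2 assms)
qed

text \<open>Completing the square separates the error of the best combination, the one with Fourier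
  coefficients, from the cost of any other choice of \<open>c\<close>. Bessel's inequality says that
  the first part is nonnegative; in \<open>parseval_approx\<close> dropping the second part turns
  density into Parseval's identity.\<close>

lemma dist_comb:
  assumes "finite F" "F \<subseteq> I" "h \<in> L2"
  shows "(norm_L2 (\<lambda>x. h x - (\<Sum>i\<in>F. c i * e i x)))\<^sup>2
    = inner_L2 h h - (\<Sum>i\<in>F. (inner_L2 h (e i))\<^sup>2) + (\<Sum>i\<in>F. (c i - inner_L2 h (e i))\<^sup>2)"
proof -
  have "(norm_L2 (\<lambda>x. h x - (\<Sum>i\<in>F. c i * e i x)))\<^sup>2 =
     inner_L2 h h - 2 * (\<Sum>i\<in>F. c i * inner_L2 h (e i)) + (\<Sum>i\<in>F. c i * c i)"
    unfolding norm_L2_sq inner_L2_diff_self[OF comb_L2[OF assms(2)] assms(3)]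
      inner_comb_comb[OF assms(1,2)] inner_comb_right[OF assms(2,3)] ..
  also have "\<dots> = inner_L2 h h - (\<Sum>i\<in>F. (inner_L2 h (e i))\<^sup>2) + (\<Sum>i\<in>F. (c i - inner_L2 h (e i))\<^sup>2)"
    by (simp add: power2_diff sum.distrib sum_subtractf sum_distrib_left power2_eq_square algebra_simps)
  finally show ?thesis .
qed

lemma bessel:
  assumes "finite F" "F \<subseteq> I" "h \<in> L2"
  shows "(\<Sum>i\<in>F. (inner_L2 h (e i))\<^sup>2) \<le> inner_L2 h h"
proof -
  have "0 \<le> (norm_L2 (\<lambda>x. h x - (\<Sum>i\<in>F. inner_L2 h (e i) * e i x)))\<^sup>2" by simp
  then show ?thesis unfolding dist_comb[OF assms] by simp
qed

end

lemma orthonormal_basis_L2_family: "orthonormal_basis_L2 I e \<Longrightarrow> orthonormal_family I e"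
  by unfold_locales (auto simp: orthonormal_basis_L2_def)

text \<open>Density provides some coefficients \<open>c\<close> with small error, and by
  \<open>dist_comb\<close> the Fourier coefficients do at least as well. The form with
  \<open>\<epsilon>\<close> avoids sums over an infinite index set.\<close>

lemma parseval_approx:
  assumes "orthonormal_basis_L2 I e" "h \<in> L2" "\<epsilon> > 0"
  obtains F where "finite F" "F \<subseteq> I" "inner_L2 h h - (\<Sum>i\<in>F. (inner_L2 h (e i))\<^sup>2) < \<epsilon>"
proof -
  interpret orthonormal_family I e
    by (rule orthonormal_basis_L2_family) fact
  from assms(3) have "sqrt \<epsilon> > 0" by simp
  with assms(1,2) obtain F c where F: "finite F" "F \<subseteq> I"
    "norm_L2 (\<lambda>x. h x - (\<Sum>i\<in>F. c i * e i x)) < sqrt \<epsilon>"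
    unfolding orthonormal_basis_L2_def by blast
  then have "(norm_L2 (\<lambda>x. h x - (\<Sum>i\<in>F. c i * e i x)))\<^sup>2 < (sqrt \<epsilon>)\<^sup>2"
    by (intro power_strict_mono) (auto simp: norm_L2_nonneg)
  moreover have "0 \<le> (\<Sum>i\<in>F. (c i - inner_L2 h (e i))\<^sup>2)"
    by (simp add: sum_nonneg)
  ultimately have "inner_L2 h h - (\<Sum>i\<in>F. (inner_L2 h (e i))\<^sup>2) < \<epsilon>"
    using dist_comb[OF F(1,2) assms(2), of c] assms(3) by simp
  with F that show thesis by blast
qed

section \<open>Compactly supported wavelets\<close>

text \<open>Bounds the number of integer translates of an interval of half-width \<open>L\<close>
  that contain a point. The count does not depend on \<open>x\<close>, which makes the later overlap
  constants uniform in level and location.\<close>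

lemma card_int_interval_le:
  fixes x :: real
  assumes "0 \<le> L"
  shows "card {k::int. \<bar>x - of_int k\<bar> \<le> L} \<le> nat \<lfloor>2 * L\<rfloor> + 1"
    and "finite {k::int. \<bar>x - of_int k\<bar> \<le> L}"
proof -
  have eq: "{k::int. \<bar>x - of_int k\<bar> \<le> L} = {\<lceil>x - L\<rceil>..\<lfloor>x + L\<rfloor>}"
    by (auto simp: abs_le_iff ceiling_le_iff le_floor_iff)
  show "finite {k::int. \<bar>x - of_int k\<bar> \<le> L}" unfolding eq by simp
  have "\<lfloor>x + L\<rfloor> - \<lceil>x - L\<rceil> \<le> \<lfloor>2 * L\<rfloor>"
    by linarith
  moreover have "0 \<le> \<lfloor>2 * L\<rfloor>" using assms by simp
  ultimately show "card {k::int. \<bar>x - of_int k\<bar> \<le> L} \<le> nat \<lfloor>2 * L\<rfloor> + 1"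
    unfolding eq by simp
qed

lemma dilate_measurable [measurable]:
  assumes [measurable]: "\<phi> \<in> borel_measurable borel"
  shows "dilate \<phi> j k \<in> borel_measurable borel"
  unfolding dilate_def[abs_def] by measurable

lemma dilate_0_0: "dilate \<phi> 0 0 = \<phi>"
  by (auto simp: dilate_def)

lemma level_index_simps [simp]:
  "Inl k \<in> A <+> B \<longleftrightarrow> k \<in> A" "Inr i \<in> A <+> B \<longleftrightarrow> i \<in> B"
  by blast+

lemma wavelet_family_simps [simp]:
  "wavelet_family \<phi> \<psi> j (Inl k) = dilate \<phi> j k"
  "wavelet_family \<phi> \<psi> j (Inr (j', k)) = dilate \<psi> j' k"
  by (simp_all add: wavelet_family_def)

lemma powr_half_power2:
  "(2 powr (real j / 2))\<^sup>2 = (2::real) ^ j" "(2 powr (- real j / 2))\<^sup>2 = 1 / (2::real) ^ j"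
proof -
  have "(2 powr (real j / 2))\<^sup>2 = (2::real) powr (real j / 2 + real j / 2)"
    by (simp only: power2_eq_square powr_add)
  then show "(2 powr (real j / 2))\<^sup>2 = (2::real) ^ j" by (simp add: powr_realpow)
  have "(2 powr (- real j / 2))\<^sup>2 = (2::real) powr (- real j / 2 + - real j / 2)"
    by (simp only: power2_eq_square powr_add)
  also have "- real j / 2 + - real j / 2 = - real j" by simp
  also have "(2::real) powr - real j = 1 / 2 ^ j"
    by (simp only: powr_minus_divide powr_realpow[of 2] zero_less_numeral)
  finally show "(2 powr (- real j / 2))\<^sup>2 = 1 / (2::real) ^ j" .
qed

lemma integral_dilate:
  "(LINT x|lborel. dilate g j k x) = 2 powr (- real j / 2) * (LINT x|lborel. g x)"
proof -
  have "(LINT x|lborel. g x) = 2 ^ j * (LINT x|lborel. g (- of_int k + 2 ^ j * x))"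
    using lborel_integral_real_affine[of "2 ^ j" g "- of_int k"] by simp
  then have "(LINT x|lborel. dilate g j k x) = 2 powr (real j / 2) / 2 ^ j * (LINT x|lborel. g x)"
    by (simp add: dilate_def algebra_simps)
  also have "2 powr (real j / 2) / 2 ^ j = (2::real) powr (real j / 2 - real j)"
    by (simp only: powr_diff powr_realpow[of 2] zero_less_numeral)
  also have "real j / 2 - real j = - real j / 2" by simp
  finally show ?thesis .
qed

locale wavelets =
  fixes \<phi> \<psi> :: "real \<Rightarrow> real" and L :: real
  assumes L_pos: "L > 0" and wavelet: "wavelet_system \<phi> \<psi> L"
begin

lemma phi_L2: "\<phi> \<in> L2" and psi_L2: "\<psi> \<in> L2"
  using wavelet by (auto simp: wavelet_system_def)

lemma phi_measurable [measurable]: "\<phi> \<in> borel_measurable borel"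
  and psi_measurable [measurable]: "\<psi> \<in> borel_measurable borel"
  using phi_L2 psi_L2 by (auto intro: L2_measurable)

lemma phi_supp: "\<phi> x \<noteq> 0 \<Longrightarrow> -L \<le> x \<and> x < L"
  and psi_supp: "\<psi> x \<noteq> 0 \<Longrightarrow> -L \<le> x \<and> x < L"
  using wavelet by (auto simp: wavelet_system_def subset_iff)

lemma dilate_phi_supp: "dilate \<phi> j k x \<noteq> 0 \<Longrightarrow> \<bar>2 ^ j * x - of_int k\<bar> \<le> L"
  using phi_supp[of "2 ^ j * x - of_int k"] by (auto simp: dilate_def)

lemma basis: "orthonormal_basis_L2 (UNIV <+> {j..} \<times> UNIV) (wavelet_family \<phi> \<psi> j)"
  using wavelet by (auto simp: wavelet_system_def)

sublocale onf: orthonormal_family "UNIV <+> {j..} \<times> UNIV" "wavelet_family \<phi> \<psi> j" for j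
  by (rule orthonormal_basis_L2_family[OF basis])

lemma dilate_phi_L2: "dilate \<phi> j k \<in> L2"
  using onf.e_L2[of "Inl k" j] by simp

lemma dilate_psi_L2: "dilate \<psi> j k \<in> L2"
  using onf.e_L2[of "Inr (j, k)" j] by simp

lemma dilate_psi_orth:
  "inner_L2 (dilate \<psi> j k) (dilate \<psi> j' k') = (if j = j' \<and> k = k' then 1 else 0)"
  \<comment> \<open>The basis that starts at level \<open>min j j'\<close> contains both wavelets,
    so their orthogonality can be read off there.\<close>
  using onf.e_orth[of "Inr (j, k)" "min j j'" "Inr (j', k')"] by auto

lemma bessel_phi:
  assumes "finite F" "h \<in> L2"
  shows "(\<Sum>k\<in>F. (inner_L2 h (dilate \<phi> j k))\<^sup>2) \<le> inner_L2 h h"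
proof -
  have "(\<Sum>i\<in>Inl ` F. (inner_L2 h (wavelet_family \<phi> \<psi> j i))\<^sup>2) \<le> inner_L2 h h"
    using assms by (intro onf.bessel) auto
  then show ?thesis by (simp add: sum.reindex)
qed

lemma bessel_psi:
  assumes "finite F" "h \<in> L2"
  shows "(\<Sum>(j,k)\<in>F. (inner_L2 h (dilate \<psi> j k))\<^sup>2) \<le> inner_L2 h h"
proof -
  have "(\<Sum>i\<in>Inr ` F. (inner_L2 h (wavelet_family \<phi> \<psi> 0 i))\<^sup>2) \<le> inner_L2 h h"
    using assms by (intro onf.bessel) auto
  then show ?thesis by (simp add: sum.reindex case_prod_unfold wavelet_family_def)
qed

definition phi_bound :: real where "phi_bound = (SOME B. \<forall>x. \<bar>\<phi> x\<bar> \<le> B)"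

lemma phi_bound: "\<bar>\<phi> x\<bar> \<le> phi_bound"
proof -
  have "\<exists>B. \<forall>x. \<bar>\<phi> x\<bar> \<le> B"
    using wavelet unfolding wavelet_system_def bounded_iff by auto
  from someI_ex[OF this] show ?thesis unfolding phi_bound_def by blast
qed

lemma phi_bound_nonneg: "0 \<le> phi_bound"
  using phi_bound[of 0] abs_ge_zero[of "\<phi> 0"] by linarith

lemma dilate_phi_bound: "\<bar>dilate \<phi> j k x\<bar> \<le> 2 powr (real j / 2) * phi_bound"
  by (simp add: dilate_def abs_mult phi_bound mult_left_mono)

subsection \<open>The wavelet has mean zero\<close>

text \<open>The two conditions put the support of the dilated wavelet inside [0, 1], where the
  indicator is 1, so that the inner product is the full integral.\<close>

lemma inner_indicator_dilate_psi:
  assumes "L \<le> of_int k" "of_int k + L \<le> 2 ^ j"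
  shows "inner_L2 (indicat_real {0..1}) (dilate \<psi> j k) = 2 powr (- real j / 2) * (LINT x|lborel. \<psi> x)"
proof -
  have "indicat_real {0..1} x * dilate \<psi> j k x = dilate \<psi> j k x" for x
  proof (cases "\<psi> (2 ^ j * x - of_int k) = 0")
    case False
    then have "-L \<le> 2 ^ j * x - of_int k" "2 ^ j * x - of_int k < L"
      using psi_supp by blast+
    then have "0 \<le> 2 ^ j * x" "2 ^ j * x \<le> 2 ^ j * 1" using assms by linarith+
    moreover have "(0::real) < 2 ^ j" by simp
    ultimately have "0 \<le> x \<and> x \<le> 1"
      by (metis mult_le_cancel_left_pos mult_zero_right)
    then show ?thesis by simp
  qed (simp add: dilate_def)
  then have "(\<lambda>x. indicat_real {0..1} x * dilate \<psi> j k x) = dilate \<psi> j k" by blast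
  then show ?thesis unfolding inner_L2_def by (simp only: integral_dilate)
qed

text \<open>Each high level contributes at least half of the squared mean to the Bessel sum of an
  indicator function.\<close>

lemma psi_integral_zero: "(LINT x|lborel. \<psi> x) = 0"
proof (rule ccontr)
  define m where "m = (LINT x|lborel. \<psi> x)"
  assume "(LINT x|lborel. \<psi> x) \<noteq> 0"
  then have m: "m\<^sup>2 > 0" by (simp add: m_def)
  \<comment> \<open>The set \<open>A j\<close> below has more than 2^j - 2L - 1 elements; from this
    level on that is at least half of 2^j.\<close>
  obtain j0 :: nat where j0: "2 ^ j0 \<ge> 4 * L + 4"
    using real_arch_pow[of 2 "4 * L + 4"] by (auto intro: less_imp_le)
  define A where "A j = {\<lceil>L\<rceil>..\<lfloor>2 ^ j - L\<rfloor>}" for j :: nat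
  have lev: "(\<Sum>k\<in>A j. (inner_L2 (indicat_real {0..1}) (dilate \<psi> j k))\<^sup>2) \<ge> m\<^sup>2 / 2" if "j \<ge> j0" for j
  proof -
    have "(2::real) ^ j0 \<le> 2 ^ j" using that by simp
    then have j: "2 ^ j \<ge> 4 * L + 4" using j0 by linarith
    have "(\<Sum>k\<in>A j. (inner_L2 (indicat_real {0..1}) (dilate \<psi> j k))\<^sup>2) = (\<Sum>k\<in>A j. m\<^sup>2 / 2 ^ j)"
    proof (rule sum.cong[OF refl])
      fix k assume "k \<in> A j"
      then have "L \<le> of_int k" "of_int k + L \<le> 2 ^ j" by (auto simp: A_def ceiling_le_iff le_floor_iff)
      then have "inner_L2 (indicat_real {0..1}) (dilate \<psi> j k) = 2 powr (- real j / 2) * m"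
        unfolding m_def by (rule inner_indicator_dilate_psi)
      then show "(inner_L2 (indicat_real {0..1}) (dilate \<psi> j k))\<^sup>2 = m\<^sup>2 / 2 ^ j"
        by (simp only: power_mult_distrib powr_half_power2) simp
    qed
    also have "\<dots> = real (card (A j)) * (m\<^sup>2 / 2 ^ j)" by simp
    also have "\<dots> \<ge> (2 ^ j / 2) * (m\<^sup>2 / 2 ^ j)"
    proof (rule mult_right_mono)
      have "real_of_int (\<lfloor>2 ^ j - L\<rfloor> - \<lceil>L\<rceil> + 1) \<ge> 2 ^ j / 2"
        using j by linarith
      then show "2 ^ j / 2 \<le> real (card (A j))" by (simp add: A_def)
    qed simp
    finally show ?thesis by simp
  qed
  have sq: "indicat_real {0..1} x * indicat_real {0..1} x = indicat_real {0..1} x" for x :: real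
    by (simp add: indicator_def)
  have ind: "indicat_real {0..1} \<in> L2"
    by (simp add: L2_def power2_eq_square sq)
  have one: "inner_L2 (indicat_real {0..1}) (indicat_real {0..1}) = 1"
    by (simp add: inner_L2_def sq)
  \<comment> \<open>Bessel's inequality: \<open>N\<close> levels contribute at least
    \<open>N\<close> times half the squared mean, and the indicator has squared norm 1.\<close>
  have "real N * (m\<^sup>2 / 2) \<le> 1" for N
  proof -
    have "real N * (m\<^sup>2 / 2) \<le> (\<Sum>j\<in>{j0..<j0+N}. \<Sum>k\<in>A j. (inner_L2 (indicat_real {0..1}) (dilate \<psi> j k))\<^sup>2)"
      using sum_bounded_below[of "{j0..<j0+N}" "m\<^sup>2 / 2"] lev by simp
    also have "\<dots> = (\<Sum>(j,k)\<in>Sigma {j0..<j0+N} A. (inner_L2 (indicat_real {0..1}) (dilate \<psi> j k))\<^sup>2)"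
      by (subst sum.Sigma) (auto simp: A_def)
    also have "\<dots> \<le> 1"
      using bessel_psi[of "Sigma {j0..<j0+N} A", OF _ ind] one by (auto simp: A_def)
    finally show ?thesis .
  qed
  moreover obtain N where "real N * (m\<^sup>2 / 2) > 1"
    using reals_Archimedean3[of "m\<^sup>2 / 2"] m by (meson half_gt_zero)
  ultimately show False by (meson not_less)
qed

subsection \<open>The wavelet is essentially bounded\<close>

text \<open>At level 1 the mother wavelet is orthogonal to all wavelets, so it is a combination of the
  finitely many dilated scaling functions whose support meets its own.\<close>

lemma psi_AE_bounded: obtains B where "B > 0" "AE x in lborel. \<bar>\<psi> x\<bar> \<le> B"
proof -
  \<comment> \<open>The supports of the wavelet and of \<open>dilate \<phi> 1 k\<close> meet only if
    |x| <= L and |2x - k| <= L for some x, hence |k| <= 3L.\<close>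
  define S :: "int set" where "S = {k. \<bar>0 - of_int k\<bar> \<le> 3 * L}"
  have finS: "finite S" unfolding S_def using L_pos by (intro card_int_interval_le) auto
  define c where "c k = inner_L2 \<psi> (dilate \<phi> 1 k)" for k
  define g where "g x = (\<Sum>k\<in>S. c k * dilate \<phi> 1 k x)" for x
  have c0: "c k = 0" if "k \<notin> S" for k
  proof -
    have "\<psi> x * dilate \<phi> 1 k x = 0" for x
    proof (rule ccontr)
      assume "\<psi> x * dilate \<phi> 1 k x \<noteq> 0"
      then have "-L \<le> x \<and> x < L" "-L \<le> 2 * x - of_int k \<and> 2 * x - of_int k < L"
        using psi_supp[of x] phi_supp[of "2 * x - of_int k"] by (auto simp: dilate_def)
      then have "\<bar>0 - real_of_int k\<bar> \<le> 3 * L" by linarith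
      with that show False by (simp add: S_def)
    qed
    then have "(\<lambda>x. \<psi> x * dilate \<phi> 1 k x) = (\<lambda>x. 0)" by blast
    then show ?thesis by (simp add: c_def inner_L2_def del: mult_eq_0_iff)
  qed
  \<comment> \<open>The mother wavelet is itself a member of the orthonormal system, at level 0 and
    position 0.\<close>
  have d0: "inner_L2 \<psi> (dilate \<psi> j k) = 0" if "j \<ge> 1" for j k
    using dilate_psi_orth[of 0 0 j k] that by (simp add: dilate_0_0)
  have gL2: "g \<in> L2" unfolding g_def by (intro L2_sum L2_cmult dilate_phi_L2)
  have dist: "(norm_L2 (\<lambda>x. \<psi> x - g x))\<^sup>2 = inner_L2 \<psi> \<psi> - (\<Sum>k\<in>S. (c k)\<^sup>2)"
    using onf.dist_comb[of "Inl ` S" 1 \<psi> "\<lambda>i. case i of Inl k \<Rightarrow> c k | Inr _ \<Rightarrow> 0"] finS psi_L2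
    by (simp add: sum.reindex g_def[abs_def] c_def image_subset_iff)
  \<comment> \<open>Parseval at level 1: all coefficients other than those of \<open>S\<close>
    vanish, so the sum over \<open>F\<close> cannot exceed the one over \<open>S\<close>, and the
    distance given by \<open>dist\<close> is below every positive number.\<close>
  have "(norm_L2 (\<lambda>x. \<psi> x - g x))\<^sup>2 \<le> \<epsilon>" if "\<epsilon> > 0" for \<epsilon>
  proof -
    obtain F where F: "finite F" "F \<subseteq> UNIV <+> {1..} \<times> UNIV"
      "inner_L2 \<psi> \<psi> - (\<Sum>i\<in>F. (inner_L2 \<psi> (wavelet_family \<phi> \<psi> 1 i))\<^sup>2) < \<epsilon>"
      using parseval_approx[OF basis psi_L2 \<open>\<epsilon> > 0\<close>] by metis
    have "(\<Sum>i\<in>F. (inner_L2 \<psi> (wavelet_family \<phi> \<psi> 1 i))\<^sup>2)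
        = (\<Sum>i\<in>F \<inter> Inl ` S. (inner_L2 \<psi> (wavelet_family \<phi> \<psi> 1 i))\<^sup>2)"
    proof (rule sum.mono_neutral_right[OF F(1)])
      show "\<forall>i\<in>F - F \<inter> Inl ` S. (inner_L2 \<psi> (wavelet_family \<phi> \<psi> 1 i))\<^sup>2 = 0"
      proof
        fix i assume i: "i \<in> F - F \<inter> Inl ` S"
        then consider k where "i = Inl k" "k \<notin> S" | j k where "i = Inr (j, k)" "j \<ge> 1"
          using F(2) by (cases i) auto
        then show "(inner_L2 \<psi> (wavelet_family \<phi> \<psi> 1 i))\<^sup>2 = 0"
          using c0 d0 by cases (auto simp: c_def)
      qed
    qed auto
    also have "\<dots> \<le> (\<Sum>i\<in>Inl ` S. (inner_L2 \<psi> (wavelet_family \<phi> \<psi> 1 i))\<^sup>2)"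
      using finS by (intro sum_mono2) auto
    also have "\<dots> = (\<Sum>k\<in>S. (c k)\<^sup>2)" by (simp add: sum.reindex c_def)
    finally show ?thesis using F(3) dist by simp
  qed
  then have "(norm_L2 (\<lambda>x. \<psi> x - g x))\<^sup>2 \<le> 0" by (rule field_le_epsilon) auto
  then have "(LINT x|lborel. (\<psi> x - g x)\<^sup>2) = 0"
    by (simp add: norm_L2_def antisym)
  moreover have "integrable lborel (\<lambda>x. (\<psi> x - g x)\<^sup>2)"
    using L2_diff[OF psi_L2 gL2] by (simp add: L2_def)
  ultimately have ae: "AE x in lborel. (\<psi> x - g x)\<^sup>2 = 0"
    by (subst (asm) integral_nonneg_eq_0_iff_AE) auto
  define B where "B = (\<Sum>k\<in>S. \<bar>c k\<bar> * (2 powr (real 1 / 2) * phi_bound)) + 1"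
  have gB: "\<bar>g x\<bar> \<le> B" for x
  proof -
    have "\<bar>g x\<bar> \<le> (\<Sum>k\<in>S. \<bar>c k * dilate \<phi> 1 k x\<bar>)" unfolding g_def by (rule sum_abs)
    also have "\<dots> \<le> (\<Sum>k\<in>S. \<bar>c k\<bar> * (2 powr (real 1 / 2) * phi_bound))"
      unfolding abs_mult by (intro sum_mono mult_left_mono dilate_phi_bound) auto
    finally show ?thesis by (simp add: B_def)
  qed
  have "B > 0" unfolding B_def
    by (intro add_nonneg_pos sum_nonneg) (auto simp: phi_bound_nonneg)
  moreover have "AE x in lborel. \<bar>\<psi> x\<bar> \<le> B"
    using ae
  proof eventually_elim
    case (elim x)
    then have "\<psi> x = g x" by simp
    then show ?case using gB[of x] by simp
  qed
  ultimately show thesis by (rule that)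
qed

end

section \<open>Gram matrices and dual weights\<close>

lemma symmetric_inner_matrix_vector:
  fixes A :: "real ^ 'm ^ 'm"
  assumes "transpose A = A"
  shows "x \<bullet> (A *v y) = (A *v x) \<bullet> y"
  using dot_lmul_matrix[of x A y] assms by (metis vector_transpose_matrix)

lemma symmetric_eigenvectors_orthogonal:
  fixes A :: "real ^ 'm ^ 'm"
  assumes "transpose A = A" "A *v v = \<mu> *\<^sub>R v" "A *v w = \<nu> *\<^sub>R w" "\<mu> \<noteq> \<nu>"
  shows "v \<bullet> w = 0"
proof -
  have "\<nu> * (v \<bullet> w) = \<mu> * (v \<bullet> w)"
    using symmetric_inner_matrix_vector[OF assms(1), of v w] assms(2,3) by simp
  with assms(4) show ?thesis by simp
qed

text \<open>Eigenvectors of different eigenvalues are orthogonal, hence independent, and there are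
  only finitely many of them. Finiteness matters because \<open>smallest_eigenvalue\<close> is a
  \<open>Min\<close>, which is meaningful only for a finite nonempty set.\<close>

lemma finite_eigenvalues_symmetric:
  fixes A :: "real ^ 'm ^ 'm"
  assumes sym: "transpose A = A"
  shows "finite (eigenvalues A)"
proof -
  define v where "v \<mu> = (SOME v. v \<noteq> 0 \<and> A *v v = \<mu> *\<^sub>R v)" for \<mu>
  have v: "v \<mu> \<noteq> 0" "A *v v \<mu> = \<mu> *\<^sub>R v \<mu>" if "\<mu> \<in> eigenvalues A" for \<mu>
  proof -
    have "\<exists>v. v \<noteq> 0 \<and> A *v v = \<mu> *\<^sub>R v" using that by (auto simp: eigenvalues_def)
    from someI_ex[OF this] show "v \<mu> \<noteq> 0" "A *v v \<mu> = \<mu> *\<^sub>R v \<mu>" by (auto simp: v_def)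
  qed
  have orth: "v \<mu> \<bullet> v \<nu> = 0" if "\<mu> \<in> eigenvalues A" "\<nu> \<in> eigenvalues A" "\<mu> \<noteq> \<nu>" for \<mu> \<nu>
    using symmetric_eigenvectors_orthogonal[OF sym v(2)[OF that(1)] v(2)[OF that(2)] that(3)] .
  have inj: "inj_on v (eigenvalues A)"
    using orth v(1) by (intro inj_onI) (metis inner_eq_zero_iff)
  have "pairwise orthogonal (v ` eigenvalues A)"
    using orth by (auto simp: pairwise_def orthogonal_def)
  moreover have "0 \<notin> v ` eigenvalues A" using v(1) by force
  ultimately have "finite (v ` eigenvalues A)"
    using pairwise_orthogonal_independent independent_imp_finite by blast
  then show ?thesis using inj by (rule finite_imageD)
qed

text \<open>The first-order condition at a minimum, without derivatives: if the linear coefficient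
  were nonzero, a small step against its sign would make the expression negative.\<close>

lemma quadratic_nonneg_imp_linear_zero:
  fixes b c :: real
  assumes "\<And>t. 0 \<le> 2 * t * b + t\<^sup>2 * c"
  shows "b = 0"
proof (rule ccontr)
  assume "b \<noteq> 0"
  have c: "0 \<le> c" using assms[of 1] assms[of "-1"] by simp
  \<comment> \<open>The vertex is at -b/c; adding 1 to \<open>c\<close> keeps the quotient defined
    when \<open>c = 0\<close>, and the value there is still negative.\<close>
  define d where "d = c + 1"
  define t where "t = - b / d"
  have d: "d \<noteq> 0" "c = d - 1" using c by (auto simp: d_def)
  have "2 * t * b + t\<^sup>2 * c = (b\<^sup>2 / d\<^sup>2) * (- d - 1)"
    unfolding t_def d(2) using d(1) by (simp add: field_simps power2_eq_square)
  also have "\<dots> < 0" using c d(1) \<open>b \<noteq> 0\<close> by (intro mult_pos_neg) (auto simp: d_def)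
  finally show False using assms[of t] by simp
qed

text \<open>The quadratic form attains its minimum \<open>\<mu>\<close> on the compact unit sphere,
  at \<open>v\<close> say. Moving \<open>v\<close> along the residual
  \<open>r = A *v v - \<mu> *\<^sub>R v\<close> turns the homogeneous inequality into a nonnegative
  quadratic in \<open>t\<close> without constant term, whose linear coefficient comes from
  \<open>r \<bullet> r\<close>. This has to vanish, so \<open>v\<close> is an eigenvector.\<close>

lemma symmetric_rayleigh_minimum:
  fixes A :: "real ^ 'm ^ 'm"
  assumes sym: "transpose A = A"
  obtains \<mu> where "\<mu> \<in> eigenvalues A" "\<And>x. \<mu> * (x \<bullet> x) \<le> x \<bullet> (A *v x)"
proof -
  let ?S = "sphere (0::real ^ 'm) 1"
  have "?S \<noteq> {}" by simp
  moreover have "continuous_on ?S (\<lambda>x. x \<bullet> (A *v x))"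
    by (intro continuous_on_inner continuous_on_id linear_continuous_on
        matrix_vector_mul_bounded_linear)
  ultimately obtain v where v: "v \<in> ?S" "\<And>x. x \<in> ?S \<Longrightarrow> v \<bullet> (A *v v) \<le> x \<bullet> (A *v x)"
    using continuous_attains_inf[of ?S "\<lambda>x. x \<bullet> (A *v x)"] by auto
  define \<mu> where "\<mu> = v \<bullet> (A *v v)"
  have vv: "v \<bullet> v = 1" "v \<noteq> 0" using v(1) by (auto simp: norm_eq_1)
  have min: "\<mu> * (x \<bullet> x) \<le> x \<bullet> (A *v x)" for x
  proof (cases "x = 0")
    case False
    define y where "y = (1 / norm x) *\<^sub>R x"
    have "y \<in> ?S" using False by (simp add: y_def)
    then have "\<mu> \<le> y \<bullet> (A *v y)" using v(2) by (simp add: \<mu>_def)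
    also have "\<dots> = (x \<bullet> (A *v x)) / (x \<bullet> x)"
      by (simp add: y_def matrix_vector_mult_scaleR dot_square_norm power2_eq_square)
    finally show ?thesis using False by (simp add: field_simps)
  qed simp
  define r where "r = A *v v - \<mu> *\<^sub>R v"
  have "r \<bullet> r = 0"
  proof (rule quadratic_nonneg_imp_linear_zero)
    fix t :: real
    have "\<mu> * ((v + t *\<^sub>R r) \<bullet> (v + t *\<^sub>R r)) \<le> (v + t *\<^sub>R r) \<bullet> (A *v (v + t *\<^sub>R r))"
      by (rule min)
    also have "\<dots> = \<mu> + 2 * t * (r \<bullet> (A *v v)) + t\<^sup>2 * (r \<bullet> (A *v r))"
      using symmetric_inner_matrix_vector[OF sym, of v r]
      by (simp add: matrix_vector_mult_scaleR matrix_vector_right_distrib inner_add_left inner_add_right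
          power2_eq_square \<mu>_def inner_commute[of r "A *v v"] algebra_simps)
    also have "(v + t *\<^sub>R r) \<bullet> (v + t *\<^sub>R r) = 1 + 2 * t * (r \<bullet> v) + t\<^sup>2 * (r \<bullet> r)"
      using vv by (simp add: inner_add_left inner_add_right power2_eq_square inner_commute[of v r]
          distrib_left)
    finally have "0 \<le> 2 * t * (r \<bullet> (A *v v) - \<mu> * (r \<bullet> v)) + t\<^sup>2 * (r \<bullet> (A *v r) - \<mu> * (r \<bullet> r))"
      by (simp add: algebra_simps)
    also have "r \<bullet> (A *v v) - \<mu> * (r \<bullet> v) = r \<bullet> r"
      by (simp add: r_def inner_diff_right inner_diff_left)
    finally show "0 \<le> 2 * t * (r \<bullet> r) + t\<^sup>2 * (r \<bullet> (A *v r) - \<mu> * (r \<bullet> r))" .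
  qed
  then have "A *v v = \<mu> *\<^sub>R v" by (simp add: r_def)
  then have "\<mu> \<in> eigenvalues A" using vv(2) by (auto simp: eigenvalues_def)
  with min that show thesis by blast
qed

text \<open>It suffices that the Rayleigh minimum is among the eigenvalues: the smallest eigenvalue
  cannot exceed it.\<close>

lemma smallest_eigenvalue_rayleigh:
  fixes A :: "real ^ 'm ^ 'm"
  assumes sym: "transpose A = A"
  shows "smallest_eigenvalue A * (x \<bullet> x) \<le> x \<bullet> (A *v x)"
proof -
  obtain \<mu> where \<mu>: "\<mu> \<in> eigenvalues A" "\<And>x. \<mu> * (x \<bullet> x) \<le> x \<bullet> (A *v x)"
    using symmetric_rayleigh_minimum[OF sym] by blast
  have "smallest_eigenvalue A \<le> \<mu>"
    unfolding smallest_eigenvalue_def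
    using finite_eigenvalues_symmetric[OF sym] \<mu>(1) by (rule Min_le)
  then have "smallest_eigenvalue A * (x \<bullet> x) \<le> \<mu> * (x \<bullet> x)" by (intro mult_right_mono) auto
  with \<mu>(2)[of x] show ?thesis by linarith
qed

lemma transpose_gram: "transpose (gram w n) = gram w n"
  by (simp add: gram_def transpose_def mult.commute)

lemma inner_gram: "x \<bullet> (gram w n *v x) = (\<Sum>i\<in>{1..n}. (\<Sum>u\<in>UNIV. x $ u * w u i)\<^sup>2)"
proof -
  have "x \<bullet> (gram w n *v x) = (\<Sum>u\<in>UNIV. \<Sum>v\<in>UNIV. \<Sum>i\<in>{1..n}. (x $ u * w u i) * (x $ v * w v i))"
    by (simp add: inner_vec_def matrix_vector_mult_def gram_def sum_distrib_left sum_distrib_right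
        mult.assoc mult.commute mult.left_commute)
  also have "\<dots> = (\<Sum>u\<in>UNIV. \<Sum>i\<in>{1..n}. \<Sum>v\<in>UNIV. (x $ u * w u i) * (x $ v * w v i))"
    by (intro sum.cong refl) (rule sum.swap)
  also have "\<dots> = (\<Sum>i\<in>{1..n}. \<Sum>u\<in>UNIV. \<Sum>v\<in>UNIV. (x $ u * w u i) * (x $ v * w v i))"
    by (rule sum.swap)
  also have "\<dots> = (\<Sum>i\<in>{1..n}. (\<Sum>u\<in>UNIV. x $ u * w u i)\<^sup>2)"
    by (simp add: power2_eq_square sum_product)
  finally show ?thesis .
qed

section \<open>Mixing weights of one sample and their dual weights\<close>

locale spread_weights =
  fixes w :: "'m::finite \<Rightarrow> nat \<Rightarrow> real" and n :: nat and K :: real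
  assumes K_pos: "0 < K" and n_pos: "0 < n" and mixing: "mixing_weights w n"
    and smallest: "smallest_eigenvalue (gram w n) \<ge> K * real n"
begin

lemma weight_nonneg: "i \<in> {1..n} \<Longrightarrow> 0 \<le> w u i"
  and weight_sum: "i \<in> {1..n} \<Longrightarrow> (\<Sum>u\<in>UNIV. w u i) = 1"
  using mixing by (auto simp: mixing_weights_def)

lemma weight_le_1: "i \<in> {1..n} \<Longrightarrow> w u i \<le> 1"
  using member_le_sum[of u UNIV "\<lambda>u. w u i"] weight_nonneg weight_sum by auto

lemma gram_lower: "K * real n * (x \<bullet> x) \<le> x \<bullet> (gram w n *v x)"
  using smallest_eigenvalue_rayleigh[OF transpose_gram, of w n x]
    mult_right_mono[OF smallest, of "x \<bullet> x"] by simp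

lemma invertible_gram: "invertible (gram w n)"
proof -
  have "x = 0" if "gram w n *v x = 0" for x
  proof -
    have "K * real n * (x \<bullet> x) \<le> 0" using gram_lower[of x] that by simp
    then have "x \<bullet> x \<le> 0" using K_pos n_pos by (simp add: mult_le_0_iff)
    then show "x = 0" using inner_gt_zero_iff[of x] by fastforce
  qed
  then have "\<exists>B. B ** gram w n = mat 1" using matrix_left_invertible_ker by blast
  then show ?thesis by (simp add: invertible_left_inverse)
qed

abbreviation G where "G \<equiv> matrix_inv (gram w n)"

lemma G_gram: "G ** gram w n = mat 1" and gram_G: "gram w n ** G = mat 1"
  unfolding matrix_inv_def
  using someI_ex[OF invertible_gram[unfolded invertible_def]] by auto

lemma dual_weight_biorthogonal:
  "(\<Sum>i\<in>{1..n}. w u i * dual_weight w n l i) = (if u = l then real n else 0)"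
proof -
  have "(\<Sum>i\<in>{1..n}. w u i * dual_weight w n l i)
      = (\<Sum>i\<in>{1..n}. \<Sum>v\<in>UNIV. real n * (G $ l $ v * (w v i * w u i)))"
    by (simp add: dual_weight_def sum_distrib_left mult.assoc mult.left_commute mult.commute)
  also have "\<dots> = (\<Sum>v\<in>UNIV. \<Sum>i\<in>{1..n}. real n * (G $ l $ v * (w v i * w u i)))"
    by (rule sum.swap)
  also have "\<dots> = real n * (G ** gram w n) $ l $ u"
    by (simp add: matrix_matrix_mult_def gram_def sum_distrib_left)
  also have "\<dots> = (if u = l then real n else 0)" by (simp add: G_gram mat_def)
  finally show ?thesis .
qed

text \<open>Write \<open>S\<close> for the sum and \<open>x\<close> for row \<open>l\<close> of the
  inverse Gram matrix. Biorthogonality gives S = n^2 x_l, while expanding the squares gives S = n^2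
  times the Gram form at \<open>x\<close>, which is at least n^2 K n x_l^2 = (K/n) S^2. So (K/n) S^2
  <= S. This estimate makes the bias of the statistic of order 1/n.\<close>

lemma dual_weight_sum_squares: "(\<Sum>i\<in>{1..n}. (dual_weight w n l i)\<^sup>2) \<le> real n / K"
proof -
  define S where "S = (\<Sum>i\<in>{1..n}. (dual_weight w n l i)\<^sup>2)"
  define x where "x = G $ l"
  have d: "dual_weight w n l i = real n * (\<Sum>u\<in>UNIV. x $ u * w u i)" for i
    by (simp add: dual_weight_def x_def)
  have "S = (\<Sum>i\<in>{1..n}. \<Sum>u\<in>UNIV. (real n * x $ u) * (w u i * dual_weight w n l i))"
    unfolding S_def power2_eq_square
    by (subst (1) d) (simp add: sum_distrib_left sum_distrib_right mult.assoc)
  also have "\<dots> = (\<Sum>u\<in>UNIV. \<Sum>i\<in>{1..n}. (real n * x $ u) * (w u i * dual_weight w n l i))"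
    by (rule sum.swap)
  also have "\<dots> = (\<Sum>u\<in>UNIV. (real n * x $ u) * (if u = l then real n else 0))"
    by (simp only: sum_distrib_left[symmetric] dual_weight_biorthogonal)
  also have "\<dots> = (real n)\<^sup>2 * x $ l" by (simp add: power2_eq_square if_distrib cong: if_cong)
  finally have S1: "S = (real n)\<^sup>2 * x $ l" .
  have "S = (real n)\<^sup>2 * (x \<bullet> (gram w n *v x))"
    by (simp only: S_def d inner_gram power_mult_distrib sum_distrib_left[symmetric])
  moreover have "K * real n * (x $ l)\<^sup>2 \<le> x \<bullet> (gram w n *v x)"
  proof -
    have "(x $ l)\<^sup>2 \<le> x \<bullet> x"
      unfolding inner_vec_def power2_eq_square inner_real_def
      by (rule member_le_sum[of l UNIV "\<lambda>i. x $ i * x $ i"]) auto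
    then have "K * real n * (x $ l)\<^sup>2 \<le> K * real n * (x \<bullet> x)"
      using K_pos by (intro mult_left_mono) auto
    with gram_lower[of x] show ?thesis by linarith
  qed
  ultimately have "(real n)\<^sup>2 * (K * real n * (x $ l)\<^sup>2) \<le> S"
    by (simp add: mult_left_mono)
  moreover have "(real n)\<^sup>2 * (K * real n * (x $ l)\<^sup>2) = K / real n * S\<^sup>2"
    using n_pos by (simp add: S1 power2_eq_square field_simps)
  ultimately have le: "K / real n * S\<^sup>2 \<le> S" by simp
  have "S \<le> real n / K"
  proof (cases "S > 0")
    case True
    from le have "(K / real n * S) * S \<le> 1 * S" by (simp add: power2_eq_square mult.assoc)
    with True have "K / real n * S \<le> 1" using mult_le_cancel_right_pos by blast
    then show ?thesis using K_pos n_pos by (simp add: field_simps)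
  next
    case False
    have "0 \<le> real n / K" using K_pos by simp
    with False show ?thesis by linarith
  qed
  then show ?thesis by (simp add: S_def)
qed

text \<open>The Gram form at the basis vector of \<open>v\<close> is the sum of the squared weights
  of \<open>v\<close>; it is at least \<open>K * real n\<close>, and each square is at most 1. The
  count supplies enough observations that can come from component \<open>v\<close>.\<close>

lemma card_positive_weight: "K * real n \<le> real (card {i\<in>{1..n}. 0 < w v i})"
proof -
  have "K * real n \<le> (\<Sum>i\<in>{1..n}. (\<Sum>u\<in>UNIV. axis v 1 $ u * w u i)\<^sup>2)"
    using gram_lower[of "axis v 1"] by (simp add: inner_gram inner_axis_axis)
  also have "\<dots> = (\<Sum>i\<in>{1..n}. (w v i)\<^sup>2)"
    by (simp add: axis_def if_distrib[of "\<lambda>x. x * _"] cong: if_cong)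
  also have "\<dots> \<le> (\<Sum>i\<in>{1..n}. if 0 < w v i then 1 else 0)"
  proof (rule sum_mono)
    fix i assume "i \<in> {1..n}"
    with weight_nonneg[of i v] weight_le_1[of i v] show "(w v i)\<^sup>2 \<le> (if 0 < w v i then 1 else 0)"
      by (auto simp: power_le_one)
  qed
  also have "\<dots> = real (card {i\<in>{1..n}. 0 < w v i})"
    by (simp add: sum.If_cases Int_def conj_commute)
  finally show ?thesis .
qed

text \<open>Up to the factor n, the dual weights at \<open>i\<close> are the image of the weight
  vector under an invertible matrix, and the weight vector is not zero since it sums to 1.\<close>

lemma dual_weight_nonzero:
  assumes "i \<in> {1..n}"
  shows "\<exists>l. dual_weight w n l i \<noteq> 0"
proof (rule ccontr)
  assume "\<nexists>l. dual_weight w n l i \<noteq> 0"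
  then have z: "G *v (\<chi> u. w u i) = 0"
    using n_pos by (simp add: dual_weight_def matrix_vector_mult_def vec_eq_iff)
  have "(\<chi> u. w u i) = gram w n *v (G *v (\<chi> u. w u i))"
    by (simp add: matrix_vector_mul_assoc gram_G)
  then have "w u i = 0" for u by (simp add: z vec_eq_iff)
  then show False using weight_sum[OF assms] by simp
qed

text \<open>More than \<open>M\<close> nonzero vectors of dual weights cannot be pairwise orthogonal.\<close>

lemma exists_correlated_dual_weights:
  assumes "real CARD('m) < K * real n"
  obtains i1 i2 where "i1 \<in> {1..n}" "i2 \<in> {1..n}" "i1 \<noteq> i2" "0 < w v i1" "0 < w v i2"
    "(\<Sum>l\<in>UNIV. dual_weight w n l i1 * dual_weight w n l i2) \<noteq> 0"
proof -
  define I where "I = {i\<in>{1..n}. 0 < w v i}"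
  define a :: "nat \<Rightarrow> real ^ 'm" where "a i = (\<chi> l. dual_weight w n l i)" for i
  have a0: "a i \<noteq> 0" if "i \<in> I" for i
    using dual_weight_nonzero[of i] that by (auto simp: I_def a_def vec_eq_iff)
  have "\<exists>i1\<in>I. \<exists>i2\<in>I. i1 \<noteq> i2 \<and> a i1 \<bullet> a i2 \<noteq> 0"
  proof (rule ccontr)
    assume "\<not> ?thesis"
    then have orth: "a i1 \<bullet> a i2 = 0" if "i1 \<in> I" "i2 \<in> I" "i1 \<noteq> i2" for i1 i2
      using that by blast
    have inj: "inj_on a I"
      using orth a0 by (intro inj_onI) (metis inner_eq_zero_iff)
    have "pairwise orthogonal (a ` I)"
      using orth by (auto simp: pairwise_def orthogonal_def)
    moreover have "0 \<notin> a ` I" using a0 by force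
    ultimately have "independent (a ` I)" by (rule pairwise_orthogonal_independent)
    then have "card (a ` I) \<le> CARD('m)" using independent_bound[of "a ` I"] by simp
    then have "card I \<le> CARD('m)" using inj by (simp add: card_image)
    with card_positive_weight[of v] assms show False by (simp add: I_def)
  qed
  then obtain i1 i2 where "i1 \<in> I" "i2 \<in> I" "i1 \<noteq> i2" "a i1 \<bullet> a i2 \<noteq> 0" by blast
  with that[of i1 i2] show thesis by (simp add: I_def a_def inner_vec_def)
qed

end

section \<open>Finite products of probability spaces\<close>

lemma (in prob_space) integrable_bounded:
  fixes f :: "'a \<Rightarrow> real"
  assumes "f \<in> borel_measurable M" "\<And>x. \<bar>f x\<bar> \<le> B"
  shows "integrable M f"
  using assms by (intro integrable_const_bound[where B=B]) auto

locale finite_prob_product =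
  fixes I :: "nat set" and N :: "nat \<Rightarrow> real measure"
  assumes finite_I: "finite I" and prob_N: "i \<in> I \<Longrightarrow> prob_space (N i)"
begin

text \<open>The library locale for products wants every factor, also outside \<open>I\<close>, to be
  a probability space.\<close>

definition N' :: "nat \<Rightarrow> real measure" where
  "N' i = (if i \<in> I then N i else return borel 0)"

lemma prob_N': "prob_space (N' i)"
  by (auto simp: N'_def prob_N intro: prob_space_return)

lemma PiM_N': "PiM I N = PiM I N'"
  by (intro PiM_cong) (auto simp: N'_def)

lemma product_sigma_finite_N': "product_sigma_finite N'"
  by (intro product_sigma_finite.intro prob_space_imp_sigma_finite prob_N')

lemma prob_space_PiM_N: "prob_space (PiM I N)"
  by (intro prob_space_PiM prob_N)

lemma emeasure_box:
  assumes "\<And>i. i \<in> I \<Longrightarrow> A i \<in> sets (N i)"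
  shows "emeasure (PiM I N) (Pi\<^sub>E I A) = (\<Prod>i\<in>I. emeasure (N i) (A i))"
proof -
  have "emeasure (PiM I N') (Pi\<^sub>E I A) = (\<Prod>i\<in>I. emeasure (N' i) (A i))"
    using assms by (intro product_sigma_finite.emeasure_PiM[OF product_sigma_finite_N' finite_I])
      (simp add: N'_def)
  then show ?thesis by (simp add: PiM_N' N'_def cong: prod.cong)
qed

lemma integral_prod:
  fixes f :: "nat \<Rightarrow> real \<Rightarrow> real"
  assumes "\<And>i. i \<in> I \<Longrightarrow> integrable (N i) (f i)"
  shows "(LINT x|PiM I N. (\<Prod>i\<in>I. f i (x i))) = (\<Prod>i\<in>I. LINT t|N i. f i t)"
    and "integrable (PiM I N) (\<lambda>x. \<Prod>i\<in>I. f i (x i))"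
proof -
  have "(LINT x|PiM I N'. (\<Prod>i\<in>I. f i (x i))) = (\<Prod>i\<in>I. LINT t|N' i. f i t)"
    using assms by (intro product_sigma_finite.product_integral_prod[OF product_sigma_finite_N' finite_I])
      (simp add: N'_def)
  then show "(LINT x|PiM I N. (\<Prod>i\<in>I. f i (x i))) = (\<Prod>i\<in>I. LINT t|N i. f i t)"
    by (simp add: PiM_N' N'_def cong: prod.cong)
  have "integrable (PiM I N') (\<lambda>x. \<Prod>i\<in>I. f i (x i))"
    using assms by (intro product_sigma_finite.product_integrable_prod[OF product_sigma_finite_N' finite_I])
      (simp add: N'_def)
  then show "integrable (PiM I N) (\<lambda>x. \<Prod>i\<in>I. f i (x i))" by (simp add: PiM_N')
qed

lemma integral_component:
  fixes f :: "real \<Rightarrow> real"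
  assumes "i \<in> I" "integrable (N i) f"
  shows "(LINT x|PiM I N. f (x i)) = (LINT t|N i. f t)"
proof -
  define F where "F k = (if k = i then f else (\<lambda>_. 1))" for k
  have int: "integrable (N k) (F k)" if "k \<in> I" for k
    using assms that prob_N[of k] by (auto simp: F_def prob_space_def finite_measure.integrable_const)
  have "(\<Prod>k\<in>I. F k (x k)) = f (x i)" for x
    using assms(1) finite_I by (simp add: F_def prod.remove[of I i])
  moreover have "(\<Prod>k\<in>I. LINT t|N k. F k t) = (LINT t|N i. f t)"
    using assms(1) finite_I prob_N
    by (simp add: F_def prod.remove[of I i] prob_space.prob_space)
  ultimately show ?thesis using integral_prod(1)[OF int] by simp
qed

lemma integral_two_components:
  fixes f g :: "real \<Rightarrow> real"
  assumes "i \<in> I" "i' \<in> I" "i \<noteq> i'" "integrable (N i) f" "integrable (N i') g"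
  shows "(LINT x|PiM I N. f (x i) * g (x i')) = (LINT t|N i. f t) * (LINT t|N i'. g t)"
proof -
  define F where "F k = (if k = i then f else if k = i' then g else (\<lambda>_. 1))" for k
  have int: "integrable (N k) (F k)" if "k \<in> I" for k
    using assms that prob_N[of k] by (auto simp: F_def prob_space_def finite_measure.integrable_const)
  have split: "prod H I = H i * H i'" if "\<And>k. k \<in> I - {i, i'} \<Longrightarrow> H k = 1" for H :: "nat \<Rightarrow> real"
  proof -
    have "prod H I = prod H {i, i'}"
      using that assms(1,2) finite_I by (intro prod.mono_neutral_right) auto
    then show ?thesis using assms(3) by simp
  qed
  have "(\<Prod>k\<in>I. F k (x k)) = f (x i) * g (x i')" for x
    using assms(3) by (subst split) (auto simp: F_def)
  moreover have "(\<Prod>k\<in>I. LINT t|N k. F k t) = (LINT t|N i. f t) * (LINT t|N i'. g t)"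
    using assms(3) prob_N by (subst split) (auto simp: F_def prob_space.prob_space)
  ultimately show ?thesis using integral_prod(1)[OF int] by simp
qed

end

lemma integral_pair_prob:
  fixes f :: "'a \<Rightarrow> real" and g :: "'b \<Rightarrow> real"
  assumes P: "prob_space P" and Q: "prob_space Q"
    and f: "f \<in> borel_measurable P" "\<And>x. \<bar>f x\<bar> \<le> A"
    and g: "g \<in> borel_measurable Q" "\<And>x. \<bar>g x\<bar> \<le> B"
  shows "(LINT x|(P \<Otimes>\<^sub>M Q). f (fst x) * g (snd x)) = (LINT x|P. f x) * (LINT x|Q. g x)"
proof -
  interpret P: prob_space P by fact
  interpret Q: prob_space Q by fact
  interpret PQ: pair_prob_space P Q by standard
  have "integrable (P \<Otimes>\<^sub>M Q) (\<lambda>x. f (fst x) * g (snd x))"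
  proof (rule PQ.P.integrable_bounded)
    show "(\<lambda>x. f (fst x) * g (snd x)) \<in> borel_measurable (P \<Otimes>\<^sub>M Q)" using f(1) g(1) by measurable
    show "\<bar>f (fst x) * g (snd x)\<bar> \<le> A * B" for x
      unfolding abs_mult using f(2)[of "fst x"] g(2)[of "snd x"] by (intro mult_mono) auto
  qed
  from PQ.integral_fst'[OF this] show ?thesis by simp
qed

lemma integral_fst_prob:
  fixes f :: "'a \<Rightarrow> real"
  assumes P: "prob_space P" and Q: "prob_space Q"
    and f: "f \<in> borel_measurable P" "\<And>x. \<bar>f x\<bar> \<le> A"
  shows "(LINT x|(P \<Otimes>\<^sub>M Q). f (fst x)) = (LINT x|P. f x)"
  using integral_pair_prob[OF P Q f, of "\<lambda>_. 1" 1] prob_space.prob_space[OF Q] by simp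

lemma integral_snd_prob:
  fixes g :: "'b \<Rightarrow> real"
  assumes P: "prob_space P" and Q: "prob_space Q"
    and g: "g \<in> borel_measurable Q" "\<And>x. \<bar>g x\<bar> \<le> B"
  shows "(LINT x|(P \<Otimes>\<^sub>M Q). g (snd x)) = (LINT x|Q. g x)"
  using integral_pair_prob[OF P Q _ _ g, of "\<lambda>_. 1" 1] prob_space.prob_space[OF P] by simp

section \<open>The mixture model\<close>

lemma prob_densities_measurable: "p \<in> prob_densities \<Longrightarrow> p \<in> borel_measurable borel"
  and prob_densities_nonneg: "p \<in> prob_densities \<Longrightarrow> 0 \<le> p x"
  by (auto simp: prob_densities_def)

lemma prob_densities_integrable: "p \<in> prob_densities \<Longrightarrow> integrable lborel p"
  by (auto simp: prob_densities_def integrable_iff_bounded)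

lemma prob_densities_integral: "p \<in> prob_densities \<Longrightarrow> (LINT x|lborel. p x) = 1"
  by (auto simp: prob_densities_def integral_eq_nn_integral)

lemma prob_densitiesI:
  assumes "p \<in> borel_measurable borel" "\<And>x. 0 \<le> p x" "integrable lborel p" "(LINT x|lborel. p x) = 1"
  shows "p \<in> prob_densities"
  using assms by (simp add: prob_densities_def nn_integral_eq_integral)

lemma prob_space_prob_density: "p \<in> prob_densities \<Longrightarrow> prob_space (density lborel (\<lambda>x. ennreal (p x)))"
  by (auto simp: prob_densities_def intro!: prob_spaceI simp: emeasure_density)

lemma integral_prob_density:
  fixes h :: "real \<Rightarrow> real"
  assumes "p \<in> prob_densities" "h \<in> borel_measurable borel"
  shows "(LINT x|density lborel (\<lambda>x. ennreal (p x)). h x) = inner_L2 p h"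
  using assms by (subst integral_density) (auto simp: prob_densities_def inner_L2_def)

lemma prob_densities_integrable_mult:
  assumes p: "p \<in> prob_densities" and h: "h \<in> borel_measurable borel" "\<And>x. \<bar>h x\<bar> \<le> B"
  shows "integrable lborel (\<lambda>x. p x * h x)"
proof (rule Bochner_Integration.integrable_bound)
  show "integrable lborel (\<lambda>x. B * p x)" using prob_densities_integrable[OF p] by simp
  show "(\<lambda>x. p x * h x) \<in> borel_measurable lborel"
    using prob_densities_measurable[OF p] h(1) by simp
  have B: "0 \<le> B" using h(2)[of 0] by (meson abs_ge_zero order_trans)
  show "AE x in lborel. norm (p x * h x) \<le> norm (B * p x)"
  proof (rule AE_I2)
    fix x
    have "p x * \<bar>h x\<bar> \<le> p x * B"
      using h(2)[of x] prob_densities_nonneg[OF p, of x] by (rule mult_left_mono)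
    then show "norm (p x * h x) \<le> norm (B * p x)"
      using prob_densities_nonneg[OF p, of x] B by (simp add: abs_mult mult.commute)
  qed
qed

text \<open>Almost everywhere p^2 <= R p, and p integrates to 1.\<close>

lemma prob_densities_bounded_L2:
  assumes "p \<in> prob_densities" "p \<in> Linf_ball R"
  shows "p \<in> L2" "inner_L2 p p \<le> R"
proof -
  have R: "AE x in lborel. \<bar>p x\<bar> \<le> R" using assms(2) by (simp add: Linf_ball_def)
  then have le: "AE x in lborel. (p x)\<^sup>2 \<le> R * p x"
    by eventually_elim (use prob_densities_nonneg[OF assms(1)] in \<open>auto simp: power2_eq_square mult_right_mono\<close>)
  have int: "integrable lborel (\<lambda>x. R * p x)" using prob_densities_integrable[OF assms(1)] by simp
  have int2: "integrable lborel (\<lambda>x. (p x)\<^sup>2)"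
    using prob_densities_measurable[OF assms(1)] le
    by (intro Bochner_Integration.integrable_bound[OF int]) auto
  then show "p \<in> L2" using prob_densities_measurable[OF assms(1)] by (simp add: L2_def)
  have "inner_L2 p p \<le> (LINT x|lborel. R * p x)"
    unfolding inner_L2_def power2_eq_square[symmetric] using int2 int le by (rule integral_mono_AE)
  then show "inner_L2 p p \<le> R" using prob_densities_integral[OF assms(1)] by simp
qed

definition mixture :: "('m::finite \<Rightarrow> nat \<Rightarrow> real) \<Rightarrow> ('m \<Rightarrow> real \<Rightarrow> real) \<Rightarrow> nat \<Rightarrow> real \<Rightarrow> real" where
  "mixture w p i x = (\<Sum>u\<in>UNIV. w u i * p u x)"

lemma mixture_prob_density:
  assumes w: "mixing_weights w n" and i: "i \<in> {1..n}" and p: "\<And>u. p u \<in> prob_densities"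
  shows "mixture w p i \<in> prob_densities"
proof (rule prob_densitiesI)
  show "mixture w p i \<in> borel_measurable borel"
    unfolding mixture_def[abs_def] using prob_densities_measurable[OF p] by measurable
  show "0 \<le> mixture w p i x" for x
    using w i prob_densities_nonneg[OF p] unfolding mixture_def mixing_weights_def
    by (intro sum_nonneg mult_nonneg_nonneg) auto
  show "integrable lborel (mixture w p i)"
    unfolding mixture_def[abs_def] using prob_densities_integrable[OF p] by simp
  show "(LINT x|lborel. mixture w p i x) = 1"
    using prob_densities_integrable[OF p] prob_densities_integral[OF p] w i
    by (simp add: mixture_def mixing_weights_def)
qed

lemma mixture_Linf:
  assumes w: "mixing_weights w n" and i: "i \<in> {1..n}" and p: "\<And>u. p u \<in> prob_densities"
    and R: "\<And>u. p u \<in> Linf_ball R"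
  shows "mixture w p i \<in> Linf_ball R"
proof -
  have "AE x in lborel. \<forall>u\<in>UNIV. \<bar>p u x\<bar> \<le> R"
    using R by (intro AE_finite_allI) (auto simp: Linf_ball_def)
  then have "AE x in lborel. \<bar>mixture w p i x\<bar> \<le> R"
  proof eventually_elim
    case (elim x)
    have "\<bar>mixture w p i x\<bar> \<le> (\<Sum>u\<in>UNIV. \<bar>w u i * p u x\<bar>)"
      unfolding mixture_def by (rule sum_abs)
    also have "\<dots> \<le> (\<Sum>u\<in>UNIV. w u i * R)"
      using elim w i by (intro sum_mono) (auto simp: abs_mult mixing_weights_def mult_left_mono)
    also have "\<dots> = R" using w i by (simp add: mixing_weights_def flip: sum_distrib_right)
    finally show ?case .
  qed
  then show ?thesis
    using prob_densities_measurable[OF mixture_prob_density[OF w i p]] by (simp add: Linf_ball_def)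
qed

text \<open>Densities are only integrable in general, so the integrals exist here because
  \<open>h\<close> is bounded, not because both factors are square integrable.\<close>

lemma inner_L2_mixture:
  assumes p: "\<And>u. p u \<in> prob_densities" and h: "h \<in> borel_measurable borel" "\<And>x. \<bar>h x\<bar> \<le> B"
  shows "inner_L2 (mixture w p i) h = (\<Sum>u\<in>UNIV. w u i * inner_L2 (p u) h)"
  using prob_densities_integrable_mult[OF p h]
  by (simp add: inner_L2_def mixture_def sum_distrib_right mult.assoc)

lemma sample_law_eq: "sample_law w p n = (\<Pi>\<^sub>M i\<in>{1..n}. density lborel (\<lambda>x. ennreal (mixture w p i x)))"
  by (simp add: sample_law_def mixture_def)

lemma sample_finite_prob_product:
  assumes "mixing_weights w n" "\<And>u. p u \<in> prob_densities"
  shows "finite_prob_product {1..n} (\<lambda>i. density lborel (\<lambda>x. ennreal (mixture w p i x)))"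
  by (intro finite_prob_product.intro prob_space_prob_density mixture_prob_density[OF assms(1) _ assms(2)])
    auto

lemma prob_space_sample_law:
  assumes "mixing_weights w n" "\<And>u. p u \<in> prob_densities"
  shows "prob_space (sample_law w p n)"
  unfolding sample_law_eq
  using finite_prob_product.prob_space_PiM_N[OF sample_finite_prob_product[OF assms]] .

lemma sets_sample_law [measurable_cong]: "sets (sample_law w p n) = sets (\<Pi>\<^sub>M i\<in>{1..n}. borel)"
  unfolding sample_law_def by (intro sets_PiM_cong) auto

lemma sets_obs_law [measurable_cong]:
  "sets (obs_law \<omega> \<sigma> n pq) = sets ((\<Pi>\<^sub>M i\<in>{1..n}. borel) \<Otimes>\<^sub>M (\<Pi>\<^sub>M i\<in>{1..n}. borel))"
  unfolding obs_law_def by (intro sets_pair_measure_cong sets_sample_law)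

lemma prob_space_obs_law:
  assumes "mixing_weights \<omega> n" "mixing_weights \<sigma> n" "\<And>u. p u \<in> prob_densities" "\<And>u. q u \<in> prob_densities"
  shows "prob_space (obs_law \<omega> \<sigma> n (p, q))"
proof -
  interpret P: prob_space "sample_law \<omega> p n" using assms by (intro prob_space_sample_law)
  interpret Q: prob_space "sample_law \<sigma> q n" using assms by (intro prob_space_sample_law)
  interpret PQ: pair_prob_space "sample_law \<omega> p n" "sample_law \<sigma> q n" by standard
  show ?thesis unfolding obs_law_def fst_conv snd_conv by (rule PQ.P.prob_space_axioms)
qed

section \<open>The test statistic\<close>

lemma abs_sum_le:
  fixes f g :: "'a \<Rightarrow> real"
  shows "(\<And>i. i \<in> A \<Longrightarrow> \<bar>f i\<bar> \<le> g i) \<Longrightarrow> \<bar>sum f A\<bar> \<le> sum g A"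
  using sum_norm_le[of A f g] by simp

definition obs_term ::
  "(real \<Rightarrow> real) \<Rightarrow> ('m::finite \<Rightarrow> nat \<Rightarrow> real) \<Rightarrow> ('m \<Rightarrow> nat \<Rightarrow> real) \<Rightarrow> nat \<Rightarrow> nat \<Rightarrow>
   'm \<Rightarrow> int \<Rightarrow> nat \<Rightarrow> observation \<Rightarrow> real" where
  "obs_term \<phi> \<omega> \<sigma> n j l k i yz = dual_weight \<omega> n l i * dilate \<phi> j k (fst yz i)
     - dual_weight \<sigma> n l i * dilate \<phi> j k (snd yz i)"

text \<open>The set of positions \<open>k\<close> that contribute depends on the observations and is
  not bounded over all of them. With a fixed finite \<open>S\<close> the statistic is a finite sum
  of products, to which linearity of expectation applies directly.\<close>

definition T_trunc ::
  "(real \<Rightarrow> real) \<Rightarrow> ('m::finite \<Rightarrow> nat \<Rightarrow> real) \<Rightarrow> ('m \<Rightarrow> nat \<Rightarrow> real) \<Rightarrow> nat \<Rightarrow> nat \<Rightarrow>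
   int set \<Rightarrow> observation \<Rightarrow> real" where
  "T_trunc \<phi> \<omega> \<sigma> n j S yz = 1 / (real n)\<^sup>2 *
     (\<Sum>l\<in>UNIV. \<Sum>k\<in>S. \<Sum>i1\<in>{1..n}. \<Sum>i2\<in>{1..n} - {i1}.
        obs_term \<phi> \<omega> \<sigma> n j l k i1 yz * obs_term \<phi> \<omega> \<sigma> n j l k i2 yz)"

lemma obs_term_measurable [measurable]:
  assumes [measurable]: "\<phi> \<in> borel_measurable borel" and i: "i \<in> {1..n}"
  shows "obs_term \<phi> \<omega> \<sigma> m j l k i \<in> borel_measurable ((\<Pi>\<^sub>M i\<in>{1..n}. borel) \<Otimes>\<^sub>M (\<Pi>\<^sub>M i\<in>{1..n}. borel))"
proof -
  have [measurable]: "(\<lambda>x. x i) \<in> borel_measurable (\<Pi>\<^sub>M i\<in>{1..n}. borel)"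
    using i by (rule measurable_component_singleton)
  show ?thesis unfolding obs_term_def[abs_def] by measurable
qed

lemma T_trunc_measurable:
  assumes "\<phi> \<in> borel_measurable borel"
  shows "T_trunc \<phi> \<omega> \<sigma> n j S \<in> borel_measurable ((\<Pi>\<^sub>M i\<in>{1..n}. borel) \<Otimes>\<^sub>M (\<Pi>\<^sub>M i\<in>{1..n}. borel))"
  unfolding T_trunc_def[abs_def] using assms
  by (intro borel_measurable_times borel_measurable_sum borel_measurable_const obs_term_measurable) auto

context wavelets
begin

text \<open>All positions at which a scaling function of level \<open>j\<close> can be nonzero at
  \<open>x\<close>. The closed inequality gives a slight superset, whose size is bounded
  independently of \<open>j\<close>.\<close>

definition active :: "nat \<Rightarrow> real \<Rightarrow> int set" where
  "active j x = {k. \<bar>2 ^ j * x - of_int k\<bar> \<le> L}"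

lemma finite_active: "finite (active j x)"
  and card_active: "card (active j x) \<le> nat \<lfloor>2 * L\<rfloor> + 1"
  unfolding active_def by (rule card_int_interval_le, simp add: L_pos less_imp_le)+

lemma dilate_phi_inactive: "k \<notin> active j x \<Longrightarrow> dilate \<phi> j k x = 0"
  using dilate_phi_supp[of j k x] by (auto simp: active_def)

lemma obs_term_inactive:
  "k \<notin> active j (fst yz i) \<union> active j (snd yz i) \<Longrightarrow> obs_term \<phi> \<omega> \<sigma> n j l k i yz = 0"
  by (simp add: obs_term_def dilate_phi_inactive)

lemma T_stat_eq_T_trunc:
  assumes S: "finite S" "(\<Union>i\<in>{1..n}. active j (fst yz i) \<union> active j (snd yz i)) \<subseteq> S"
  shows "T_stat \<phi> \<omega> \<sigma> n j yz = T_trunc \<phi> \<omega> \<sigma> n j S yz"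
proof -
  have "(\<Sum>\<^sub>\<infinity>k. \<Sum>i1\<in>{1..n}. \<Sum>i2\<in>{1..n} - {i1}.
        obs_term \<phi> \<omega> \<sigma> n j l k i1 yz * obs_term \<phi> \<omega> \<sigma> n j l k i2 yz)
    = (\<Sum>\<^sub>\<infinity>k\<in>S. \<Sum>i1\<in>{1..n}. \<Sum>i2\<in>{1..n} - {i1}.
        obs_term \<phi> \<omega> \<sigma> n j l k i1 yz * obs_term \<phi> \<omega> \<sigma> n j l k i2 yz)" for l
  proof (rule infsum_cong_neutral)
    fix k assume "k \<in> UNIV - S"
    then have "obs_term \<phi> \<omega> \<sigma> n j l k i yz = 0" if "i \<in> {1..n}" for i
      using S(2) that by (intro obs_term_inactive) blast
    then show "(\<Sum>i1\<in>{1..n}. \<Sum>i2\<in>{1..n} - {i1}.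
        obs_term \<phi> \<omega> \<sigma> n j l k i1 yz * obs_term \<phi> \<omega> \<sigma> n j l k i2 yz) = 0"
      by (intro sum.neutral ballI) simp
  qed auto
  then show ?thesis
    using S(1) unfolding T_stat_def T_trunc_def obs_term_def
    by (simp add: Let_def case_prod_unfold)
qed

text \<open>For fixed observations the sequence is eventually constant, since only finitely many
  positions are active. Convergence is the form in which measurability, bounds and expectations pass
  to \<open>T_stat\<close>.\<close>

lemma T_trunc_tendsto: "(\<lambda>N. T_trunc \<phi> \<omega> \<sigma> n j {- int N..int N} yz) \<longlonglongrightarrow> T_stat \<phi> \<omega> \<sigma> n j yz"
proof -
  define A where "A = (\<Union>i\<in>{1..n}. active j (fst yz i) \<union> active j (snd yz i))"
  have "finite A" unfolding A_def by (auto simp: finite_active)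
  then have "finite (abs ` A)" by simp
  then obtain b where b: "\<And>k. k \<in> A \<Longrightarrow> \<bar>k\<bar> \<le> b"
    using bdd_above_finite[of "abs ` A"] by (auto simp: bdd_above_def)
  have "\<forall>\<^sub>F N in sequentially. T_stat \<phi> \<omega> \<sigma> n j yz = T_trunc \<phi> \<omega> \<sigma> n j {- int N..int N} yz"
    using eventually_ge_at_top[of "nat b"]
  proof eventually_elim
    case (elim N)
    have "A \<subseteq> {- int N..int N}"
    proof
      fix k assume "k \<in> A"
      with b[of k] elim show "k \<in> {- int N..int N}" by (auto simp: abs_le_iff)
    qed
    then show ?case unfolding A_def by (intro T_stat_eq_T_trunc) auto
  qed
  then show ?thesis by (rule tendsto_eventually[OF eventually_mono]) simp
qed

lemma T_stat_measurable:
  "T_stat \<phi> \<omega> \<sigma> n j \<in> borel_measurable ((\<Pi>\<^sub>M i\<in>{1..n}. borel) \<Otimes>\<^sub>M (\<Pi>\<^sub>M i\<in>{1..n}. borel))"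
  by (rule borel_measurable_LIMSEQ_real[OF T_trunc_tendsto T_trunc_measurable[OF phi_measurable]])

definition obs_bound ::
  "('m::finite \<Rightarrow> nat \<Rightarrow> real) \<Rightarrow> ('m \<Rightarrow> nat \<Rightarrow> real) \<Rightarrow> nat \<Rightarrow> nat \<Rightarrow> 'm \<Rightarrow> nat \<Rightarrow> real" where
  "obs_bound \<omega> \<sigma> n j l i =
     (\<bar>dual_weight \<omega> n l i\<bar> + \<bar>dual_weight \<sigma> n l i\<bar>) * (2 powr (real j / 2) * phi_bound)"

lemma obs_bound_nonneg: "0 \<le> obs_bound \<omega> \<sigma> n j l i"
  by (simp add: obs_bound_def phi_bound_nonneg)

lemma obs_term_bounded: "\<bar>obs_term \<phi> \<omega> \<sigma> n j l k i yz\<bar> \<le> obs_bound \<omega> \<sigma> n j l i"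
proof -
  have "\<bar>obs_term \<phi> \<omega> \<sigma> n j l k i yz\<bar>
    \<le> \<bar>dual_weight \<omega> n l i\<bar> * \<bar>dilate \<phi> j k (fst yz i)\<bar> + \<bar>dual_weight \<sigma> n l i\<bar> * \<bar>dilate \<phi> j k (snd yz i)\<bar>"
    unfolding obs_term_def using abs_triangle_ineq4 by (simp flip: abs_mult)
  also have "\<dots> \<le> obs_bound \<omega> \<sigma> n j l i"
    unfolding obs_bound_def distrib_right by (intro add_mono mult_left_mono dilate_phi_bound) auto
  finally show ?thesis .
qed

text \<open>Dominated convergence needs a bound uniform in \<open>S\<close>. A product of two terms
  vanishes unless \<open>k\<close> is active for one of the two values with index \<open>i1\<close>,
  so each sum over \<open>k\<close> has at most \<open>C\<close> nonzero terms, however large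
  \<open>S\<close> is.\<close>

lemma T_trunc_bounded:
  obtains B where "\<And>S yz. finite S \<Longrightarrow> \<bar>T_trunc \<phi> \<omega> \<sigma> n j S yz\<bar> \<le> B"
proof -
  define D where "D = obs_bound \<omega> \<sigma> n j"
  have D: "\<bar>obs_term \<phi> \<omega> \<sigma> n j l k i yz\<bar> \<le> D l i" and D0: "0 \<le> D l i" for l k i yz
    unfolding D_def by (rule obs_term_bounded obs_bound_nonneg)+
  define C where "C = 2 * (real (nat \<lfloor>2 * L\<rfloor>) + 1)"
  have inner: "\<bar>\<Sum>k\<in>S. obs_term \<phi> \<omega> \<sigma> n j l k i1 yz * obs_term \<phi> \<omega> \<sigma> n j l k i2 yz\<bar> \<le> C * (D l i1 * D l i2)"
    if "finite S" for S l i1 i2 yz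
  proof -
    define A where "A = active j (fst yz i1) \<union> active j (snd yz i1)"
    have fA: "finite A" by (simp add: A_def finite_active)
    have "(\<Sum>k\<in>S. obs_term \<phi> \<omega> \<sigma> n j l k i1 yz * obs_term \<phi> \<omega> \<sigma> n j l k i2 yz)
        = (\<Sum>k\<in>S \<inter> A. obs_term \<phi> \<omega> \<sigma> n j l k i1 yz * obs_term \<phi> \<omega> \<sigma> n j l k i2 yz)"
      using that obs_term_inactive[of _ j yz i1 \<omega> \<sigma> n l]
      by (intro sum.mono_neutral_right) (auto simp: A_def)
    also have "\<bar>\<dots>\<bar> \<le> (\<Sum>k\<in>S \<inter> A. D l i1 * D l i2)"
      by (rule order_trans[OF sum_abs]) (unfold abs_mult, intro sum_mono mult_mono D D0, simp)
    also have "\<dots> \<le> C * (D l i1 * D l i2)"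
    proof -
      have "card (S \<inter> A) \<le> card A" using fA by (intro card_mono) auto
      also have "\<dots> \<le> card (active j (fst yz i1)) + card (active j (snd yz i1))"
        unfolding A_def by (rule card_Un_le)
      also have "\<dots> \<le> 2 * (nat \<lfloor>2 * L\<rfloor> + 1)"
        using add_mono[OF card_active[of j "fst yz i1"] card_active[of j "snd yz i1"]]
        by (simp only: mult_2)
      finally have "real (card (S \<inter> A)) \<le> real (2 * (nat \<lfloor>2 * L\<rfloor> + 1))" by (rule of_nat_mono)
      then have "real (card (S \<inter> A)) \<le> C" by (simp add: C_def)
      then show ?thesis using D0 by (simp add: mult_right_mono)
    qed
    finally show ?thesis .
  qed
  define B where "B = 1 / (real n)\<^sup>2 * (\<Sum>l\<in>UNIV. \<Sum>i1\<in>{1..n}. \<Sum>i2\<in>{1..n} - {i1}. C * (D l i1 * D l i2))"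
  have "\<bar>T_trunc \<phi> \<omega> \<sigma> n j S yz\<bar> \<le> B" if "finite S" for S yz
  proof -
    \<comment> \<open>The sum over \<open>k\<close> is moved innermost, where only the active
      positions count.\<close>
    define X where "X l i1 i2 = (\<Sum>k\<in>S. obs_term \<phi> \<omega> \<sigma> n j l k i1 yz * obs_term \<phi> \<omega> \<sigma> n j l k i2 yz)"
      for l i1 i2
    have X: "\<bar>X l i1 i2\<bar> \<le> C * (D l i1 * D l i2)" for l i1 i2
      unfolding X_def using that by (rule inner)
    have "T_trunc \<phi> \<omega> \<sigma> n j S yz = 1 / (real n)\<^sup>2 * (\<Sum>l\<in>UNIV. \<Sum>i1\<in>{1..n}. \<Sum>i2\<in>{1..n} - {i1}. X l i1 i2)"
      unfolding T_trunc_def X_def by (simp add: sum.swap[of _ _ S])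
    moreover have "\<bar>\<Sum>l\<in>UNIV. \<Sum>i1\<in>{1..n}. \<Sum>i2\<in>{1..n} - {i1}. X l i1 i2\<bar>
        \<le> (\<Sum>l\<in>UNIV. \<Sum>i1\<in>{1..n}. \<Sum>i2\<in>{1..n} - {i1}. C * (D l i1 * D l i2))"
      by (intro abs_sum_le X)
    ultimately show ?thesis by (simp add: B_def abs_mult divide_right_mono)
  qed
  then show thesis by (rule that)
qed

lemma T_stat_bounded:
  obtains B where "\<And>yz. \<bar>T_stat \<phi> \<omega> \<sigma> n j yz\<bar> \<le> B"
proof -
  obtain B where B: "\<And>S yz. finite S \<Longrightarrow> \<bar>T_trunc \<phi> \<omega> \<sigma> n j S yz\<bar> \<le> B"
    using T_trunc_bounded[of \<omega> \<sigma> n j] by blast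
  have "\<bar>T_stat \<phi> \<omega> \<sigma> n j yz\<bar> \<le> B" for yz
    by (rule LIMSEQ_le_const2[OF tendsto_rabs[OF T_trunc_tendsto]]) (auto intro!: B)
  then show thesis by (rule that)
qed

end

section \<open>Moments of the test statistic\<close>

text \<open>\<open>p\<close> and \<open>q\<close> range over all densities. Bounds by
  \<open>R\<close> are assumed only where they are used, because the construction with unbounded
  components takes place in the same locale.\<close>

locale mixture_model = wavelets \<phi> \<psi> L
  for \<phi> \<psi> :: "real \<Rightarrow> real" and L :: real +
  fixes \<omega> \<sigma> :: "'m::finite \<Rightarrow> nat \<Rightarrow> real" and n :: nat and K :: real
    and p q :: "'m \<Rightarrow> real \<Rightarrow> real"
  assumes \<omega>: "spread_weights \<omega> n K" and \<sigma>: "spread_weights \<sigma> n K"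
    and p: "\<And>u. p u \<in> prob_densities" and q: "\<And>u. q u \<in> prob_densities"
begin

abbreviation "M \<equiv> obs_law \<omega> \<sigma> n (p, q)"

lemma mixing: "mixing_weights \<omega> n" "mixing_weights \<sigma> n"
  using \<omega> \<sigma> by (auto simp: spread_weights_def)

lemma K_pos: "0 < K" and n_pos: "0 < n"
  using \<omega> by (auto simp: spread_weights_def)

sublocale M: prob_space M
  using mixing p q by (rule prob_space_obs_law)

lemma M_measurable: "f \<in> borel_measurable ((\<Pi>\<^sub>M i\<in>{1..n}. borel) \<Otimes>\<^sub>M (\<Pi>\<^sub>M i\<in>{1..n}. borel)) \<Longrightarrow>
    f \<in> borel_measurable M"
  using measurable_cong_sets[OF sets_obs_law refl] by blast

definition mean_term :: "nat \<Rightarrow> 'm \<Rightarrow> int \<Rightarrow> nat \<Rightarrow> real" where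
  "mean_term j l k i = dual_weight \<omega> n l i * inner_L2 (mixture \<omega> p i) (dilate \<phi> j k)
     - dual_weight \<sigma> n l i * inner_L2 (mixture \<sigma> q i) (dilate \<phi> j k)"

text \<open>Observations with different indices are independent, within each sample and across the
  two. The four products obtained by expanding are integrated separately: those within one sample by
  \<open>integral_two_components\<close>, the mixed ones by
  \<open>integral_pair_prob\<close>.\<close>

lemma expectation_product:
  assumes i: "i1 \<in> {1..n}" "i2 \<in> {1..n}" "i1 \<noteq> i2"
  shows "(LINT yz|M. obs_term \<phi> \<omega> \<sigma> n j l k i1 yz * obs_term \<phi> \<omega> \<sigma> n j l k i2 yz)
    = mean_term j l k i1 * mean_term j l k i2"
proof -
  define h where "h = dilate \<phi> j k"
  define P where "P = sample_law \<omega> p n"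
  define Q where "Q = sample_law \<sigma> q n"
  define B where "B = 2 powr (real j / 2) * phi_bound"
  have h: "h \<in> borel_measurable borel" "\<And>x. \<bar>h x\<bar> \<le> B"
    by (auto simp: h_def B_def dilate_phi_bound)
  have P: "prob_space P" and Q: "prob_space Q"
    unfolding P_def Q_def by (intro prob_space_sample_law mixing p q)+
  interpret P: finite_prob_product "{1..n}" "\<lambda>i. density lborel (\<lambda>x. ennreal (mixture \<omega> p i x))"
    by (intro sample_finite_prob_product mixing p)
  interpret Q: finite_prob_product "{1..n}" "\<lambda>i. density lborel (\<lambda>x. ennreal (mixture \<sigma> q i x))"
    by (intro sample_finite_prob_product mixing q)
  have hm: "(\<lambda>y. h (y i)) \<in> borel_measurable P" "(\<lambda>y. h (y i)) \<in> borel_measurable Q"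
    if "i \<in> {1..n}" for i
  proof -
    have "(\<lambda>y. h (y i)) \<in> borel_measurable (\<Pi>\<^sub>M i\<in>{1..n}. borel)"
      using h(1) measurable_component_singleton[OF that, of "\<lambda>_. borel"] by (rule measurable_compose[rotated])
    then show "(\<lambda>y. h (y i)) \<in> borel_measurable P" "(\<lambda>y. h (y i)) \<in> borel_measurable Q"
      unfolding P_def Q_def using measurable_cong_sets[OF sets_sample_law refl] by blast+
  qed
  have intP: "integrable (density lborel (\<lambda>x. ennreal (mixture \<omega> p i x))) h"
    and intQ: "integrable (density lborel (\<lambda>x. ennreal (mixture \<sigma> q i x))) h" if "i \<in> {1..n}" for i
    using that h mixing p q
    by (auto intro!: prob_space.integrable_bounded[of _ _ B] prob_space_prob_density mixture_prob_density)
  have EP: "(LINT y|P. h (y i)) = inner_L2 (mixture \<omega> p i) h"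
    and EQ: "(LINT z|Q. h (z i)) = inner_L2 (mixture \<sigma> q i) h" if "i \<in> {1..n}" for i
    unfolding P_def Q_def sample_law_eq
    using P.integral_component[OF that intP[OF that]] Q.integral_component[OF that intQ[OF that]] h(1)
      integral_prob_density[OF mixture_prob_density[OF mixing(1) that p]]
      integral_prob_density[OF mixture_prob_density[OF mixing(2) that q]] by auto
  have EPP: "(LINT y|P. h (y i1) * h (y i2)) = inner_L2 (mixture \<omega> p i1) h * inner_L2 (mixture \<omega> p i2) h"
    unfolding P_def sample_law_eq
    using P.integral_two_components[OF i intP[OF i(1)] intP[OF i(2)]] h(1)
      integral_prob_density[OF mixture_prob_density[OF mixing(1) i(1) p]]
      integral_prob_density[OF mixture_prob_density[OF mixing(1) i(2) p]] by simp
  have EQQ: "(LINT y|Q. h (y i1) * h (y i2)) = inner_L2 (mixture \<sigma> q i1) h * inner_L2 (mixture \<sigma> q i2) h"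
    unfolding Q_def sample_law_eq
    using Q.integral_two_components[OF i intQ[OF i(1)] intQ[OF i(2)]] h(1)
      integral_prob_density[OF mixture_prob_density[OF mixing(2) i(1) q]]
      integral_prob_density[OF mixture_prob_density[OF mixing(2) i(2) q]] by simp
  have hh: "\<bar>h x * h y\<bar> \<le> B * B" for x y
    unfolding abs_mult using h(2)[of x] h(2)[of y] by (intro mult_mono) auto
  have hhm: "(\<lambda>y. h (y i1) * h (y i2)) \<in> borel_measurable P" "(\<lambda>y. h (y i1) * h (y i2)) \<in> borel_measurable Q"
    using hm i by auto
  have fm: "(\<lambda>yz. f (fst yz)) \<in> borel_measurable M" if "f \<in> borel_measurable P" for f :: "_ \<Rightarrow> real"
    using that unfolding obs_law_def fst_conv snd_conv P_def by measurable
  have sm: "(\<lambda>yz. f (snd yz)) \<in> borel_measurable M" if "f \<in> borel_measurable Q" for f :: "_ \<Rightarrow> real"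
    using that unfolding obs_law_def fst_conv snd_conv Q_def by measurable
  note fsm = fm[OF hm(1)] sm[OF hm(2)]
  define a where "a = dual_weight \<omega> n l"
  define b where "b = dual_weight \<sigma> n l"
  have Meq: "M = P \<Otimes>\<^sub>M Q" by (simp add: obs_law_def P_def Q_def)
  have E1: "(LINT yz|M. h (fst yz i1) * h (fst yz i2)) = inner_L2 (mixture \<omega> p i1) h * inner_L2 (mixture \<omega> p i2) h"
    unfolding Meq using integral_fst_prob[OF P Q hhm(1) hh] EPP by simp
  have E2: "(LINT yz|M. h (snd yz i1) * h (snd yz i2)) = inner_L2 (mixture \<sigma> q i1) h * inner_L2 (mixture \<sigma> q i2) h"
    unfolding Meq using integral_snd_prob[OF P Q hhm(2) hh] EQQ by simp
  have E3: "(LINT yz|M. h (fst yz i) * h (snd yz i')) = inner_L2 (mixture \<omega> p i) h * inner_L2 (mixture \<sigma> q i') h"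
    if "i \<in> {1..n}" "i' \<in> {1..n}" for i i'
    unfolding Meq using integral_pair_prob[OF P Q hm(1)[OF that(1)] h(2) hm(2)[OF that(2)] h(2)]
      EP[OF that(1)] EQ[OF that(2)] by simp
  have int: "integrable M (\<lambda>yz. h (fst yz i) * h (fst yz i'))" "integrable M (\<lambda>yz. h (snd yz i) * h (snd yz i'))"
      "integrable M (\<lambda>yz. h (fst yz i) * h (snd yz i'))"
    if "i \<in> {1..n}" "i' \<in> {1..n}" for i i'
    using fsm that hh by (auto intro!: M.integrable_bounded[of _ "B * B"] borel_measurable_times)
  have "(LINT yz|M. obs_term \<phi> \<omega> \<sigma> n j l k i1 yz * obs_term \<phi> \<omega> \<sigma> n j l k i2 yz)
    = (LINT yz|M. (a i1 * a i2) * (h (fst yz i1) * h (fst yz i2)) - (a i1 * b i2) * (h (fst yz i1) * h (snd yz i2))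
        - (a i2 * b i1) * (h (fst yz i2) * h (snd yz i1)) + (b i1 * b i2) * (h (snd yz i1) * h (snd yz i2)))"
    by (intro Bochner_Integration.integral_cong refl)
       (simp add: obs_term_def a_def b_def h_def algebra_simps)
  also have "\<dots> = (a i1 * a i2) * (inner_L2 (mixture \<omega> p i1) h * inner_L2 (mixture \<omega> p i2) h)
     - (a i1 * b i2) * (inner_L2 (mixture \<omega> p i1) h * inner_L2 (mixture \<sigma> q i2) h)
     - (a i2 * b i1) * (inner_L2 (mixture \<omega> p i2) h * inner_L2 (mixture \<sigma> q i1) h)
     + (b i1 * b i2) * (inner_L2 (mixture \<sigma> q i1) h * inner_L2 (mixture \<sigma> q i2) h)"
    using int[OF i(1,2)] int[OF i(2,1)] E3[OF i(1,2)] E3[OF i(2,1)] E1 E2 by simp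
  also have "\<dots> = mean_term j l k i1 * mean_term j l k i2"
    by (simp add: mean_term_def a_def b_def h_def algebra_simps)
  finally show ?thesis .
qed

lemma integrable_obs_term_product:
  assumes "i1 \<in> {1..n}" "i2 \<in> {1..n}"
  shows "integrable M (\<lambda>yz. obs_term \<phi> \<omega> \<sigma> n j l k i1 yz * obs_term \<phi> \<omega> \<sigma> n j l k i2 yz)"
proof (rule M.integrable_bounded)
  show "(\<lambda>yz. obs_term \<phi> \<omega> \<sigma> n j l k i1 yz * obs_term \<phi> \<omega> \<sigma> n j l k i2 yz) \<in> borel_measurable M"
    using assms by (intro M_measurable borel_measurable_times obs_term_measurable phi_measurable)
  show "\<bar>obs_term \<phi> \<omega> \<sigma> n j l k i1 yz * obs_term \<phi> \<omega> \<sigma> n j l k i2 yz\<bar>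
      \<le> obs_bound \<omega> \<sigma> n j l i1 * obs_bound \<omega> \<sigma> n j l i2" for yz
    unfolding abs_mult by (intro mult_mono obs_term_bounded obs_bound_nonneg) auto
qed

text \<open>This is the purpose of the dual weights: by biorthogonality the weighted sum over the
  mixtures reduces to the single component \<open>l\<close>.\<close>

lemma sum_mean_term:
  "(\<Sum>i\<in>{1..n}. mean_term j l k i) = real n * inner_L2 (\<lambda>x. p l x - q l x) (dilate \<phi> j k)"
proof -
  define h where "h = dilate \<phi> j k"
  have h: "h \<in> borel_measurable borel" "\<And>x. \<bar>h x\<bar> \<le> 2 powr (real j / 2) * phi_bound"
    by (auto simp: h_def dilate_phi_bound)
  have sum_dual: "(\<Sum>i\<in>{1..n}. dual_weight w n l i * inner_L2 (mixture w r i) h) = real n * inner_L2 (r l) h"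
    if w: "spread_weights w n K" and r: "\<And>u. r u \<in> prob_densities" for w :: "'m \<Rightarrow> nat \<Rightarrow> real" and r
  proof -
    have "(\<Sum>i\<in>{1..n}. dual_weight w n l i * inner_L2 (mixture w r i) h)
        = (\<Sum>i\<in>{1..n}. \<Sum>u\<in>UNIV. inner_L2 (r u) h * (w u i * dual_weight w n l i))"
      by (simp add: inner_L2_mixture[OF r h] sum_distrib_left mult_ac)
    also have "\<dots> = (\<Sum>u\<in>UNIV. inner_L2 (r u) h * (\<Sum>i\<in>{1..n}. w u i * dual_weight w n l i))"
      by (subst sum.swap) (simp add: sum_distrib_left)
    also have "\<dots> = (\<Sum>u\<in>UNIV. if u = l then real n * inner_L2 (r u) h else 0)"
      using spread_weights.dual_weight_biorthogonal[OF w] by (intro sum.cong refl) simp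
    also have "\<dots> = real n * inner_L2 (r l) h" by simp
    finally show ?thesis .
  qed
  have "inner_L2 (\<lambda>x. p l x - q l x) h = inner_L2 (p l) h - inner_L2 (q l) h"
    unfolding inner_L2_def left_diff_distrib
    by (intro Bochner_Integration.integral_diff prob_densities_integrable_mult[OF p h]
        prob_densities_integrable_mult[OF q h])
  then show ?thesis
    using sum_dual[OF \<omega> p] sum_dual[OF \<sigma> q]
    by (simp add: mean_term_def sum_subtractf h_def right_diff_distrib)
qed

lemma expectation_T_trunc:
  assumes "finite S"
  shows "(LINT yz|M. T_trunc \<phi> \<omega> \<sigma> n j S yz)
    = (\<Sum>l\<in>UNIV. \<Sum>k\<in>S. (inner_L2 (\<lambda>x. p l x - q l x) (dilate \<phi> j k))\<^sup>2)
      - 1 / (real n)\<^sup>2 * (\<Sum>l\<in>UNIV. \<Sum>k\<in>S. \<Sum>i\<in>{1..n}. (mean_term j l k i)\<^sup>2)"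
proof -
  have E: "(LINT yz|M. T_trunc \<phi> \<omega> \<sigma> n j S yz) = 1 / (real n)\<^sup>2 *
     (\<Sum>l\<in>UNIV. \<Sum>k\<in>S. \<Sum>i1\<in>{1..n}. \<Sum>i2\<in>{1..n} - {i1}. mean_term j l k i1 * mean_term j l k i2)"
  proof -
    have "(LINT yz|M. (\<Sum>l\<in>UNIV. \<Sum>k\<in>S. \<Sum>i1\<in>{1..n}. \<Sum>i2\<in>{1..n} - {i1}.
        obs_term \<phi> \<omega> \<sigma> n j l k i1 yz * obs_term \<phi> \<omega> \<sigma> n j l k i2 yz))
      = (\<Sum>l\<in>UNIV. \<Sum>k\<in>S. \<Sum>i1\<in>{1..n}. \<Sum>i2\<in>{1..n} - {i1}.
         LINT yz|M. obs_term \<phi> \<omega> \<sigma> n j l k i1 yz * obs_term \<phi> \<omega> \<sigma> n j l k i2 yz)"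
      by (intro has_bochner_integral_integral_eq has_bochner_integral_sum has_bochner_integral_integrable
          integrable_obs_term_product) auto
    also have "\<dots> = (\<Sum>l\<in>UNIV. \<Sum>k\<in>S. \<Sum>i1\<in>{1..n}. \<Sum>i2\<in>{1..n} - {i1}. mean_term j l k i1 * mean_term j l k i2)"
      by (intro sum.cong refl expectation_product) auto
    finally show ?thesis unfolding T_trunc_def by simp
  qed
  \<comment> \<open>Full square minus diagonal; the root of the full square is evaluated by
    \<open>sum_mean_term\<close>.\<close>
  have sq: "(\<Sum>i1\<in>{1..n}. \<Sum>i2\<in>{1..n} - {i1}. mean_term j l k i1 * mean_term j l k i2)
      = (real n)\<^sup>2 * (inner_L2 (\<lambda>x. p l x - q l x) (dilate \<phi> j k))\<^sup>2 - (\<Sum>i\<in>{1..n}. (mean_term j l k i)\<^sup>2)" for l k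
  proof -
    have "(\<Sum>i1\<in>{1..n}. \<Sum>i2\<in>{1..n} - {i1}. mean_term j l k i1 * mean_term j l k i2)
      = (\<Sum>i1\<in>{1..n}. mean_term j l k i1 * (\<Sum>i2\<in>{1..n}. mean_term j l k i2) - (mean_term j l k i1)\<^sup>2)"
      by (intro sum.cong refl) (simp add: sum_diff1 right_diff_distrib power2_eq_square flip: sum_distrib_left)
    also have "\<dots> = (\<Sum>i\<in>{1..n}. mean_term j l k i)\<^sup>2 - (\<Sum>i\<in>{1..n}. (mean_term j l k i)\<^sup>2)"
      by (simp only: sum_subtractf sum_distrib_right[symmetric] power2_eq_square)
    finally show ?thesis by (simp only: sum_mean_term power_mult_distrib)
  qed
  show ?thesis
    unfolding E sq
    unfolding sum_subtractf sum_distrib_left[symmetric] right_diff_distrib using n_pos by simp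
qed

lemma expectation_T_trunc_tendsto:
  "(\<lambda>N. LINT yz|M. T_trunc \<phi> \<omega> \<sigma> n j {- int N..int N} yz) \<longlonglongrightarrow> M.expectation (T_stat \<phi> \<omega> \<sigma> n j)"
proof -
  obtain B where B: "\<And>S yz. finite S \<Longrightarrow> \<bar>T_trunc \<phi> \<omega> \<sigma> n j S yz\<bar> \<le> B"
    using T_trunc_bounded[of \<omega> \<sigma> n j] by blast
  show ?thesis
    by (rule integral_dominated_convergence[where w="\<lambda>_. B"])
      (auto intro!: M_measurable T_stat_measurable T_trunc_measurable phi_measurable T_trunc_tendsto B)
qed

lemma T_stat_measurable_M: "T_stat \<phi> \<omega> \<sigma> n j \<in> borel_measurable M"
  by (intro M_measurable T_stat_measurable)

lemma T_stat_integrable: "integrable M (\<lambda>yz. (T_stat \<phi> \<omega> \<sigma> n j yz)\<^sup>2)" "integrable M (T_stat \<phi> \<omega> \<sigma> n j)"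
proof -
  obtain B where B: "\<And>yz. \<bar>T_stat \<phi> \<omega> \<sigma> n j yz\<bar> \<le> B"
    using T_stat_bounded[of \<omega> \<sigma> n j] by blast
  show "integrable M (T_stat \<phi> \<omega> \<sigma> n j)"
    using T_stat_measurable_M B by (rule M.integrable_bounded)
  have "\<bar>(T_stat \<phi> \<omega> \<sigma> n j yz)\<^sup>2\<bar> \<le> B\<^sup>2" for yz
    using power_mono[OF B[of yz], of 2] by simp
  then show "integrable M (\<lambda>yz. (T_stat \<phi> \<omega> \<sigma> n j yz)\<^sup>2)"
    using T_stat_measurable_M by (intro M.integrable_bounded[where B="B\<^sup>2"]) auto
qed

end

section \<open>Besov bodies and the separation rate\<close>

lemma finite_sum_le_infsum_ennreal:
  fixes f :: "'a \<Rightarrow> ennreal"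
  assumes "finite F" "F \<subseteq> A"
  shows "sum f F \<le> infsum f A"
proof -
  have "infsum f F \<le> infsum f A"
    using assms by (intro infsum_mono_neutral nonneg_summable_on_complete) auto
  then show ?thesis using assms(1) by simp
qed

context wavelets
begin

text \<open>The Besov condition in the form needed for finite sums of real numbers. The set
  \<open>F\<close> is enlarged to the product of its projections, so that the iterated sums of
  \<open>besov_body\<close> dominate it.\<close>

lemma besov_tail:
  assumes h: "h \<in> besov_body \<psi> s R" and R: "0 \<le> R" and F: "finite F" "F \<subseteq> {j..} \<times> UNIV"
  shows "(\<Sum>(j', k)\<in>F. (inner_L2 h (dilate \<psi> j' k))\<^sup>2) \<le> R * 2 powr (- (2 * real j * s))"
proof -
  let ?b = "\<lambda>j' k. (inner_L2 h (dilate \<psi> j' k))\<^sup>2"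
  let ?J = "fst ` F" and ?K = "snd ` F"
  have sub: "F \<subseteq> ?J \<times> ?K" by force
  have fin: "finite ?J" "finite ?K" using F by auto
  have "ennreal (\<Sum>(j', k)\<in>F. ?b j' k) \<le> ennreal (\<Sum>(j', k)\<in>?J \<times> ?K. ?b j' k)"
    using fin sub by (intro ennreal_leI sum_mono2) auto
  also have "\<dots> = (\<Sum>j'\<in>?J. \<Sum>k\<in>?K. ennreal (?b j' k))"
    by (simp add: sum.cartesian_product[symmetric] sum_nonneg)
  also have "\<dots> \<le> (\<Sum>j'\<in>?J. \<Sum>\<^sub>\<infinity>k\<in>UNIV. ennreal (?b j' k))"
    using fin by (intro sum_mono finite_sum_le_infsum_ennreal) auto
  also have "\<dots> \<le> (\<Sum>\<^sub>\<infinity>j'\<in>{j..}. \<Sum>\<^sub>\<infinity>k\<in>UNIV. ennreal (?b j' k))"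
    using fin F(2) by (intro finite_sum_le_infsum_ennreal) auto
  finally have "ennreal (2 powr (2 * real j * s)) * ennreal (\<Sum>(j', k)\<in>F. ?b j' k)
    \<le> ennreal (2 powr (2 * real j * s)) * (\<Sum>\<^sub>\<infinity>j'\<in>{j..}. \<Sum>\<^sub>\<infinity>k\<in>UNIV. ennreal (?b j' k))"
    by (rule mult_left_mono) simp
  also have "\<dots> \<le> ennreal R"
  proof -
    have "(SUP j::nat. ennreal (2 powr (2 * real j * s)) *
        (\<Sum>\<^sub>\<infinity>j'\<in>{j..}. \<Sum>\<^sub>\<infinity>k\<in>UNIV. ennreal (?b j' k))) \<le> ennreal R"
      using h by (simp add: besov_body_def)
    then show ?thesis unfolding SUP_le_iff by blast
  qed
  finally have "2 powr (2 * real j * s) * (\<Sum>(j', k)\<in>F. ?b j' k) \<le> R"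
    using R by (simp add: sum_nonneg case_prod_unfold flip: ennreal_mult)
  then show ?thesis by (simp add: powr_minus field_simps)
qed

text \<open>Parseval at level \<open>j\<close> splits the squared norm into scaling coefficients and
  wavelet coefficients of level at least \<open>j\<close>; \<open>besov_tail\<close> bounds the
  latter. Asserting this for every finite superset of \<open>S\<^sub>0\<close> lets one symmetric
  window serve all components.\<close>

lemma besov_projection:
  assumes h: "h \<in> besov_body \<psi> s R" and R: "0 \<le> R" and "\<epsilon> > 0"
  obtains S\<^sub>0 where "finite S\<^sub>0"
    "\<And>S. finite S \<Longrightarrow> S\<^sub>0 \<subseteq> S \<Longrightarrow>
      inner_L2 h h - R * 2 powr (- (2 * real j * s)) - \<epsilon> \<le> (\<Sum>k\<in>S. (inner_L2 h (dilate \<phi> j k))\<^sup>2)"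
proof -
  have hL2: "h \<in> L2" using h by (simp add: besov_body_def)
  obtain F where F: "finite F" "F \<subseteq> UNIV <+> {j..} \<times> UNIV"
      "inner_L2 h h - (\<Sum>i\<in>F. (inner_L2 h (wavelet_family \<phi> \<psi> j i))\<^sup>2) < \<epsilon>"
    using parseval_approx[OF basis hL2 \<open>\<epsilon> > 0\<close>] by metis
  define S\<^sub>0 where "S\<^sub>0 = Inl -` F"
  define G where "G = Inr -` F"
  have split: "F = Inl ` S\<^sub>0 \<union> Inr ` G"
  proof
    show "F \<subseteq> Inl ` S\<^sub>0 \<union> Inr ` G"
    proof
      fix i assume "i \<in> F"
      then show "i \<in> Inl ` S\<^sub>0 \<union> Inr ` G" by (cases i) (auto simp: S\<^sub>0_def G_def)
    qed
  qed (auto simp: S\<^sub>0_def G_def)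
  have fin: "finite S\<^sub>0" "finite G"
    unfolding S\<^sub>0_def G_def using F(1) by (auto intro!: finite_vimageI)
  have "(\<Sum>i\<in>F. (inner_L2 h (wavelet_family \<phi> \<psi> j i))\<^sup>2)
    = (\<Sum>i\<in>Inl ` S\<^sub>0. (inner_L2 h (wavelet_family \<phi> \<psi> j i))\<^sup>2) + (\<Sum>i\<in>Inr ` G. (inner_L2 h (wavelet_family \<phi> \<psi> j i))\<^sup>2)"
    unfolding split using fin by (intro sum.union_disjoint) auto
  also have "\<dots> = (\<Sum>k\<in>S\<^sub>0. (inner_L2 h (dilate \<phi> j k))\<^sup>2) + (\<Sum>(j', k)\<in>G. (inner_L2 h (dilate \<psi> j' k))\<^sup>2)"
    by (simp add: sum.reindex case_prod_unfold wavelet_family_def)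
  also have "(\<Sum>(j', k)\<in>G. (inner_L2 h (dilate \<psi> j' k))\<^sup>2) \<le> R * 2 powr (- (2 * real j * s))"
    using F(2) by (intro besov_tail h R fin) (force simp: G_def)
  finally have le: "inner_L2 h h - R * 2 powr (- (2 * real j * s)) - \<epsilon> \<le> (\<Sum>k\<in>S\<^sub>0. (inner_L2 h (dilate \<phi> j k))\<^sup>2)"
    using F(3) by simp
  have "inner_L2 h h - R * 2 powr (- (2 * real j * s)) - \<epsilon> \<le> (\<Sum>k\<in>S. (inner_L2 h (dilate \<phi> j k))\<^sup>2)"
    if "finite S" "S\<^sub>0 \<subseteq> S" for S
    by (rule order_trans[OF le]) (use that in \<open>auto intro!: sum_mono2\<close>)
  with fin(1) that show thesis by blast
qed

end

section \<open>Separation rate and resolution level\<close>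

lemma sep_rate_pos: "0 < n \<Longrightarrow> 0 < sep_rate s n"
  by (simp add: sep_rate_def)

text \<open>Arithmetic of exponents with X = n^(2/(1+4s)): the squared rate is X^(-2s), and n^2
  times the fourth power of the rate is X. The middle claim holds because the exponent -4s/(1+4s) of
  the squared rate is larger than -1.\<close>

lemma sep_rate_powers:
  assumes "0 < n" "s > 0"
  shows "(real n)\<^sup>2 * sep_rate s n ^ 4 = real n powr (2 / (1 + 4 * s))"
    and "1 / real n \<le> (sep_rate s n)\<^sup>2"
    and "(sep_rate s n)\<^sup>2 = real n powr (- (2 / (1 + 4 * s)) * (2 * s))"
proof -
  have n: "real n > 0" using assms by simp
  have r: "sep_rate s n > 0" using assms by (simp add: sep_rate_pos)
  have "sep_rate s n powr 4 = real n powr (- (2 * s / (1 + 4 * s)) * 4)"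
    by (simp only: sep_rate_def powr_powr)
  then have "(real n)\<^sup>2 * sep_rate s n ^ 4 = real n powr 2 * real n powr (- (2 * s / (1 + 4 * s)) * 4)"
    using n r by simp
  also have "\<dots> = real n powr (2 + - (2 * s / (1 + 4 * s)) * 4)"
    by (simp only: powr_add)
  also have "2 + - (2 * s / (1 + 4 * s)) * 4 = 2 / (1 + 4 * s)"
    using assms(2) by (simp add: field_simps)
  finally show "(real n)\<^sup>2 * sep_rate s n ^ 4 = real n powr (2 / (1 + 4 * s))" .
  have sq: "(sep_rate s n)\<^sup>2 = real n powr (- (2 * s / (1 + 4 * s)) * 2)"
  proof -
    have "sep_rate s n powr 2 = real n powr (- (2 * s / (1 + 4 * s)) * 2)"
      by (simp only: sep_rate_def powr_powr)
    then show ?thesis using r by simp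
  qed
  also have "- (2 * s / (1 + 4 * s)) * 2 = - (2 / (1 + 4 * s)) * (2 * s)" by simp
  finally show "(sep_rate s n)\<^sup>2 = real n powr (- (2 / (1 + 4 * s)) * (2 * s))" .
  have "- 1 \<le> - (2 * s / (1 + 4 * s)) * 2" using assms(2) by (simp add: field_simps)
  then have "real n powr - 1 \<le> (sep_rate s n)\<^sup>2"
    unfolding sq using assms(1) by (intro powr_mono) auto
  then show "1 / real n \<le> (sep_rate s n)\<^sup>2"
    using n by (simp add: powr_minus_divide)
qed

text \<open>Minimality gives the upper estimate: the level before the least one fails, so 2^j is at
  most twice the target. At level 0 there is no level before, and the target being at least 1 is
  used instead.\<close>

lemma level_bounds:
  assumes "0 < n" "s > 0"
  shows "real n powr (2 / (1 + 4 * s)) \<le> 2 ^ level s n"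
    and "2 ^ level s n \<le> 2 * real n powr (2 / (1 + 4 * s))"
proof -
  define a where "a = 2 / (1 + 4 * s)"
  define X where "X = real n powr a"
  have a: "a > 0" using assms by (simp add: a_def)
  have X: "X \<ge> 1" unfolding X_def using assms a by (intro ge_one_powr_ge_zero) auto
  have iff: "2 powr (- real j) \<le> real n powr (- (2 / (1 + 4 * s))) \<longleftrightarrow> X \<le> 2 ^ j" for j :: nat
  proof -
    have "2 powr (- real j) = inverse ((2::real) ^ j)" by (simp add: powr_minus powr_realpow)
    moreover have "real n powr (- (2 / (1 + 4 * s))) = inverse X"
      by (simp add: X_def a_def powr_minus)
    ultimately show ?thesis using X inverse_le_iff_le[of "2 ^ j" X] by auto
  qed
  have lev: "level s n = (LEAST j::nat. X \<le> 2 ^ j)" unfolding level_def iff ..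
  obtain j0 :: nat where "X \<le> 2 ^ j0"
    using real_arch_pow[of 2 X] by (auto intro: less_imp_le)
  then show "real n powr (2 / (1 + 4 * s)) \<le> 2 ^ level s n"
    unfolding lev X_def[symmetric] a_def[symmetric] by (rule LeastI)
  show "2 ^ level s n \<le> 2 * real n powr (2 / (1 + 4 * s))"
  proof (cases "level s n")
    case 0
    then show ?thesis using X unfolding X_def a_def by simp
  next
    case (Suc j)
    then have "\<not> X \<le> 2 ^ j" using not_less_Least[of j "\<lambda>j. X \<le> 2 ^ j"] lev by simp
    then show ?thesis unfolding Suc X_def[symmetric] a_def[symmetric] by simp
  qed
qed

text \<open>All claims follow from X <= 2^j <= 2X with X = n^(2/(1+4s)). The second and third bound
  the variance and the approximation error in the upper bound; the first and fourth control the
  chi-square distance and the Besov condition in the lower bound.\<close>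

lemma level_sep_rate:
  assumes "0 < n" "s > 0"
  shows "(real n)\<^sup>2 * sep_rate s n ^ 4 \<le> 2 ^ level s n"
    and "2 ^ level s n / (real n)\<^sup>2 \<le> 2 * sep_rate s n ^ 4"
    and "2 powr (- (2 * real (level s n) * s)) \<le> (sep_rate s n)\<^sup>2"
    and "2 powr (2 * real (level s n) * s) * (sep_rate s n)\<^sup>2 \<le> 2 powr (2 * s)"
proof -
  define X where "X = real n powr (2 / (1 + 4 * s))"
  have n: "0 < real n" using assms by simp
  have X: "X > 0" using n by (simp add: X_def)
  note lb = level_bounds[OF assms, folded X_def]
  show "(real n)\<^sup>2 * sep_rate s n ^ 4 \<le> 2 ^ level s n"
    using lb(1) sep_rate_powers(1)[OF assms] by (simp add: X_def)
  show "2 ^ level s n / (real n)\<^sup>2 \<le> 2 * sep_rate s n ^ 4"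
    using lb(2) sep_rate_powers(1)[OF assms, folded X_def] n by (simp add: field_simps)
  have r: "(sep_rate s n)\<^sup>2 = X powr (- (2 * s))"
    using sep_rate_powers(3)[OF assms] by (simp add: X_def powr_powr)
  have pow: "2 powr (c * real (level s n) * s) = (2 ^ level s n) powr (c * s)" for c
    by (simp add: powr_realpow[symmetric] powr_powr mult_ac)
  have "2 powr (- (2 * real (level s n) * s)) = (2 ^ level s n) powr (- (2 * s))"
    using pow[of "- 2"] by simp
  also have "\<dots> \<le> X powr (- (2 * s))"
    using X lb(1) assms(2) by (intro powr_mono2') auto
  finally show "2 powr (- (2 * real (level s n) * s)) \<le> (sep_rate s n)\<^sup>2" by (simp add: r)
  have "2 powr (2 * real (level s n) * s) * (sep_rate s n)\<^sup>2
      \<le> (2 * X) powr (2 * s) * X powr (- (2 * s))"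
    unfolding pow r using lb(2) assms(2) by (intro mult_right_mono powr_mono2) auto
  also have "\<dots> = 2 powr (2 * s)"
    using X by (simp add: powr_mult powr_minus)
  finally show "2 powr (2 * real (level s n) * s) * (sep_rate s n)\<^sup>2 \<le> 2 powr (2 * s)" .
qed

section \<open>Upper bound\<close>

definition variance_rate :: "nat \<Rightarrow> ('m::finite \<Rightarrow> real \<Rightarrow> real) \<Rightarrow> ('m \<Rightarrow> real \<Rightarrow> real) \<Rightarrow> nat \<Rightarrow> real" where
  "variance_rate n p q j = 2 ^ j / (real n)\<^sup>2
     + 1 / real n * (\<Sum>l\<in>UNIV. (norm_L2 (\<lambda>x. p l x - q l x))\<^sup>2)
     + sqrt (2 ^ j / real n ^ 3) * (\<Sum>l\<in>UNIV. norm_L2 (\<lambda>x. p l x - q l x))"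

lemma variance_boundD:
  fixes \<omega> \<sigma> :: "nat \<Rightarrow> 'm::finite \<Rightarrow> nat \<Rightarrow> real"
  assumes "variance_bound \<A> \<phi> \<psi> R s \<omega> \<sigma> K C\<^sub>T" "C > 0"
  shows "\<forall>\<^sub>F n in sequentially. \<forall>(p, q) \<in> Theta0 R \<union> Theta1 \<A> \<psi> R C n s. \<forall>j.
    prob_space.variance (obs_law (\<omega> n) (\<sigma> n) n (p, q)) (T_stat \<phi> (\<omega> n) (\<sigma> n) n j)
      \<le> C\<^sub>T * variance_rate n p q j * ((real CARD('m))\<^sup>2 / K\<^sup>2)"
  using assms unfolding variance_bound_def variance_rate_def by blast


context mixture_model
begin

text \<open>All scaling coefficients of the differences vanish; what remains is the diagonal, which
  enters with a minus sign, so the bias works in favour of the null hypothesis.\<close>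

lemma expectation_T_null:
  assumes "p = q"
  shows "M.expectation (T_stat \<phi> \<omega> \<sigma> n j) \<le> 0"
proof (rule LIMSEQ_le_const2[OF expectation_T_trunc_tendsto], intro exI allI impI)
  fix N :: nat
  have "inner_L2 (\<lambda>x. p l x - q l x) h = 0" for l h by (simp add: assms inner_L2_def)
  then show "(LINT yz|M. T_trunc \<phi> \<omega> \<sigma> n j {- int N..int N} yz) \<le> 0"
    by (simp add: expectation_T_trunc sum_nonneg)
qed

text \<open>Summation over \<open>k\<close> comes first: Bessel's inequality for each mixture
  density, whose squared norm is at most \<open>R\<close>, removes \<open>S\<close> and
  \<open>j\<close> from the bound. One factor 2 of the constant comes from (x-y)^2 <= 2x^2 + 2y^2,
  the other from the two samples.\<close>

lemma bias_bound:
  assumes R: "\<And>u. p u \<in> Linf_ball R" "\<And>u. q u \<in> Linf_ball R" and S: "finite S"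
  shows "1 / (real n)\<^sup>2 * (\<Sum>l\<in>UNIV. \<Sum>k\<in>S. \<Sum>i\<in>{1..n}. (mean_term j l k i)\<^sup>2)
    \<le> 4 * R * real CARD('m) / (K * real n)"
proof -
  have inner_le: "(\<Sum>k\<in>S. (mean_term j l k i)\<^sup>2)
      \<le> 2 * R * (dual_weight \<omega> n l i)\<^sup>2 + 2 * R * (dual_weight \<sigma> n l i)\<^sup>2" if i: "i \<in> {1..n}" for l i
  proof -
    define f g where "f = mixture \<omega> p i" and "g = mixture \<sigma> q i"
    define a b where "a = dual_weight \<omega> n l i" and "b = dual_weight \<sigma> n l i"
    have f: "f \<in> L2" "inner_L2 f f \<le> R" and g: "g \<in> L2" "inner_L2 g g \<le> R"
      unfolding f_def g_def
      using prob_densities_bounded_L2[OF mixture_prob_density[OF mixing(1) i p] mixture_Linf[OF mixing(1) i p R(1)]]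
        prob_densities_bounded_L2[OF mixture_prob_density[OF mixing(2) i q] mixture_Linf[OF mixing(2) i q R(2)]]
      by auto
    have bes: "(\<Sum>k\<in>S. (inner_L2 f (dilate \<phi> j k))\<^sup>2) \<le> R" "(\<Sum>k\<in>S. (inner_L2 g (dilate \<phi> j k))\<^sup>2) \<le> R"
      using bessel_phi[OF S f(1)] bessel_phi[OF S g(1)] f(2) g(2) order_trans by blast+
    have "(mean_term j l k i)\<^sup>2
       \<le> 2 * a\<^sup>2 * (inner_L2 f (dilate \<phi> j k))\<^sup>2 + 2 * b\<^sup>2 * (inner_L2 g (dilate \<phi> j k))\<^sup>2" for k
    proof -
      have "(x - y)\<^sup>2 \<le> 2 * x\<^sup>2 + 2 * y\<^sup>2" for x y :: real
        using zero_le_power2[of "x + y"] by (simp add: power2_sum power2_diff)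
      from this[of "a * inner_L2 f (dilate \<phi> j k)" "b * inner_L2 g (dilate \<phi> j k)"]
      show ?thesis by (simp add: mean_term_def a_def b_def f_def g_def power_mult_distrib)
    qed
    then have "(\<Sum>k\<in>S. (mean_term j l k i)\<^sup>2)
       \<le> (\<Sum>k\<in>S. 2 * a\<^sup>2 * (inner_L2 f (dilate \<phi> j k))\<^sup>2 + 2 * b\<^sup>2 * (inner_L2 g (dilate \<phi> j k))\<^sup>2)"
      by (rule sum_mono)
    also have "\<dots> = 2 * a\<^sup>2 * (\<Sum>k\<in>S. (inner_L2 f (dilate \<phi> j k))\<^sup>2) + 2 * b\<^sup>2 * (\<Sum>k\<in>S. (inner_L2 g (dilate \<phi> j k))\<^sup>2)"
      by (simp add: sum.distrib sum_distrib_left)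
    also have "\<dots> \<le> 2 * a\<^sup>2 * R + 2 * b\<^sup>2 * R"
      using bes by (intro add_mono mult_left_mono) auto
    finally show ?thesis by (simp add: a_def b_def mult_ac)
  qed
  have R0: "0 \<le> R"
    using prob_densities_bounded_L2(2)[OF p R(1)] inner_L2_self_nonneg order_trans by blast
  have "(\<Sum>l\<in>UNIV. \<Sum>k\<in>S. \<Sum>i\<in>{1..n}. (mean_term j l k i)\<^sup>2)
      = (\<Sum>l\<in>UNIV. \<Sum>i\<in>{1..n}. \<Sum>k\<in>S. (mean_term j l k i)\<^sup>2)"
    by (intro sum.cong refl) (rule sum.swap)
  also have "\<dots> \<le> (\<Sum>l\<in>UNIV. \<Sum>i\<in>{1..n}. 2 * R * (dual_weight \<omega> n l i)\<^sup>2 + 2 * R * (dual_weight \<sigma> n l i)\<^sup>2)"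
    by (intro sum_mono inner_le)
  also have "\<dots> = (\<Sum>l\<in>UNIV. 2 * R * (\<Sum>i\<in>{1..n}. (dual_weight \<omega> n l i)\<^sup>2) + 2 * R * (\<Sum>i\<in>{1..n}. (dual_weight \<sigma> n l i)\<^sup>2))"
    by (simp add: sum.distrib sum_distrib_left)
  also have "\<dots> \<le> (\<Sum>l\<in>(UNIV::'m set). 2 * R * (real n / K) + 2 * R * (real n / K))"
    using R0 by (intro sum_mono add_mono mult_left_mono
        spread_weights.dual_weight_sum_squares[OF \<omega>] spread_weights.dual_weight_sum_squares[OF \<sigma>]) auto
  also have "\<dots> = 4 * R * real CARD('m) * real n / K" by simp
  finally have "1 / (real n)\<^sup>2 * (\<Sum>l\<in>UNIV. \<Sum>k\<in>S. \<Sum>i\<in>{1..n}. (mean_term j l k i)\<^sup>2)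
      \<le> 1 / (real n)\<^sup>2 * (4 * R * real CARD('m) * real n / K)"
    by (rule mult_left_mono) simp
  also have "\<dots> = 4 * R * real CARD('m) / (K * real n)"
    using n_pos K_pos by (simp add: field_simps power2_eq_square)
  finally show ?thesis .
qed

lemma expectation_T_alternative:
  assumes R: "\<And>u. p u \<in> Linf_ball R" "\<And>u. q u \<in> Linf_ball R"
    and besov: "\<And>u. (\<lambda>x. p u x - q u x) \<in> besov_body \<psi> s R"
  shows "(\<Sum>l\<in>UNIV. (norm_L2 (\<lambda>x. p l x - q l x))\<^sup>2)
      - real CARD('m) * (R * 2 powr (- (2 * real j * s))) - 4 * R * real CARD('m) / (K * real n)
    \<le> M.expectation (T_stat \<phi> \<omega> \<sigma> n j)"
proof (rule field_le_epsilon)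
  fix e :: real assume e: "e > 0"
  \<comment> \<open>Each component may lose an equal share of \<open>e\<close> through its finite
    window.\<close>
  define \<epsilon> where "\<epsilon> = e / real CARD('m)"
  have \<epsilon>: "\<epsilon> > 0" using e by (simp add: \<epsilon>_def)
  have R0: "0 \<le> R"
    using prob_densities_bounded_L2(2)[OF p R(1)] inner_L2_self_nonneg order_trans by blast
  let ?d = "\<lambda>l x. p l x - q l x"
  let ?c = "R * 2 powr (- (2 * real j * s))"
  define good where "good l S \<longleftrightarrow>
      inner_L2 (?d l) (?d l) - ?c - \<epsilon> \<le> (\<Sum>k\<in>S. (inner_L2 (?d l) (dilate \<phi> j k))\<^sup>2)" for l S
  have "\<exists>S\<^sub>0. finite S\<^sub>0 \<and> (\<forall>S. finite S \<longrightarrow> S\<^sub>0 \<subseteq> S \<longrightarrow> good l S)" for l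
  proof -
    obtain S\<^sub>0 where "finite S\<^sub>0" "\<And>S. finite S \<Longrightarrow> S\<^sub>0 \<subseteq> S \<Longrightarrow> good l S"
      unfolding good_def using besov_projection[OF besov R0 \<epsilon>, of l j] by blast
    then show ?thesis by blast
  qed
  then obtain S\<^sub>0 where S\<^sub>0: "\<And>l. finite (S\<^sub>0 l)" "\<And>l S. finite S \<Longrightarrow> S\<^sub>0 l \<subseteq> S \<Longrightarrow> good l S"
    by metis
  have "finite (abs ` (\<Union>l. S\<^sub>0 l))" using S\<^sub>0(1) by auto
  then obtain b where b: "\<And>l k. k \<in> S\<^sub>0 l \<Longrightarrow> \<bar>k\<bar> \<le> b"
    using bdd_above_finite[of "abs ` (\<Union>l. S\<^sub>0 l)"] by (auto simp: bdd_above_def)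
  have "(\<Sum>l\<in>UNIV. (norm_L2 (?d l))\<^sup>2) - real CARD('m) * ?c - 4 * R * real CARD('m) / (K * real n) - e
     \<le> M.expectation (T_stat \<phi> \<omega> \<sigma> n j)"
  proof (rule LIMSEQ_le_const[OF expectation_T_trunc_tendsto], intro exI allI impI)
    fix N :: nat assume N: "nat b \<le> N"
    let ?S = "{- int N..int N}"
    have sub: "S\<^sub>0 l \<subseteq> ?S" for l
    proof
      fix k assume "k \<in> S\<^sub>0 l"
      with b[of k l] N show "k \<in> ?S" by (auto simp: abs_le_iff)
    qed
    have "(\<Sum>l\<in>UNIV. inner_L2 (?d l) (?d l) - ?c - \<epsilon>)
        \<le> (\<Sum>l\<in>UNIV. \<Sum>k\<in>?S. (inner_L2 (?d l) (dilate \<phi> j k))\<^sup>2)"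
      using S\<^sub>0(2)[OF _ sub] by (intro sum_mono) (simp add: good_def)
    then have "(\<Sum>l\<in>UNIV. (norm_L2 (?d l))\<^sup>2) - real CARD('m) * ?c - e
        \<le> (\<Sum>l\<in>UNIV. \<Sum>k\<in>?S. (inner_L2 (?d l) (dilate \<phi> j k))\<^sup>2)"
      by (simp add: sum_subtractf norm_L2_sq \<epsilon>_def)
    with bias_bound[OF R, of ?S j]
    show "(\<Sum>l\<in>UNIV. (norm_L2 (?d l))\<^sup>2) - real CARD('m) * ?c - 4 * R * real CARD('m) / (K * real n) - e
      \<le> (LINT yz|M. T_trunc \<phi> \<omega> \<sigma> n j ?S yz)"
      by (simp add: expectation_T_trunc)
  qed
  then show "(\<Sum>l\<in>UNIV. (norm_L2 (?d l))\<^sup>2) - real CARD('m) * ?c - 4 * R * real CARD('m) / (K * real n)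
     \<le> M.expectation (T_stat \<phi> \<omega> \<sigma> n j) + e" by simp
qed

lemma T_upper_tail:
  assumes "M.expectation (T_stat \<phi> \<omega> \<sigma> n j) < c"
  shows "M.prob {yz \<in> space M. c < T_stat \<phi> \<omega> \<sigma> n j yz}
    \<le> M.variance (T_stat \<phi> \<omega> \<sigma> n j) / (c - M.expectation (T_stat \<phi> \<omega> \<sigma> n j))\<^sup>2"
proof -
  let ?T = "T_stat \<phi> \<omega> \<sigma> n j"
  have [measurable]: "?T \<in> borel_measurable M" by (rule T_stat_measurable_M)
  have "M.prob {yz \<in> space M. c < ?T yz}
      \<le> M.prob {yz \<in> space M. c - M.expectation ?T \<le> \<bar>?T yz - M.expectation ?T\<bar>}"
    by (intro M.finite_measure_mono) auto
  also have "\<dots> \<le> M.variance ?T / (c - M.expectation ?T)\<^sup>2"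
    using assms by (intro M.Chebyshev_inequality T_stat_measurable_M T_stat_integrable) auto
  finally show ?thesis .
qed

lemma T_lower_tail:
  assumes "c < M.expectation (T_stat \<phi> \<omega> \<sigma> n j)"
  shows "M.prob {yz \<in> space M. T_stat \<phi> \<omega> \<sigma> n j yz \<le> c}
    \<le> M.variance (T_stat \<phi> \<omega> \<sigma> n j) / (M.expectation (T_stat \<phi> \<omega> \<sigma> n j) - c)\<^sup>2"
proof -
  let ?T = "T_stat \<phi> \<omega> \<sigma> n j"
  have [measurable]: "?T \<in> borel_measurable M" by (rule T_stat_measurable_M)
  have "M.prob {yz \<in> space M. ?T yz \<le> c}
      \<le> M.prob {yz \<in> space M. M.expectation ?T - c \<le> \<bar>?T yz - M.expectation ?T\<bar>}"
    by (intro M.finite_measure_mono) auto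
  also have "\<dots> \<le> M.variance ?T / (M.expectation ?T - c)\<^sup>2"
    using assms by (intro M.Chebyshev_inequality T_stat_measurable_M T_stat_integrable) auto
  finally show ?thesis .
qed

text \<open>Under the null the variance bound reduces to its first term, at most 2 C_T r^4 (M/K)^2,
  while the mean stays below the threshold by at least 2 sqrt(C_T/\<gamma>) (M/K) r^2. Chebyshev's
  quotient is then \<gamma>/2.\<close>

lemma type_I_error:
  assumes "p = q" "0 < \<gamma>" "0 < C\<^sub>T" "0 \<le> L'" "s > 0"
    and var: "M.variance (T_stat \<phi> \<omega> \<sigma> n (level s n))
      \<le> C\<^sub>T * variance_rate n p q (level s n) * ((real CARD('m))\<^sup>2 / K\<^sup>2)"
  shows "M.prob {yz \<in> space M. threshold_const C\<^sub>T \<gamma> L' R CARD('m) K * (sep_rate s n)\<^sup>2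
      < T_stat \<phi> \<omega> \<sigma> n (level s n) yz} \<le> \<gamma> / 2"
proof -
  define m where "m = real CARD('m) / K"
  define r where "r = sep_rate s n"
  define t where "t = threshold_const C\<^sub>T \<gamma> L' R CARD('m) K"
  let ?T = "T_stat \<phi> \<omega> \<sigma> n (level s n)"
  have m: "m > 0" using K_pos by (simp add: m_def)
  have r: "r > 0" using n_pos by (simp add: r_def sep_rate_pos)
  have t: "2 * sqrt (C\<^sub>T / \<gamma>) * m \<le> t"
    using assms m unfolding t_def threshold_const_def m_def[symmetric]
    by (intro mult_right_mono) auto
  have t0: "0 < 2 * sqrt (C\<^sub>T / \<gamma>) * m" using assms m by simp
  have V: "M.variance ?T \<le> C\<^sub>T * (2 * r ^ 4) * m\<^sup>2"
  proof -
    have "variance_rate n p q (level s n) = 2 ^ level s n / (real n)\<^sup>2"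
      unfolding variance_rate_def by (simp add: assms(1) norm_L2_def)
    also have "\<dots> \<le> 2 * r ^ 4" unfolding r_def using n_pos assms by (intro level_sep_rate(2))
    finally have "C\<^sub>T * variance_rate n p q (level s n) * m\<^sup>2 \<le> C\<^sub>T * (2 * r ^ 4) * m\<^sup>2"
      using assms by (intro mult_right_mono mult_left_mono) auto
    with var show ?thesis by (simp add: m_def power_divide)
  qed
  have E: "M.expectation ?T \<le> 0" by (rule expectation_T_null[OF assms(1)])
  have "0 < t" using t t0 by linarith
  then have tr: "0 < t * r\<^sup>2" using r by simp
  have "M.prob {yz \<in> space M. t * r\<^sup>2 < ?T yz} \<le> M.variance ?T / (t * r\<^sup>2 - M.expectation ?T)\<^sup>2"
    using E tr by (intro T_upper_tail) linarith
  also have "\<dots> \<le> (C\<^sub>T * (2 * r ^ 4) * m\<^sup>2) / (2 * sqrt (C\<^sub>T / \<gamma>) * m * r\<^sup>2)\<^sup>2"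
  proof (rule frac_le)
    show "0 \<le> C\<^sub>T * (2 * r ^ 4) * m\<^sup>2" using assms r by simp
    have pos: "0 < 2 * sqrt (C\<^sub>T / \<gamma>) * m * r\<^sup>2" by (rule mult_pos_pos[OF t0 zero_less_power[OF r]])
    then show "0 < (2 * sqrt (C\<^sub>T / \<gamma>) * m * r\<^sup>2)\<^sup>2" by (rule zero_less_power)
    have "2 * sqrt (C\<^sub>T / \<gamma>) * m * r\<^sup>2 \<le> t * r\<^sup>2" using t by (intro mult_right_mono) auto
    then show "(2 * sqrt (C\<^sub>T / \<gamma>) * m * r\<^sup>2)\<^sup>2 \<le> (t * r\<^sup>2 - M.expectation ?T)\<^sup>2"
      using E pos by (intro power_mono) linarith+
  qed (rule V)
  also have "\<dots> = \<gamma> / 2"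
  proof -
    have "(sqrt (C\<^sub>T / \<gamma>))\<^sup>2 = C\<^sub>T / \<gamma>" using assms by simp
    then have "(2 * sqrt (C\<^sub>T / \<gamma>) * m * r\<^sup>2)\<^sup>2 = 4 * (C\<^sub>T / \<gamma>) * m\<^sup>2 * r ^ 4"
      by (simp add: power_mult_distrib flip: power_mult)
    then show ?thesis using assms m r by (simp add: field_simps)
  qed
  finally show ?thesis by (simp add: t_def r_def)
qed

text \<open>Everything is measured by x, the root of the summed squared distances, with x >= C r.
  The second condition on \<open>C\<close> keeps the mean above the threshold by half of x^2, the
  variance is at most a constant times x^4 / C^2, and the third condition makes Chebyshev's quotient
  at most \<gamma>/2. No upper bound on the separation enters.\<close>

lemma type_II_error:
  assumes R: "\<And>u. p u \<in> Linf_ball R" "\<And>u. q u \<in> Linf_ball R"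
    and besov: "\<And>u. (\<lambda>x. p u x - q u x) \<in> besov_body \<psi> s R"
    and sep: "\<exists>u. C * sep_rate s n \<le> norm_L2 (\<lambda>x. p u x - q u x)"
    and pos: "0 < \<gamma>" "0 < C\<^sub>T" "s > 0" "0 \<le> t"
    and C: "1 \<le> C" "2 * (real CARD('m) * R + 4 * R * real CARD('m) / K + t) \<le> C\<^sup>2"
      "8 * (C\<^sub>T * (real CARD('m) / K)\<^sup>2 * (3 + 2 * real CARD('m))) / \<gamma> \<le> C\<^sup>2"
    and var: "M.variance (T_stat \<phi> \<omega> \<sigma> n (level s n))
      \<le> C\<^sub>T * variance_rate n p q (level s n) * ((real CARD('m))\<^sup>2 / K\<^sup>2)"
  shows "M.prob {yz \<in> space M. T_stat \<phi> \<omega> \<sigma> n (level s n) yz \<le> t * (sep_rate s n)\<^sup>2} \<le> \<gamma> / 2"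
proof -
  define m where "m = real CARD('m)"
  define r where "r = sep_rate s n"
  define d where "d l = norm_L2 (\<lambda>x. p l x - q l x)" for l
  define S where "S = (\<Sum>l\<in>UNIV. (d l)\<^sup>2)"
  define x where "x = sqrt S"
  define V where "V = C\<^sub>T * (m / K)\<^sup>2"
  let ?T = "T_stat \<phi> \<omega> \<sigma> n (level s n)"
  have m: "m \<ge> 1" by (simp add: m_def)
  have r: "r > 0" using n_pos by (simp add: r_def sep_rate_pos)
  have V: "V > 0" using pos m K_pos by (simp add: V_def)
  have R0: "0 \<le> R"
    using prob_densities_bounded_L2(2)[OF p R(1)] inner_L2_self_nonneg order_trans by blast
  have dS: "(d l)\<^sup>2 \<le> S" for l
    unfolding S_def by (rule member_le_sum) auto
  have S0: "0 \<le> S" by (simp add: S_def sum_nonneg)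
  then have x2: "x\<^sup>2 = S" by (simp add: x_def)
  have dx: "d l \<le> x" for l
    unfolding x_def by (rule real_le_rsqrt[OF dS])
  obtain u where u: "C * r \<le> d u" using sep by (auto simp: d_def r_def)
  have Crx: "C * r \<le> x" using u dx[of u] by linarith
  have rx: "r \<le> x / C" using Crx C(1) by (simp add: field_simps)
  have x: "x > 0" using Crx r C(1) by (meson less_le_trans mult_pos_pos zero_less_one)
  \<comment> \<open>The two losses of the mean, approximation and bias, are of order r^2; together
    with the threshold they amount to at most half of C^2 r^2, hence of \<open>S\<close>.\<close>
  have E: "S / 2 \<le> M.expectation ?T - t * r\<^sup>2"
  proof -
    have "m * (R * 2 powr (- (2 * real (level s n) * s))) \<le> m * (R * r\<^sup>2)"
      unfolding r_def using m R0 n_pos pos by (intro mult_left_mono level_sep_rate(3)) auto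
    moreover have "4 * R * m / (K * real n) \<le> 4 * R * m / K * r\<^sup>2"
    proof -
      have "4 * R * m / (K * real n) = 4 * R * m / K * (1 / real n)" by simp
      also have "\<dots> \<le> 4 * R * m / K * r\<^sup>2"
        unfolding r_def using R0 m K_pos n_pos pos by (intro mult_left_mono sep_rate_powers(2)) auto
      finally show ?thesis .
    qed
    moreover define c where "c = m * R + 4 * R * m / K"
    ultimately have "S - c * r\<^sup>2 \<le> M.expectation ?T"
      using expectation_T_alternative[OF R besov, of "level s n"]
      by (simp add: S_def d_def m_def algebra_simps)
    moreover have "c * r\<^sup>2 + t * r\<^sup>2 \<le> C\<^sup>2 * r\<^sup>2 / 2"
    proof -
      have "(c + t) * r\<^sup>2 \<le> C\<^sup>2 / 2 * r\<^sup>2"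
        using C(2) by (intro mult_right_mono) (auto simp: m_def c_def)
      then show ?thesis by (simp add: distrib_right)
    qed
    moreover have "C\<^sup>2 * r\<^sup>2 \<le> S"
      unfolding x2[symmetric] power_mult_distrib[symmetric]
      using Crx C(1) r by (intro power_mono) auto
    ultimately show ?thesis by linarith
  qed
  \<comment> \<open>With r <= x/C, each of the three terms is at most x^4 divided by a power of
    \<open>C\<close> with exponent at least 2, up to the factors 2, 1 and 2m.\<close>
  have "variance_rate n p q (level s n) \<le> (3 + 2 * m) * (x ^ 4 / C\<^sup>2)"
  proof -
    have C1: "C\<^sup>2 \<le> C ^ 4" "C\<^sup>2 \<le> C ^ 3" using C(1) by (auto intro: power_increasing)
    have C0: "0 < C" using C(1) by simp
    have r4: "r ^ 4 \<le> x ^ 4 / C\<^sup>2"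
    proof -
      have "r ^ 4 \<le> (x / C) ^ 4" using rx r by (intro power_mono) auto
      also have "\<dots> \<le> x ^ 4 / C\<^sup>2" unfolding power_divide using C1 C0 by (intro divide_left_mono) auto
      finally show ?thesis .
    qed
    have "2 ^ level s n / (real n)\<^sup>2 \<le> 2 * (x ^ 4 / C\<^sup>2)"
      using level_sep_rate(2)[OF n_pos pos(3)] r4 by (simp add: r_def)
    moreover have "1 / real n * S \<le> x ^ 4 / C\<^sup>2"
    proof -
      have "1 / real n \<le> r\<^sup>2" unfolding r_def using n_pos pos(3) by (intro sep_rate_powers(2))
      also have "r\<^sup>2 \<le> (x / C)\<^sup>2" using rx r by (intro power_mono) auto
      finally have "1 / real n * S \<le> (x / C)\<^sup>2 * S" using S0 by (intro mult_right_mono)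
      also have "\<dots> = x ^ 4 / C\<^sup>2" by (simp add: power_divide flip: x2 power_add)
      finally show ?thesis .
    qed
    moreover have "sqrt (2 ^ level s n / real n ^ 3) * (\<Sum>l\<in>UNIV. d l) \<le> 2 * m * (x ^ 4 / C\<^sup>2)"
    proof -
      have "2 ^ level s n / real n ^ 3 = 2 ^ level s n / (real n)\<^sup>2 * (1 / real n)"
        by (simp add: power2_eq_square power3_eq_cube)
      also have "\<dots> \<le> 2 * r ^ 4 * r\<^sup>2"
        unfolding r_def using n_pos pos(3) r
        by (intro mult_mono level_sep_rate(2) sep_rate_powers(2)) auto
      also have "\<dots> \<le> (2 * r ^ 3)\<^sup>2" using r by (simp add: power_mult_distrib flip: power_add power_mult)
      finally have "sqrt (2 ^ level s n / real n ^ 3) \<le> sqrt ((2 * r ^ 3)\<^sup>2)" by (rule real_sqrt_le_mono)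
      moreover have "sqrt ((2 * r ^ 3)\<^sup>2) = 2 * r ^ 3" unfolding real_sqrt_abs using r by simp
      ultimately have "sqrt (2 ^ level s n / real n ^ 3) \<le> 2 * r ^ 3" by (simp only:)
      moreover have "(\<Sum>l\<in>UNIV. d l) \<le> m * x"
        using sum_bounded_above[of UNIV d x] dx by (simp add: m_def)
      ultimately have "sqrt (2 ^ level s n / real n ^ 3) * (\<Sum>l\<in>UNIV. d l) \<le> (2 * r ^ 3) * (m * x)"
        using r by (intro mult_mono) (auto simp: d_def norm_L2_nonneg sum_nonneg)
      also have "\<dots> = 2 * m * (r ^ 3 * x)" by simp
      also have "\<dots> \<le> 2 * m * (x ^ 4 / C\<^sup>2)"
      proof (rule mult_left_mono)
        have "r ^ 3 * x \<le> (x / C) ^ 3 * x" using rx r x by (intro mult_right_mono power_mono) auto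
        also have "\<dots> = x ^ 4 / C ^ 3" by (simp add: power_divide power_numeral_reduce mult_ac)
        also have "\<dots> \<le> x ^ 4 / C\<^sup>2" using C1 C0 by (intro divide_left_mono) auto
        finally show "r ^ 3 * x \<le> x ^ 4 / C\<^sup>2" .
      qed (use m in auto)
      finally show ?thesis .
    qed
    ultimately show ?thesis
      unfolding variance_rate_def d_def[symmetric] S_def[symmetric] distrib_right by linarith
  qed
  then have "C\<^sub>T * variance_rate n p q (level s n) * (m / K)\<^sup>2 \<le> C\<^sub>T * ((3 + 2 * m) * (x ^ 4 / C\<^sup>2)) * (m / K)\<^sup>2"
    using pos by (intro mult_right_mono mult_left_mono) auto
  then have var': "M.variance ?T \<le> V * (3 + 2 * m) * (x ^ 4 / C\<^sup>2)"
    using var by (simp add: V_def m_def power_divide mult_ac)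
  have "M.prob {yz \<in> space M. ?T yz \<le> t * r\<^sup>2} \<le> M.variance ?T / (M.expectation ?T - t * r\<^sup>2)\<^sup>2"
    using E x2 x by (intro T_lower_tail) (smt (verit) zero_less_power half_gt_zero)
  also have "\<dots> \<le> (V * (3 + 2 * m) * (x ^ 4 / C\<^sup>2)) / (S / 2)\<^sup>2"
  proof (rule frac_le)
    show "0 \<le> V * (3 + 2 * m) * (x ^ 4 / C\<^sup>2)" using V m by simp
    show "0 < (S / 2)\<^sup>2" using x x2 by (metis half_gt_zero zero_less_power)
    show "(S / 2)\<^sup>2 \<le> (M.expectation ?T - t * r\<^sup>2)\<^sup>2" using E S0 by (intro power_mono) auto
  qed (rule var')
  also have "\<dots> = 4 * (V * (3 + 2 * m)) / C\<^sup>2"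
  proof -
    have "(S / 2)\<^sup>2 = x ^ 4 / 4" by (simp add: x2[symmetric] power_divide flip: power_mult)
    moreover have "W * (x ^ 4 / C\<^sup>2) / (x ^ 4 / 4) = 4 * W / C\<^sup>2" for W using x by simp
    ultimately show ?thesis by (simp only:)
  qed
  also have "\<dots> \<le> \<gamma> / 2"
  proof -
    have "8 * (V * (3 + 2 * m)) / \<gamma> \<le> C\<^sup>2" using C(3) by (simp only: V_def m_def)
    then have "8 * (V * (3 + 2 * m)) \<le> C\<^sup>2 * \<gamma>" using pos(1) by (simp only: pos_divide_le_eq)
    then have "4 * (V * (3 + 2 * m)) \<le> \<gamma> / 2 * C\<^sup>2" by (simp add: mult.commute)
    moreover have "0 < C\<^sup>2" using C(1) by simp
    ultimately show ?thesis by (simp only: pos_divide_le_eq)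
  qed
  finally show ?thesis by (simp add: r_def)
qed

end

lemma upper_bound:
  fixes \<omega> \<sigma> :: "nat \<Rightarrow> 'm::finite \<Rightarrow> nat \<Rightarrow> real"
  assumes wav: "wavelets \<phi> \<psi> L" and R: "R > 0" and s: "s > 0"
    and \<omega>: "\<forall>\<^sub>F n in sequentially. spread_weights (\<omega> n) n K"
    and \<sigma>: "\<forall>\<^sub>F n in sequentially. spread_weights (\<sigma> n) n K"
    and \<gamma>: "0 < \<gamma>" and C\<^sub>T: "0 < C\<^sub>T"
    and bounded: "\<And>C n p q u. C > 0 \<Longrightarrow> (p, q) \<in> Theta1 \<A> \<psi> R C n s \<Longrightarrow>
      (p :: 'm \<Rightarrow> real \<Rightarrow> real) u \<in> prob_densities \<inter> Linf_ball R \<and> q u \<in> prob_densities \<inter> Linf_ball R"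
    and var: "variance_bound \<A> \<phi> \<psi> R s \<omega> \<sigma> K C\<^sub>T"
  shows "\<exists>C\<^sub>\<gamma>. \<forall>C>C\<^sub>\<gamma>.
        limsup (\<lambda>n. total_error (\<omega> n) (\<sigma> n) n (Theta0 R) (Theta1 \<A> \<psi> R C n s)
          (Delta_star \<phi> (\<omega> n) (\<sigma> n) n s (threshold_const C\<^sub>T \<gamma> L R CARD('m) K)))
        \<le> ennreal \<gamma>"
proof -
  interpret wavelets \<phi> \<psi> L by fact
  define t where "t = threshold_const C\<^sub>T \<gamma> L R CARD('m) K"
  define m where "m = real CARD('m)"
  obtain n0 where "spread_weights (\<omega> n0) n0 K"
    using eventually_happens[OF \<omega>] by auto
  then have K: "K > 0" by (simp add: spread_weights_def)
  have t: "t \<ge> 0" unfolding t_def threshold_const_def using K C\<^sub>T \<gamma> L_pos by simp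
  \<comment> \<open>The sum of the two lower bounds on C^2 required by \<open>type_II_error\<close>;
    any C > 1 + X satisfies C^2 >= C >= X.\<close>
  define X where "X = 2 * (m * R + 4 * R * m / K + t) + 8 * (C\<^sub>T * (m / K)\<^sup>2 * (3 + 2 * m)) / \<gamma>"
  have X1: "0 \<le> 2 * (m * R + 4 * R * m / K + t)" using t K R by (simp add: m_def)
  have X2: "0 \<le> 8 * (C\<^sub>T * (m / K)\<^sup>2 * (3 + 2 * m)) / \<gamma>" using C\<^sub>T \<gamma> by (simp add: m_def)
  have "limsup (\<lambda>n. total_error (\<omega> n) (\<sigma> n) n (Theta0 R) (Theta1 \<A> \<psi> R C n s)
          (Delta_star \<phi> (\<omega> n) (\<sigma> n) n s t)) \<le> ennreal \<gamma>" if C: "C > 1 + X" for C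
  proof (rule Limsup_bounded)
    have C1: "C \<ge> 1" using C X1 X2 by (simp add: X_def)
    have "X \<le> C" using C by simp
    also have "C \<le> C\<^sup>2" using C1 by (simp add: power2_eq_square)
    finally have XC: "X \<le> C\<^sup>2" .
    have "C > 0" using C1 by simp
    note V = variance_boundD[OF var \<open>C > 0\<close>]
    show "\<forall>\<^sub>F n in sequentially. total_error (\<omega> n) (\<sigma> n) n (Theta0 R) (Theta1 \<A> \<psi> R C n s)
          (Delta_star \<phi> (\<omega> n) (\<sigma> n) n s t) \<le> ennreal \<gamma>"
      using V \<omega> \<sigma>
    proof eventually_elim
      case (elim n)
      let ?D = "Delta_star \<phi> (\<omega> n) (\<sigma> n) n s t"
      let ?M = "obs_law (\<omega> n) (\<sigma> n) n"
      have D1: "?D yz = 1 \<longleftrightarrow> t * (sep_rate s n)\<^sup>2 < T_stat \<phi> (\<omega> n) (\<sigma> n) n (level s n) yz"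
        and D0: "?D yz = 0 \<longleftrightarrow> T_stat \<phi> (\<omega> n) (\<sigma> n) n (level s n) yz \<le> t * (sep_rate s n)\<^sup>2" for yz
        by (auto simp: Delta_star_def)
      have I: "(SUP pq\<in>Theta0 R. emeasure (?M pq) {yz \<in> space (?M pq). ?D yz = 1}) \<le> ennreal (\<gamma> / 2)"
      proof (rule SUP_least)
        fix pq :: "('m \<Rightarrow> real \<Rightarrow> real) \<times> ('m \<Rightarrow> real \<Rightarrow> real)" assume pq: "pq \<in> Theta0 R"
        obtain p q where pq_eq: "pq = (p, q)" by force
        have dens: "p u = q u" "p u \<in> prob_densities" for u
          using pq unfolding pq_eq Theta0_def by blast+
        have dens_q: "q u \<in> prob_densities" for u using dens[of u] by simp
        interpret mixture_model \<phi> \<psi> L "\<omega> n" "\<sigma> n" n K p q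
          using elim dens(2) dens_q wav by (intro mixture_model.intro mixture_model_axioms.intro)
        have "M.prob {yz \<in> space M. t * (sep_rate s n)\<^sup>2 < T_stat \<phi> (\<omega> n) (\<sigma> n) n (level s n) yz} \<le> \<gamma> / 2"
          unfolding t_def
        proof (rule type_I_error)
          show "p = q" using dens(1) by blast
          show "M.variance (T_stat \<phi> (\<omega> n) (\<sigma> n) n (level s n))
              \<le> C\<^sub>T * variance_rate n p q (level s n) * ((real CARD('m))\<^sup>2 / K\<^sup>2)"
            using elim(1) pq unfolding pq_eq by blast
        qed (use \<gamma> C\<^sub>T L_pos s in auto)
        then show "emeasure (?M pq) {yz \<in> space (?M pq). ?D yz = 1} \<le> ennreal (\<gamma> / 2)"
          unfolding pq_eq D1 M.emeasure_eq_measure by (rule ennreal_leI)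
      qed
      have II: "(SUP pq\<in>Theta1 \<A> \<psi> R C n s. emeasure (?M pq) {yz \<in> space (?M pq). ?D yz = 0}) \<le> ennreal (\<gamma> / 2)"
      proof (rule SUP_least)
        fix pq :: "('m \<Rightarrow> real \<Rightarrow> real) \<times> ('m \<Rightarrow> real \<Rightarrow> real)" assume pq: "pq \<in> Theta1 \<A> \<psi> R C n s"
        obtain p q where pq_eq: "pq = (p, q)" by force
        have dens: "p u \<in> prob_densities" "q u \<in> prob_densities" "p u \<in> Linf_ball R" "q u \<in> Linf_ball R" for u
          using bounded[of C p q n u] pq C1 by (auto simp: pq_eq)
        have besov: "(\<lambda>x. p u x - q u x) \<in> besov_body \<psi> s R" for u
          using pq by (auto simp: pq_eq Theta1_def)
        have sep: "\<exists>u. C * sep_rate s n \<le> norm_L2 (\<lambda>x. p u x - q u x)"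
          using pq by (auto simp: pq_eq Theta1_def Lambda_def)
        interpret mixture_model \<phi> \<psi> L "\<omega> n" "\<sigma> n" n K p q
          using elim dens wav by (intro mixture_model.intro mixture_model_axioms.intro)
        have "M.prob {yz \<in> space M. T_stat \<phi> (\<omega> n) (\<sigma> n) n (level s n) yz \<le> t * (sep_rate s n)\<^sup>2} \<le> \<gamma> / 2"
        proof (rule type_II_error[OF dens(3,4) besov sep \<gamma> C\<^sub>T s t C1])
          show "2 * (real CARD('m) * R + 4 * R * real CARD('m) / K + t) \<le> C\<^sup>2"
            using XC X2 unfolding X_def m_def by linarith
          show "8 * (C\<^sub>T * (real CARD('m) / K)\<^sup>2 * (3 + 2 * real CARD('m))) / \<gamma> \<le> C\<^sup>2"
            using XC X1 unfolding X_def m_def by linarith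
          show "M.variance (T_stat \<phi> (\<omega> n) (\<sigma> n) n (level s n))
              \<le> C\<^sub>T * variance_rate n p q (level s n) * ((real CARD('m))\<^sup>2 / K\<^sup>2)"
            using elim(1) pq unfolding pq_eq by blast
        qed
        then show "emeasure (?M pq) {yz \<in> space (?M pq). ?D yz = 0} \<le> ennreal (\<gamma> / 2)"
          unfolding pq_eq D0 M.emeasure_eq_measure by (rule ennreal_leI)
      qed
      have "total_error (\<omega> n) (\<sigma> n) n (Theta0 R) (Theta1 \<A> \<psi> R C n s) ?D \<le> ennreal (\<gamma> / 2) + ennreal (\<gamma> / 2)"
        unfolding total_error_def by (intro add_mono I II)
      also have "\<dots> = ennreal \<gamma>" using \<gamma> by (simp flip: ennreal_plus)
      finally show ?case .
    qed
  qed
  then show ?thesis unfolding t_def by blast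
qed

section \<open>Perturbations of the flat density by wavelets\<close>

lemma inner_L2_cong_AE:
  assumes [measurable]: "f \<in> borel_measurable borel" "g \<in> borel_measurable borel" "h \<in> borel_measurable borel"
    and ae: "AE x in lborel. f x = g x"
  shows "inner_L2 f h = inner_L2 g h"
  unfolding inner_L2_def
proof (rule integral_cong_AE)
  show "AE x in lborel. f x * h x = g x * h x" using ae by eventually_elim simp
qed measurable

context wavelets
begin

definition psi_bound :: real where
  "psi_bound = (SOME B. B > 0 \<and> (AE x in lborel. \<bar>\<psi> x\<bar> \<le> B))"

lemma psi_bound: "psi_bound > 0" "AE x in lborel. \<bar>\<psi> x\<bar> \<le> psi_bound"
proof -
  have "\<exists>B. B > 0 \<and> (AE x in lborel. \<bar>\<psi> x\<bar> \<le> B)" using psi_AE_bounded by blast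
  from someI_ex[OF this] show "psi_bound > 0" "AE x in lborel. \<bar>\<psi> x\<bar> \<le> psi_bound"
    unfolding psi_bound_def by blast+
qed

text \<open>Densities have to be nonnegative everywhere, whereas \<open>\<psi>\<close> is only essentially bounded.\<close>

definition psib :: "real \<Rightarrow> real" where
  "psib x = (if \<bar>\<psi> x\<bar> \<le> psi_bound then \<psi> x else 0)"

lemma psib_measurable [measurable]: "psib \<in> borel_measurable borel"
  unfolding psib_def[abs_def] by measurable

lemma psib_AE: "AE x in lborel. psib x = \<psi> x"
  using psi_bound(2) by eventually_elim (simp add: psib_def)

lemma psib_bounded: "\<bar>psib x\<bar> \<le> psi_bound"
  using psi_bound(1) by (auto simp: psib_def)

lemma dilate_psib_supp: "dilate psib J k x \<noteq> 0 \<Longrightarrow> -L \<le> 2 ^ J * x - of_int k \<and> 2 ^ J * x - of_int k < L"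
  using psi_supp[of "2 ^ J * x - of_int k"] by (auto simp: dilate_def psib_def split: if_splits)

lemma dilate_psib_AE: "AE x in lborel. dilate psib J k x = dilate \<psi> J k x"
proof -
  have "AE x in lborel. psib (- of_int k + 2 ^ J * x) = \<psi> (- of_int k + 2 ^ J * x)"
    by (rule AE_borel_affine[OF _ _ psib_AE]) auto
  then show ?thesis by eventually_elim (simp add: dilate_def)
qed

definition bump :: "nat \<Rightarrow> int set \<Rightarrow> (int \<Rightarrow> real) \<Rightarrow> real \<Rightarrow> real" where
  "bump J A c x = (\<Sum>k\<in>A. c k * dilate psib J k x)"

lemma bump_measurable [measurable]: "bump J A c \<in> borel_measurable borel"
  unfolding bump_def[abs_def] by measurable

lemma bump_AE:
  assumes "finite A"
  shows "AE x in lborel. bump J A c x = (\<Sum>k\<in>A. c k * dilate \<psi> J k x)"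
proof -
  have "AE x in lborel. \<forall>k\<in>A. dilate psib J k x = dilate \<psi> J k x"
    using assms dilate_psib_AE by (intro AE_finite_allI) auto
  then show ?thesis by eventually_elim (simp add: bump_def)
qed

lemma L2_cong_AE:
  assumes "g \<in> L2" "f \<in> borel_measurable borel" "AE x in lborel. f x = g x"
  shows "f \<in> L2"
proof -
  have "integrable lborel (\<lambda>x. (g x)\<^sup>2)" using assms(1) by (simp add: L2_def)
  moreover have "AE x in lborel. (g x)\<^sup>2 = (f x)\<^sup>2" using assms(3) by eventually_elim simp
  ultimately have "integrable lborel (\<lambda>x. (f x)\<^sup>2)"
    using assms L2_measurable[OF assms(1)] by (subst integrable_cong_AE[symmetric]) auto
  then show ?thesis using assms(2) by (simp add: L2_def)
qed

lemma bump_L2: "finite A \<Longrightarrow> bump J A c \<in> L2"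
  by (rule L2_cong_AE[OF _ bump_measurable bump_AE]) (auto intro!: L2_sum L2_cmult dilate_psi_L2)

lemma inner_bump:
  assumes A: "finite A"
  shows "inner_L2 (bump J A c) (dilate \<psi> j k) = (if j = J \<and> k \<in> A then c k else 0)"
proof -
  have "inner_L2 (bump J A c) (dilate \<psi> j k)
      = inner_L2 (\<lambda>x. \<Sum>k\<in>A. c k * dilate \<psi> J k x) (dilate \<psi> j k)"
    by (intro inner_L2_cong_AE bump_AE[OF A]) measurable
  also have "\<dots> = (\<Sum>k'\<in>A. c k' * inner_L2 (dilate \<psi> J k') (dilate \<psi> j k))"
    by (subst inner_L2_sum_left) (auto intro!: L2_cmult dilate_psi_L2 simp: inner_L2_cmult_left)
  also have "\<dots> = (\<Sum>k'\<in>A. if k' = k then (if j = J then c k else 0) else 0)"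
    by (intro sum.cong refl) (auto simp: dilate_psi_orth)
  finally show ?thesis using A by simp
qed

lemma inner_bump_bump:
  assumes A: "finite A"
  shows "inner_L2 (bump J A c) (bump J A d) = (\<Sum>k\<in>A. c k * d k)"
proof -
  have "inner_L2 (bump J A d) (bump J A c) = inner_L2 (\<lambda>x. \<Sum>k\<in>A. d k * dilate \<psi> J k x) (bump J A c)"
    by (intro inner_L2_cong_AE bump_AE[OF A]) measurable
  also have "\<dots> = (\<Sum>k\<in>A. d k * inner_L2 (dilate \<psi> J k) (bump J A c))"
    using A by (subst inner_L2_sum_left) (auto intro!: L2_cmult dilate_psi_L2 bump_L2 simp: inner_L2_cmult_left)
  also have "\<dots> = (\<Sum>k\<in>A. c k * d k)"
    using A by (intro sum.cong refl) (simp add: inner_L2_commute[of "dilate _ _ _"] inner_bump)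
  finally show ?thesis by (simp add: inner_L2_commute)
qed

text \<open>The condition on \<open>A\<close> places each dilated wavelet inside [0, D), the
  interval that carries the flat density, so that the perturbed function can stay
  nonnegative.\<close>

lemma bump_supp:
  assumes k: "\<And>k. k \<in> A \<Longrightarrow> L \<le> of_int k \<and> of_int k + L \<le> D * 2 ^ J"
    and x: "bump J A c x \<noteq> 0"
  shows "0 \<le> x \<and> x < D"
proof -
  obtain k where "k \<in> A" "dilate psib J k x \<noteq> 0"
    using sum.not_neutral_contains_not_neutral[OF x[unfolded bump_def]] by auto
  then have "-L \<le> 2 ^ J * x - of_int k" "2 ^ J * x - of_int k < L"
      "L \<le> of_int k" "of_int k + L \<le> D * 2 ^ J"
    using dilate_psib_supp[of J k x] k[of k] by blast+
  then have "0 \<le> 2 ^ J * x" "2 ^ J * x < 2 ^ J * D" unfolding mult.commute[of D] by linarith+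
  moreover have "(0::real) < 2 ^ J" by simp
  ultimately show ?thesis
    by (metis mult_le_cancel_left_pos mult_less_cancel_left_pos mult_zero_right)
qed

text \<open>A bound on the number of translates that overlap at a point, times the bound of a single
  one. It depends neither on the level nor on the number of wavelets in the combination.\<close>

definition bump_amp :: real where
  "bump_amp = (real (nat \<lfloor>2 * L\<rfloor>) + 1) * psi_bound"

lemma bump_amp_pos: "bump_amp > 0"
  unfolding bump_amp_def by (intro mult_pos_pos psi_bound) auto

lemma bump_bounded:
  assumes A: "finite A" and c: "\<And>k. \<bar>c k\<bar> \<le> a"
  shows "\<bar>bump J A c x\<bar> \<le> a * 2 powr (real J / 2) * bump_amp"
proof -
  have a: "0 \<le> a" using c[of 0] by (meson abs_ge_zero order_trans)
  let ?b = "a * (2 powr (real J / 2) * psi_bound)"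
  have "bump J A c x = (\<Sum>k\<in>A \<inter> active J x. c k * dilate psib J k x)"
    unfolding bump_def using A dilate_psib_supp[of J _ x]
    by (intro sum.mono_neutral_right) (force simp: active_def abs_le_iff)+
  also have "\<bar>\<dots>\<bar> \<le> (\<Sum>k\<in>A \<inter> active J x. ?b)"
  proof (rule abs_sum_le)
    fix k
    have "\<bar>dilate psib J k x\<bar> \<le> 2 powr (real J / 2) * psi_bound"
      by (simp add: dilate_def abs_mult psib_bounded mult_left_mono)
    then show "\<bar>c k * dilate psib J k x\<bar> \<le> ?b"
      unfolding abs_mult using c[of k] a by (intro mult_mono) auto
  qed
  also have "\<dots> \<le> (real (nat \<lfloor>2 * L\<rfloor>) + 1) * ?b"
  proof -
    have "card (A \<inter> active J x) \<le> card (active J x)"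
      using finite_active by (intro card_mono) auto
    then have "real (card (A \<inter> active J x)) \<le> real (nat \<lfloor>2 * L\<rfloor> + 1)"
      using card_active[of J x] by (intro of_nat_mono) linarith
    then show ?thesis using a psi_bound(1) by (simp add: mult_right_mono)
  qed
  finally show ?thesis by (simp add: bump_amp_def mult_ac)
qed

text \<open>Here the mean zero of the wavelet is essential: it keeps the mass of the perturbed
  density at 1.\<close>

lemma bump_integral:
  assumes A: "finite A"
  shows "integrable lborel (bump J A c)" "(LINT x|lborel. bump J A c x) = 0"
proof -
  have int: "integrable lborel psib"
  proof (rule Bochner_Integration.integrable_bound)
    show "integrable lborel (\<lambda>x. psi_bound * indicat_real {-L..L} x)"
      using L_pos by (intro integrable_mult_right integrable_real_indicator) auto
    show "AE x in lborel. norm (psib x) \<le> norm (psi_bound * indicat_real {-L..L} x)"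
    proof (rule AE_I2)
      fix x
      show "norm (psib x) \<le> norm (psi_bound * indicat_real {-L..L} x)"
        using psi_supp[of x] psib_bounded[of x] psi_bound(1)
        by (cases "\<psi> x = 0") (auto simp: psib_def indicator_def)
    qed
  qed auto
  have dint: "integrable lborel (dilate psib J k)" for k
  proof -
    have "integrable lborel (\<lambda>x. psib (- of_int k + 2 ^ J * x))"
      using lborel_integrable_real_affine[OF int, of "2 ^ J" "- of_int k"] by simp
    then show ?thesis unfolding dilate_def[abs_def] by (simp add: algebra_simps)
  qed
  then show "integrable lborel (bump J A c)" unfolding bump_def[abs_def] by simp
  have "(LINT x|lborel. psib x) = (LINT x|lborel. \<psi> x)"
    by (intro integral_cong_AE psib_AE) auto
  then have "(LINT x|lborel. dilate psib J k x) = 0" for k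
    by (simp add: integral_dilate psi_integral_zero)
  then show "(LINT x|lborel. bump J A c x) = 0" unfolding bump_def using dint by simp
qed

text \<open>Only level \<open>J\<close> carries coefficients, so the tail sum from \<open>j\<close>
  is the full sum for j <= J and 0 beyond. The weight grows with \<open>j\<close>, hence the case j
  = J decides, and that is the assumption.\<close>

lemma bump_besov:
  assumes A: "finite A" and R: "2 powr (2 * real J * s) * (\<Sum>k\<in>A. (c k)\<^sup>2) \<le> R" and s: "0 \<le> s"
  shows "bump J A c \<in> besov_body \<psi> s R"
proof -
  let ?b = "\<lambda>j' k. ennreal ((inner_L2 (bump J A c) (dilate \<psi> j' k))\<^sup>2)"
  let ?S = "ennreal (\<Sum>k\<in>A. (c k)\<^sup>2)"
  have k: "(\<Sum>\<^sub>\<infinity>k\<in>UNIV. ?b j' k) = (if j' = J then ?S else 0)" for j'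
  proof -
    have "(\<Sum>\<^sub>\<infinity>k\<in>UNIV. ?b j' k) = (\<Sum>\<^sub>\<infinity>k\<in>A. if j' = J then ennreal ((c k)\<^sup>2) else 0)"
      using A by (intro infsum_cong_neutral) (auto simp: inner_bump)
    also have "\<dots> = (if j' = J then ?S else 0)"
      using A by (simp add: sum_nonneg)
    finally show ?thesis .
  qed
  have "ennreal (2 powr (2 * real j * s)) * (\<Sum>\<^sub>\<infinity>j'\<in>{j..}. \<Sum>\<^sub>\<infinity>k\<in>UNIV. ?b j' k) \<le> ennreal R" for j
  proof -
    have "(\<Sum>\<^sub>\<infinity>j'\<in>{j..}. \<Sum>\<^sub>\<infinity>k\<in>UNIV. ?b j' k) = (\<Sum>\<^sub>\<infinity>j'\<in>{j..} \<inter> {J}. ?S)"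
      unfolding k by (intro infsum_cong_neutral) auto
    also have "\<dots> = (if j \<le> J then ?S else 0)" by simp
    finally have eq: "(\<Sum>\<^sub>\<infinity>j'\<in>{j..}. \<Sum>\<^sub>\<infinity>k\<in>UNIV. ?b j' k) = (if j \<le> J then ?S else 0)" .
    show ?thesis
    proof (cases "j \<le> J")
      case True
      have "2 powr (2 * real j * s) * (\<Sum>k\<in>A. (c k)\<^sup>2) \<le> 2 powr (2 * real J * s) * (\<Sum>k\<in>A. (c k)\<^sup>2)"
        using True s by (intro mult_right_mono powr_mono sum_nonneg) (auto intro: mult_right_mono)
      also note R
      finally show ?thesis
        using True ennreal_leI by (simp add: eq sum_nonneg flip: ennreal_mult)
    qed (simp add: eq)
  qed
  then show ?thesis using bump_L2[OF A, of J c] by (simp add: besov_body_def SUP_le_iff)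
qed

end

definition flat_density :: "real \<Rightarrow> real \<Rightarrow> real" where
  "flat_density D x = (if 0 \<le> x \<and> x < D then 1 / D else 0)"

lemma flat_indicator: "flat_density D = (\<lambda>x. indicat_real {0..<D} x / D)"
  by (auto simp: flat_density_def indicator_def)

lemma flat_measurable [measurable]: "flat_density D \<in> borel_measurable borel"
  unfolding flat_indicator by measurable

lemma flat_integral:
  assumes "D > 0"
  shows "integrable lborel (flat_density D)" "(LINT x|lborel. flat_density D x) = 1"
proof -
  have "integrable lborel (indicat_real {0..<D})" using assms by (intro integrable_real_indicator) auto
  then show "integrable lborel (flat_density D)" unfolding flat_indicator by simp
  show "(LINT x|lborel. flat_density D x) = 1" unfolding flat_indicator using assms by simp
qed

lemma flat_prob_density: "D > 0 \<Longrightarrow> flat_density D \<in> prob_densities"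
  by (intro prob_densitiesI flat_integral) (auto simp: flat_density_def)

lemma flat_Linf:
  assumes "D > 0" "1 / D \<le> R"
  shows "flat_density D \<in> Linf_ball R"
proof -
  have "0 \<le> 1 / D" using assms(1) by simp
  with assms(2) have "0 \<le> R" by linarith
  with \<open>0 \<le> 1 / D\<close> have "\<bar>flat_density D x\<bar> \<le> R" for x using assms(2) by (simp add: flat_density_def)
  then show ?thesis by (simp add: Linf_ball_def)
qed

text \<open>A density bounded by 1/D has squared norm at most 1/D; the condition with R^2 therefore
  gives membership in the L2-ball.\<close>

lemma flat_Theta0:
  assumes D: "D > 0" "1 / D \<le> R" "1 / D \<le> R\<^sup>2"
  shows "((\<lambda>_. flat_density D), (\<lambda>_. flat_density D)) \<in> Theta0 R"
proof -
  have R: "0 < R" using D by (meson divide_pos_pos less_le_trans zero_less_one)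
  have "norm_L2 (flat_density D) \<le> R"
  proof -
    have "(norm_L2 (flat_density D))\<^sup>2 \<le> 1 / D"
      unfolding norm_L2_sq using prob_densities_bounded_L2(2)[OF flat_prob_density flat_Linf] D by blast
    then have "(norm_L2 (flat_density D))\<^sup>2 \<le> R\<^sup>2" using D(3) by linarith
    then show ?thesis using R by (rule power2_le_imp_le[OF _ less_imp_le])
  qed
  then show ?thesis
    using D flat_prob_density[of D] flat_Linf[of D R] prob_densities_bounded_L2(1)[of "flat_density D" R]
    by (simp add: Theta0_def L2_ball_def)
qed

context wavelets
begin

lemma flat_bump_prob_density:
  assumes A: "finite A" and D: "D > 0"
    and supp: "\<And>k. k \<in> A \<Longrightarrow> L \<le> of_int k \<and> of_int k + L \<le> D * 2 ^ J"
    and bound: "\<And>x. \<bar>bump J A c x\<bar> \<le> 1 / D"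
  shows "(\<lambda>x. flat_density D x + bump J A c x) \<in> prob_densities"
proof (rule prob_densitiesI)
  show "0 \<le> flat_density D x + bump J A c x" for x
  proof (cases "bump J A c x = 0")
    case False
    then have "flat_density D x = 1 / D" using bump_supp[OF supp] by (auto simp: flat_density_def)
    then show ?thesis using bound[of x] by simp
  qed (use D in \<open>simp add: flat_density_def\<close>)
qed (use A D in \<open>auto simp: flat_integral bump_integral\<close>)

lemma flat_bump_Linf:
  assumes D: "D > 0" "2 / D \<le> R" and bound: "\<And>x. \<bar>bump J A c x\<bar> \<le> 1 / D"
  shows "(\<lambda>x. flat_density D x + bump J A c x) \<in> Linf_ball R"
proof -
  have "\<bar>flat_density D x + bump J A c x\<bar> \<le> R" for x
  proof -
    have "\<bar>flat_density D x\<bar> \<le> 1 / D" using D by (simp add: flat_density_def)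
    then show ?thesis using bound[of x] D(2) by linarith
  qed
  then show ?thesis by (simp add: Linf_ball_def)
qed

text \<open>Stated for one pair of components, because the lower bound uses it for all components at
  once and the unbounded case for a single one.\<close>

lemma flat_bump_Theta1:
  assumes A: "finite A" and D: "D > 0" "2 / D \<le> R" and s: "0 \<le> s"
    and supp: "\<And>k. k \<in> A \<Longrightarrow> L \<le> of_int k \<and> of_int k + L \<le> D * 2 ^ J"
    and bound: "\<And>x. \<bar>bump J A c x\<bar> \<le> 1 / D"
    and besov: "2 powr (2 * real J * s) * (\<Sum>k\<in>A. (c k)\<^sup>2) \<le> R"
    and sep: "C * sep_rate s n \<le> sqrt (\<Sum>k\<in>A. (c k)\<^sup>2)"
  shows "flat_density D \<in> prob_densities \<inter> Linf_ball R"
    and "(\<lambda>x. flat_density D x + bump J A c x) \<in> prob_densities \<inter> Linf_ball R"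
    and "(\<lambda>x. flat_density D x - (flat_density D x + bump J A c x)) \<in> besov_body \<psi> s R"
    and "(flat_density D, \<lambda>x. flat_density D x + bump J A c x) \<in> Lambda R C n s"
proof -
  have D1: "1 / D \<le> 2 / D" using D by (simp add: divide_right_mono)
  show f: "flat_density D \<in> prob_densities \<inter> Linf_ball R"
    using D D1 flat_prob_density flat_Linf[of D R] by auto
  show g: "(\<lambda>x. flat_density D x + bump J A c x) \<in> prob_densities \<inter> Linf_ball R"
    using flat_bump_prob_density[OF A D(1) supp bound] flat_bump_Linf[OF D bound] by blast
  have eq: "(\<lambda>x. flat_density D x - (flat_density D x + bump J A c x)) = bump J A (\<lambda>k. - c k)"
    by (simp add: bump_def fun_eq_iff sum_negf)
  show "(\<lambda>x. flat_density D x - (flat_density D x + bump J A c x)) \<in> besov_body \<psi> s R"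
    unfolding eq using besov by (intro bump_besov A s) simp
  have "norm_L2 (bump J A (\<lambda>k. - c k)) = sqrt (\<Sum>k\<in>A. (c k)\<^sup>2)"
    using A norm_L2_sq[of "bump J A (\<lambda>k. - c k)"] norm_L2_nonneg
    by (intro real_sqrt_unique[symmetric]) (auto simp: inner_bump_bump power2_eq_square)
  with sep have "C * sep_rate s n \<le> norm_L2 (\<lambda>x. flat_density D x - (flat_density D x + bump J A c x))"
    by (simp only: eq)
  with f g show "(flat_density D, \<lambda>x. flat_density D x + bump J A c x) \<in> Lambda R C n s"
    by (simp add: Lambda_def)
qed

end

section \<open>Lower bound\<close>

lemma (in finite_prob_product) PiM_density:
  fixes g :: "nat \<Rightarrow> real \<Rightarrow> ennreal"
  assumes g: "\<And>i. i \<in> I \<Longrightarrow> g i \<in> borel_measurable (N i)"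
    and prob: "\<And>i. i \<in> I \<Longrightarrow> prob_space (density (N i) (g i))"
  shows "PiM I (\<lambda>i. density (N i) (g i)) = density (PiM I N) (\<lambda>x. \<Prod>i\<in>I. g i (x i))"
proof -
  interpret G: finite_prob_product I "\<lambda>i. density (N i) (g i)"
    using finite_I prob by (rule finite_prob_product.intro)
  have gm: "(\<lambda>x. \<Prod>i\<in>I. g i (x i)) \<in> borel_measurable (PiM I N)"
    using g by (intro borel_measurable_prod_ennreal measurable_compose[OF measurable_component_singleton])
  \<comment> \<open>A product measure is determined by its values on boxes, and on a box both the
    density and the indicator factor over the coordinates.\<close>
  have "density (PiM I N) (\<lambda>x. \<Prod>i\<in>I. g i (x i)) = PiM I G.N'"
  proof (rule product_sigma_finite.PiM_eqI[OF G.product_sigma_finite_N' finite_I])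
    show "sets (density (PiM I N) (\<lambda>x. \<Prod>i\<in>I. g i (x i))) = sets (PiM I G.N')"
      by (simp add: G.N'_def cong: sets_PiM_cong)
    fix A assume A: "\<And>i. i \<in> I \<Longrightarrow> A i \<in> sets (G.N' i)"
    then have A': "A i \<in> sets (N i)" if "i \<in> I" for i using that by (simp add: G.N'_def)
    have sA: "Pi\<^sub>E I A \<in> sets (PiM I N)" using finite_I A' by (intro sets_PiM_I_finite) auto
    have "emeasure (density (PiM I N) (\<lambda>x. \<Prod>i\<in>I. g i (x i))) (Pi\<^sub>E I A)
      = (\<integral>\<^sup>+x. (\<Prod>i\<in>I. g i (x i)) * indicator (Pi\<^sub>E I A) x \<partial>PiM I N)"
      using gm sA by (rule emeasure_density)
    also have "\<dots> = (\<integral>\<^sup>+x. (\<Prod>i\<in>I. g i (x i) * indicator (A i) (x i)) \<partial>PiM I N)"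
    proof (rule nn_integral_cong)
      fix x assume x: "x \<in> space (PiM I N)"
      show "(\<Prod>i\<in>I. g i (x i)) * indicator (Pi\<^sub>E I A) x = (\<Prod>i\<in>I. g i (x i) * indicator (A i) (x i))"
      proof (cases "x \<in> Pi\<^sub>E I A")
        case True
        then show ?thesis by (simp add: PiE_mem cong: prod.cong)
      next
        case False
        then obtain i where "i \<in> I" "x i \<notin> A i"
          using x by (auto simp: space_PiM PiE_def Pi_def)
        then show ?thesis using False finite_I
          by (simp add: prod_zero_iff) (meson indicator_simps(2))
      qed
    qed
    also have "\<dots> = (\<integral>\<^sup>+x. (\<Prod>i\<in>I. g i (x i) * indicator (A i) (x i)) \<partial>PiM I N')"
      by (simp add: PiM_N')
    also have "\<dots> = (\<Prod>i\<in>I. \<integral>\<^sup>+t. g i t * indicator (A i) t \<partial>N' i)"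
      using g A' by (intro product_sigma_finite.product_nn_integral_prod[OF product_sigma_finite_N' finite_I])
        (auto simp: N'_def)
    also have "\<dots> = (\<Prod>i\<in>I. emeasure (G.N' i) (A i))"
      using g A' by (intro prod.cong refl) (simp add: N'_def G.N'_def emeasure_density)
    finally show "emeasure (density (PiM I N) (\<lambda>x. \<Prod>i\<in>I. g i (x i))) (Pi\<^sub>E I A) = (\<Prod>i\<in>I. emeasure (G.N' i) (A i))" .
  qed
  then show ?thesis by (simp add: G.PiM_N')
qed

lemma exists_ge_average:
  fixes f :: "'a \<Rightarrow> real"
  assumes "finite A" "A \<noteq> {}" "real (card A) * c \<le> sum f A"
  shows "\<exists>a\<in>A. c \<le> f a"
proof (rule ccontr)
  assume "\<not> ?thesis"
  then have "sum f A < (\<Sum>a\<in>A. c)" using assms by (intro sum_strict_mono) auto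
  with assms(3) show False by simp
qed

text \<open>The average \<open>m\<close> of the likelihood ratios has mean 1 and second moment at
  most 1 + \<epsilon>^2, so its variance is at most \<epsilon>^2. Hence the average probability of
  \<open>E\<close> under the alternatives is at least \<open>prob E - \<epsilon>\<close>, and some
  index reaches the average. The index may depend on \<open>E\<close>, as a supremum over
  alternatives allows.\<close>

lemma (in prob_space) likelihood_mixture_test:
  fixes Q :: "'i \<Rightarrow> 'a \<Rightarrow> real"
  assumes I: "finite I" "I \<noteq> {}" and E: "E \<in> events" and \<epsilon>: "\<epsilon> > 0"
    and Q: "\<And>i. i \<in> I \<Longrightarrow> integrable M (Q i)" "\<And>i. i \<in> I \<Longrightarrow> expectation (Q i) = 1"
    and Q2: "\<And>i i'. i \<in> I \<Longrightarrow> i' \<in> I \<Longrightarrow> integrable M (\<lambda>x. Q i x * Q i' x)"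
    and second: "(\<Sum>i\<in>I. \<Sum>i'\<in>I. expectation (\<lambda>x. Q i x * Q i' x)) \<le> (1 + \<epsilon>\<^sup>2) * (real (card I))\<^sup>2"
  shows "\<exists>i\<in>I. 1 - \<epsilon> \<le> prob (space M - E) + expectation (\<lambda>x. Q i x * indicat_real E x)"
proof -
  define N where "N = real (card I)"
  have N: "N > 0" using I by (simp add: N_def card_gt_0_iff)
  define m where "m x = (\<Sum>i\<in>I. Q i x) / N" for x
  have m: "integrable M m" "expectation m = 1"
    unfolding m_def using Q N by (auto simp: N_def)
  have sq: "(m x)\<^sup>2 = (\<Sum>i\<in>I. \<Sum>i'\<in>I. Q i x * Q i' x) / N\<^sup>2" for x
    by (simp add: m_def power_divide power2_eq_square[of "sum _ _"] sum_product)
  have m2: "integrable M (\<lambda>x. (m x)\<^sup>2)" unfolding sq using Q2 by auto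
  have Em2: "expectation (\<lambda>x. (m x)\<^sup>2) \<le> 1 + \<epsilon>\<^sup>2"
  proof -
    have "expectation (\<lambda>x. (m x)\<^sup>2) = (\<Sum>i\<in>I. \<Sum>i'\<in>I. expectation (\<lambda>x. Q i x * Q i' x)) / N\<^sup>2"
      unfolding sq using Q2 by simp
    also have "\<dots> \<le> 1 + \<epsilon>\<^sup>2" using second N by (simp add: divide_le_eq N_def)
    finally show ?thesis .
  qed
  have mE: "integrable M (\<lambda>x. m x * indicat_real E x)" "integrable M (\<lambda>x. (m x - 1) * indicat_real E x)"
    using m E by (auto intro!: integrable_real_mult_indicator)
  \<comment> \<open>The arithmetic-geometric mean inequality in place of Cauchy-Schwarz: the left
    side has expectation at least -\<epsilon>, and outside \<open>E\<close> there is nothing to show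
    as it is not positive.\<close>
  have pt: "- (\<epsilon> + (m x - 1)\<^sup>2 / \<epsilon>) / 2 \<le> (m x - 1) * indicat_real E x" for x
  proof -
    have "0 \<le> (\<epsilon> + (m x - 1))\<^sup>2" by simp
    then have "- 2 * \<epsilon> * (m x - 1) \<le> \<epsilon>\<^sup>2 + (m x - 1)\<^sup>2" by (simp add: power2_sum)
    then have "- (m x - 1) \<le> (\<epsilon> + (m x - 1)\<^sup>2 / \<epsilon>) / 2"
      using \<epsilon> by (simp add: field_simps power2_eq_square)
    moreover have "0 \<le> (\<epsilon> + (m x - 1)\<^sup>2 / \<epsilon>) / 2" using \<epsilon> by simp
    ultimately show ?thesis by (simp add: indicator_def)
  qed
  have int: "integrable M (\<lambda>x. - (\<epsilon> + (m x - 1)\<^sup>2 / \<epsilon>) / 2)"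
    using m m2 by (simp add: power2_diff)
  have "- \<epsilon> \<le> expectation (\<lambda>x. - (\<epsilon> + (m x - 1)\<^sup>2 / \<epsilon>) / 2)"
  proof -
    have "expectation (\<lambda>x. (m x - 1)\<^sup>2) = expectation (\<lambda>x. (m x)\<^sup>2) - 1"
      using m m2 by (simp add: power2_diff prob_space)
    then have "expectation (\<lambda>x. (m x - 1)\<^sup>2) \<le> \<epsilon>\<^sup>2" using Em2 by simp
    then have "expectation (\<lambda>x. (m x - 1)\<^sup>2) / \<epsilon> \<le> \<epsilon>"
      using \<epsilon> by (simp add: divide_le_eq power2_eq_square)
    moreover have "integrable M (\<lambda>x. (m x - 1)\<^sup>2)" using m m2 by (simp add: power2_diff)
    ultimately show ?thesis by (simp add: prob_space)
  qed
  also have "\<dots> \<le> expectation (\<lambda>x. (m x - 1) * indicat_real E x)"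
    using int mE(2) pt by (intro integral_mono) auto
  also have "\<dots> = expectation (\<lambda>x. m x * indicat_real E x) - prob E"
  proof -
    have "integrable M (indicat_real E)"
      using E by (intro integrable_real_indicator) (auto simp: emeasure_eq_measure)
    then show ?thesis using mE(1) E by (simp add: left_diff_distrib)
  qed
  finally have "1 - \<epsilon> \<le> prob (space M - E) + expectation (\<lambda>x. m x * indicat_real E x)"
    using prob_compl[OF E] by simp
  moreover have "expectation (\<lambda>x. m x * indicat_real E x) = (\<Sum>i\<in>I. expectation (\<lambda>x. Q i x * indicat_real E x)) / N"
    unfolding m_def using Q(1) E
    by (simp add: sum_divide_distrib sum_distrib_right integrable_real_mult_indicator)
  ultimately have "N * (1 - \<epsilon> - prob (space M - E)) \<le> (\<Sum>i\<in>I. expectation (\<lambda>x. Q i x * indicat_real E x))"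
    using N by (simp add: field_simps)
  then have "\<exists>i\<in>I. 1 - \<epsilon> - prob (space M - E) \<le> expectation (\<lambda>x. Q i x * indicat_real E x)"
    unfolding N_def using I by (intro exists_ge_average)
  then show ?thesis by (simp only: diff_le_eq add.commute)
qed

text \<open>For arguments of modulus at most 1, quadratic bounds of exp on both sides of 0 give cosh
  x <= 1 + x^2; the one for exp (-x) comes from the reciprocal of a Taylor polynomial. For larger
  arguments cosh x <= exp x <= exp (x^2).\<close>

lemma cosh_le_exp_square: "cosh (a::real) \<le> exp (a\<^sup>2)"
proof -
  have "cosh x \<le> exp (x\<^sup>2)" if x: "0 \<le> x" for x :: real
  proof (cases "x \<le> 1")
    case True
    have "1 + x + x\<^sup>2 / 2 \<le> exp x" using x by (rule exp_lower_Taylor_quadratic)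
    moreover have "0 < 1 + x + x\<^sup>2 / 2" using x by (simp add: add_pos_nonneg)
    ultimately have "exp (- x) \<le> 1 / (1 + x + x\<^sup>2 / 2)"
      by (simp add: exp_minus inverse_eq_divide frac_le)
    also have "\<dots> \<le> 1 - x + x\<^sup>2 / 2"
    proof -
      have "(1 - x + x\<^sup>2 / 2) * (1 + x + x\<^sup>2 / 2) = 1 + x ^ 4 / 4"
        by (simp add: algebra_simps power2_eq_square power4_eq_xxxx)
      then have "1 \<le> (1 - x + x\<^sup>2 / 2) * (1 + x + x\<^sup>2 / 2)" by simp
      with \<open>0 < 1 + x + x\<^sup>2 / 2\<close> show ?thesis by (simp add: divide_le_eq)
    qed
    finally have "exp (- x) \<le> 1 - x + x\<^sup>2 / 2" .
    moreover have "exp x \<le> 1 + x + x\<^sup>2" using x True by (rule exp_bound)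
    moreover have "(b + a) / 2 \<le> 1 + y" if "a \<le> 1 - x + y / 2" "b \<le> 1 + x + y" "0 \<le> y" for a b y :: real
      using that by (simp add: field_simps)
    ultimately have "(exp x + exp (- x)) / 2 \<le> 1 + x\<^sup>2" using zero_le_power2 by blast
    then have "cosh x \<le> 1 + x\<^sup>2" by (simp add: cosh_field_def)
    also have "\<dots> \<le> exp (x\<^sup>2)" by (rule exp_ge_add_one_self)
    finally show ?thesis .
  next
    case False
    have "cosh x \<le> exp x" using x by (simp add: cosh_field_def)
    also have "\<dots> \<le> exp (x\<^sup>2)" using False by (simp add: power2_eq_square)
    finally show ?thesis .
  qed
  from this[of "\<bar>a\<bar>"] show ?thesis by simp
qed

text \<open>The exponential factors over \<open>k\<close>, and summing out one sign gives exp a +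
  exp (-a) whatever the other sign is, so the inner sum is the same for every
  \<open>\<theta>\<close>.\<close>

lemma sum_signs_exp:
  assumes "finite A"
  shows "(\<Sum>\<theta>\<in>A \<rightarrow>\<^sub>E {-1, 1}. \<Sum>\<theta>'\<in>A \<rightarrow>\<^sub>E {-1, 1}. exp (a * (\<Sum>k\<in>A. \<theta> k * \<theta>' k)))
    = (real (card (A \<rightarrow>\<^sub>E {-1, 1::real})))\<^sup>2 * cosh a ^ card A"
proof -
  have inner: "(\<Sum>\<theta>'\<in>A \<rightarrow>\<^sub>E {-1, 1}. exp (a * (\<Sum>k\<in>A. \<theta> k * \<theta>' k))) = (2 * cosh a) ^ card A"
    if \<theta>: "\<theta> \<in> A \<rightarrow>\<^sub>E {-1, 1}" for \<theta>
  proof -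
    have "(\<Sum>\<theta>'\<in>A \<rightarrow>\<^sub>E {-1, 1}. exp (a * (\<Sum>k\<in>A. \<theta> k * \<theta>' k)))
       = (\<Sum>\<theta>'\<in>A \<rightarrow>\<^sub>E {-1, 1}. \<Prod>k\<in>A. exp (a * (\<theta> k * \<theta>' k)))"
      using assms by (simp add: sum_distrib_left exp_sum)
    also have "\<dots> = (\<Prod>k\<in>A. \<Sum>y\<in>{-1, 1}. exp (a * (\<theta> k * y)))"
      using assms by (intro prod_sum_PiE[symmetric]) auto
    also have "\<dots> = (\<Prod>k\<in>A. 2 * cosh a)"
    proof (rule prod.cong[OF refl])
      fix k assume "k \<in> A"
      then have "\<theta> k = -1 \<or> \<theta> k = 1" using \<theta> by (auto simp: PiE_iff)
      then show "(\<Sum>y\<in>{-1, 1}. exp (a * (\<theta> k * y))) = 2 * cosh a"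
        by (auto simp: cosh_field_def)
    qed
    finally show ?thesis by simp
  qed
  have card: "real (card (A \<rightarrow>\<^sub>E {-1, 1::real})) = 2 ^ card A"
    using assms by (simp add: card_PiE)
  have "(\<Sum>\<theta>\<in>A \<rightarrow>\<^sub>E {-1, 1}. \<Sum>\<theta>'\<in>A \<rightarrow>\<^sub>E {-1, 1}. exp (a * (\<Sum>k\<in>A. \<theta> k * \<theta>' k)))
      = (\<Sum>\<theta>\<in>A \<rightarrow>\<^sub>E {-1, 1::real}. (2 * cosh a) ^ card A)"
    by (intro sum.cong refl inner)
  then show ?thesis by (simp add: card power_mult_distrib power2_eq_square)
qed

text \<open>Equal components make the observations identically distributed, so that the lower bound
  becomes a two-sample problem independent of the weights.\<close>

lemma sample_law_const:
  assumes "mixing_weights w n"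
  shows "sample_law w (\<lambda>_. f) n = (\<Pi>\<^sub>M i\<in>{1..n}. density lborel (\<lambda>x. ennreal (f x)))"
  unfolding sample_law_def
proof (rule PiM_cong[OF refl])
  fix i assume "i \<in> {1..n}"
  then have "(\<Sum>u\<in>UNIV. w u i * f x) = f x" for x
    using assms by (simp add: mixing_weights_def flip: sum_distrib_right)
  then show "density lborel (\<lambda>x. ennreal (\<Sum>u\<in>UNIV. w u i * f x)) = density lborel (\<lambda>x. ennreal (f x))"
    by simp
qed

section \<open>Randomly signed perturbations and their likelihood ratios\<close>

locale flat_perturbation = wavelets \<phi> \<psi> L
  for \<phi> \<psi> :: "real \<Rightarrow> real" and L :: real +
  fixes D :: real and J :: nat and A :: "int set" and \<delta> :: real
  assumes D_pos: "D > 0" and finite_A: "finite A"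
    and A_supp: "\<And>k. k \<in> A \<Longrightarrow> L \<le> of_int k \<and> of_int k + L \<le> D * 2 ^ J"
    and \<delta>_pos: "0 \<le> \<delta>" and \<delta>_bound: "\<delta> * 2 powr (real J / 2) * bump_amp \<le> 1 / D"
begin

definition signs :: "(int \<Rightarrow> real) set" where
  "signs = A \<rightarrow>\<^sub>E {-1, 1}"

text \<open>Elements of \<open>signs\<close> are \<open>undefined\<close> outside \<open>A\<close>,
  whereas \<open>bump_bounded\<close> wants all coefficients bounded; hence the case
  distinction.\<close>

definition pert :: "(int \<Rightarrow> real) \<Rightarrow> real \<Rightarrow> real" where
  "pert \<theta> = bump J A (\<lambda>k. if k \<in> A then \<delta> * \<theta> k else 0)"

definition base :: "real measure" where
  "base = density lborel (\<lambda>x. ennreal (flat_density D x))"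

text \<open>The likelihood ratio of a perturbed sample against a flat one: on [0, D) the flat
  density is 1/D, so the quotient of the two densities is 1 + D times the perturbation.\<close>

definition lik :: "nat \<Rightarrow> (int \<Rightarrow> real) \<Rightarrow> (nat \<Rightarrow> real) \<Rightarrow> real" where
  "lik n \<theta> z = (\<Prod>i\<in>{1..n}. 1 + D * pert \<theta> (z i))"

lemma finite_signs: "finite signs" and signs_nonempty: "signs \<noteq> {}"
  using finite_A by (auto simp: signs_def PiE_eq_empty_iff intro!: finite_PiE)

lemma signs_square: "\<theta> \<in> signs \<Longrightarrow> k \<in> A \<Longrightarrow> (\<theta> k)\<^sup>2 = 1"
  by (auto simp: signs_def PiE_iff power2_eq_square)

lemma signs_abs: "\<theta> \<in> signs \<Longrightarrow> k \<in> A \<Longrightarrow> \<bar>\<theta> k\<bar> = 1"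
  by (auto simp: signs_def PiE_iff)

lemma pert_measurable [measurable]: "pert \<theta> \<in> borel_measurable borel"
  unfolding pert_def by measurable

lemma pert_bound:
  assumes "\<theta> \<in> signs"
  shows "\<bar>pert \<theta> x\<bar> \<le> 1 / D"
proof -
  have "\<bar>pert \<theta> x\<bar> \<le> \<delta> * 2 powr (real J / 2) * bump_amp"
    unfolding pert_def using \<delta>_pos signs_abs[OF assms]
    by (intro bump_bounded[OF finite_A]) (simp add: abs_mult)
  with \<delta>_bound show ?thesis by linarith
qed

lemma pert_supp: "pert \<theta> x \<noteq> 0 \<Longrightarrow> flat_density D x = 1 / D"
  using bump_supp[OF A_supp] by (auto simp: pert_def flat_density_def)

lemma factor_bounds:
  assumes "\<theta> \<in> signs"
  shows "0 \<le> 1 + D * pert \<theta> x" "1 + D * pert \<theta> x \<le> 2"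
proof -
  have "\<bar>D * pert \<theta> x\<bar> \<le> 1"
    using pert_bound[OF assms, of x] D_pos by (simp add: abs_mult field_simps)
  then show "0 \<le> 1 + D * pert \<theta> x" "1 + D * pert \<theta> x \<le> 2" by linarith+
qed

lemma flat_factor: "flat_density D x * (1 + D * pert \<theta> x) = flat_density D x + pert \<theta> x"
  using pert_supp[of \<theta> x] D_pos by (cases "pert \<theta> x = 0") (auto simp: distrib_left)

lemma prob_base: "prob_space base"
  unfolding base_def by (intro prob_space_prob_density flat_prob_density D_pos)

lemma sets_base [measurable_cong]: "sets base = sets borel"
  by (simp add: base_def)

lemma density_base:
  assumes "\<theta> \<in> signs"
  shows "density base (\<lambda>x. ennreal (1 + D * pert \<theta> x)) = density lborel (\<lambda>x. ennreal (flat_density D x + pert \<theta> x))"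
proof -
  have "ennreal (flat_density D x) * ennreal (1 + D * pert \<theta> x) = ennreal (flat_density D x + pert \<theta> x)" for x
  proof -
    have "0 \<le> flat_density D x" using D_pos by (simp add: flat_density_def)
    then show ?thesis
      unfolding flat_factor[symmetric] using factor_bounds(1)[OF assms] by (rule ennreal_mult[symmetric])
  qed
  then show ?thesis unfolding base_def by (subst density_density_eq) auto
qed

lemma pert_prob_density: "\<theta> \<in> signs \<Longrightarrow> (\<lambda>x. flat_density D x + pert \<theta> x) \<in> prob_densities"
  using flat_bump_prob_density[OF finite_A D_pos A_supp, of "\<lambda>k. if k \<in> A then \<delta> * \<theta> k else 0"] pert_bound
  unfolding pert_def by blast

text \<open>The linear terms vanish because the wavelets have mean zero, and orthonormality leaves
  only the correlation of the two sign vectors in the quadratic term.\<close>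

lemma second_moment_factor:
  assumes "\<theta> \<in> signs" "\<theta>' \<in> signs"
  shows "(LINT x|base. (1 + D * pert \<theta> x) * (1 + D * pert \<theta>' x)) = 1 + D * \<delta>\<^sup>2 * (\<Sum>k\<in>A. \<theta> k * \<theta>' k)"
proof -
  have int: "integrable lborel (pert \<theta>)" "integrable lborel (pert \<theta>')"
    and zero: "(LINT x|lborel. pert \<theta> x) = 0" "(LINT x|lborel. pert \<theta>' x) = 0"
    unfolding pert_def by (auto intro!: bump_integral finite_A)
  have L2: "pert \<theta> \<in> L2" "pert \<theta>' \<in> L2" unfolding pert_def by (auto intro!: bump_L2 finite_A)
  have prod: "(LINT x|lborel. pert \<theta> x * pert \<theta>' x) = \<delta>\<^sup>2 * (\<Sum>k\<in>A. \<theta> k * \<theta>' k)"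
    unfolding inner_L2_def[symmetric] pert_def inner_bump_bump[OF finite_A]
    by (simp add: sum_distrib_left power2_eq_square mult_ac)
  have pt: "flat_density D x * ((1 + D * pert \<theta> x) * (1 + D * pert \<theta>' x))
    = flat_density D x + pert \<theta> x + pert \<theta>' x + D * (pert \<theta> x * pert \<theta>' x)" for x
  proof (cases "pert \<theta> x = 0")
    case True
    then show ?thesis using flat_factor[of x \<theta>'] by simp
  next
    case False
    then have "flat_density D x = 1 / D" by (rule pert_supp)
    then show ?thesis using D_pos by (simp add: distrib_left distrib_right)
  qed
  have "(LINT x|base. (1 + D * pert \<theta> x) * (1 + D * pert \<theta>' x))
     = (LINT x|lborel. flat_density D x * ((1 + D * pert \<theta> x) * (1 + D * pert \<theta>' x)))"
    unfolding base_def using integral_prob_density[OF flat_prob_density[OF D_pos]]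
    by (simp add: inner_L2_def)
  also have "\<dots> = 1 + D * \<delta>\<^sup>2 * (\<Sum>k\<in>A. \<theta> k * \<theta>' k)"
    unfolding pt using int zero prod flat_integral[OF D_pos] L2_integrable_mult[OF L2] by simp
  finally show ?thesis .
qed

lemma first_moment_factor:
  assumes "\<theta> \<in> signs"
  shows "(LINT x|base. 1 + D * pert \<theta> x) = 1"
proof -
  have "(LINT x|base. 1 + D * pert \<theta> x) = (LINT x|lborel. flat_density D x * (1 + D * pert \<theta> x))"
    unfolding base_def using integral_prob_density[OF flat_prob_density[OF D_pos]]
    by (simp add: inner_L2_def)
  also have "\<dots> = 1"
    unfolding flat_factor using flat_integral[OF D_pos]
    by (simp add: pert_def bump_integral[OF finite_A])
  finally show ?thesis .
qed

abbreviation sample :: "nat \<Rightarrow> (nat \<Rightarrow> real) measure" where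
  "sample n \<equiv> (\<Pi>\<^sub>M i\<in>{1..n}. base)"

lemma base_product: "finite_prob_product {1..n} (\<lambda>_. base)"
  using prob_base by (intro finite_prob_product.intro) auto

lemma prob_sample: "prob_space (sample n)"
  by (rule finite_prob_product.prob_space_PiM_N[OF base_product])

lemma lik_measurable: "lik n \<theta> \<in> borel_measurable (sample n)"
  unfolding lik_def[abs_def]
  by (intro borel_measurable_prod borel_measurable_add borel_measurable_times borel_measurable_const
      measurable_compose[OF measurable_component_singleton]) measurable

lemma lik_bounds:
  assumes "\<theta> \<in> signs"
  shows "0 \<le> lik n \<theta> z" "lik n \<theta> z \<le> 2 ^ n"
proof -
  show "0 \<le> lik n \<theta> z" unfolding lik_def by (intro prod_nonneg ballI factor_bounds assms)
  have "lik n \<theta> z \<le> (\<Prod>i\<in>{1..n}. 2)"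
    unfolding lik_def by (intro prod_mono conjI factor_bounds assms)
  then show "lik n \<theta> z \<le> 2 ^ n" by simp
qed

lemma lik_integral:
  assumes "\<theta> \<in> signs"
  shows "(LINT z|sample n. lik n \<theta> z) = 1"
proof -
  interpret finite_prob_product "{1..n}" "\<lambda>_. base" by (rule base_product)
  have "integrable base (\<lambda>x. 1 + D * pert \<theta> x)"
    using factor_bounds[OF assms]
    by (intro prob_space.integrable_bounded[OF prob_base, of _ 2]) (auto simp: abs_le_iff intro: order_trans[of _ 0])
  from integral_prod(1)[OF this] show ?thesis
    unfolding lik_def by (simp add: first_moment_factor assms)
qed

lemma lik_second_moment:
  assumes "\<theta> \<in> signs" "\<theta>' \<in> signs"
  shows "(LINT z|sample n. lik n \<theta> z * lik n \<theta>' z) = (1 + D * \<delta>\<^sup>2 * (\<Sum>k\<in>A. \<theta> k * \<theta>' k)) ^ n"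
proof -
  interpret finite_prob_product "{1..n}" "\<lambda>_. base" by (rule base_product)
  have "integrable base (\<lambda>x. (1 + D * pert \<theta> x) * (1 + D * pert \<theta>' x))"
  proof (rule prob_space.integrable_bounded[OF prob_base])
    show "\<bar>(1 + D * pert \<theta> x) * (1 + D * pert \<theta>' x)\<bar> \<le> 2 * 2" for x
      using factor_bounds[OF assms(1), of x] factor_bounds[OF assms(2), of x]
      unfolding abs_mult by (intro mult_mono) auto
  qed auto
  from integral_prod(1)[OF this] show ?thesis
    unfolding lik_def by (simp add: second_moment_factor assms prod.distrib[symmetric])
qed

lemma lik_second_moment_le:
  assumes "\<theta> \<in> signs" "\<theta>' \<in> signs"
  shows "(LINT z|sample n. lik n \<theta> z * lik n \<theta>' z) \<le> exp (real n * D * \<delta>\<^sup>2 * (\<Sum>k\<in>A. \<theta> k * \<theta>' k))"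
proof -
  let ?x = "D * \<delta>\<^sup>2 * (\<Sum>k\<in>A. \<theta> k * \<theta>' k)"
  \<comment> \<open>Raising 1 + x <= exp x to the power \<open>n\<close> needs a nonnegative left
    side; it is one because it is the integral of a nonnegative function.\<close>
  have "0 \<le> 1 + ?x"
    unfolding second_moment_factor[OF assms, symmetric]
    using factor_bounds(1)[OF assms(1)] factor_bounds(1)[OF assms(2)]
    by (intro Bochner_Integration.integral_nonneg mult_nonneg_nonneg)
  then have "(1 + ?x) ^ n \<le> exp ?x ^ n" by (intro power_mono exp_ge_add_one_self)
  then show ?thesis
    using lik_second_moment[OF assms, of n] by (simp add: mult_ac flip: exp_of_nat_mult)
qed

text \<open>Divided by the squared number of sign vectors, the left side is the second moment of the
  averaged likelihood ratio, that is, 1 plus its chi-square distance from the null law.\<close>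

lemma sum_lik_second_moment:
  assumes "exp ((real n * D * \<delta>\<^sup>2)\<^sup>2 * real (card A)) \<le> 1 + \<epsilon>\<^sup>2"
  shows "(\<Sum>\<theta>\<in>signs. \<Sum>\<theta>'\<in>signs. LINT z|sample n. lik n \<theta> z * lik n \<theta>' z)
    \<le> (1 + \<epsilon>\<^sup>2) * (real (card signs))\<^sup>2"
proof -
  let ?a = "real n * D * \<delta>\<^sup>2"
  have "(\<Sum>\<theta>\<in>signs. \<Sum>\<theta>'\<in>signs. LINT z|sample n. lik n \<theta> z * lik n \<theta>' z)
    \<le> (\<Sum>\<theta>\<in>signs. \<Sum>\<theta>'\<in>signs. exp (?a * (\<Sum>k\<in>A. \<theta> k * \<theta>' k)))"
    by (intro sum_mono lik_second_moment_le)
  also have "\<dots> = (real (card signs))\<^sup>2 * cosh ?a ^ card A"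
    unfolding signs_def by (rule sum_signs_exp[OF finite_A])
  also have "\<dots> \<le> (real (card signs))\<^sup>2 * (1 + \<epsilon>\<^sup>2)"
  proof (rule mult_left_mono)
    have "cosh ?a ^ card A \<le> exp (?a\<^sup>2) ^ card A" by (intro power_mono cosh_le_exp_square) simp
    also have "\<dots> = exp (?a\<^sup>2 * real (card A))" by (simp add: mult.commute flip: exp_of_nat_mult)
    finally show "cosh ?a ^ card A \<le> 1 + \<epsilon>\<^sup>2" using assms by linarith
  qed simp
  finally show ?thesis by (simp add: mult.commute)
qed

lemma obs_law_flat:
  assumes "mixing_weights \<omega> n" "mixing_weights \<sigma> n"
  shows "obs_law \<omega> \<sigma> n ((\<lambda>_. flat_density D), (\<lambda>_. flat_density D)) = sample n \<Otimes>\<^sub>M sample n"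
  unfolding obs_law_def fst_conv snd_conv sample_law_const[OF assms(1)] sample_law_const[OF assms(2)] base_def ..

lemma obs_law_pert:
  assumes w: "mixing_weights \<omega> n" "mixing_weights \<sigma> n" and \<theta>: "\<theta> \<in> signs"
  shows "obs_law \<omega> \<sigma> n ((\<lambda>_. flat_density D), (\<lambda>_ x. flat_density D x + pert \<theta> x))
    = density (sample n \<Otimes>\<^sub>M sample n) (\<lambda>yz. ennreal (lik n \<theta> (snd yz)))"
proof -
  interpret finite_prob_product "{1..n}" "\<lambda>_. base" by (rule base_product)
  have "sample_law \<sigma> (\<lambda>_ x. flat_density D x + pert \<theta> x) n
     = PiM {1..n} (\<lambda>i. density base (\<lambda>x. ennreal (1 + D * pert \<theta> x)))"
    unfolding sample_law_const[OF w(2)] density_base[OF \<theta>] ..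
  also have "\<dots> = density (sample n) (\<lambda>x. \<Prod>i\<in>{1..n}. ennreal (1 + D * pert \<theta> (x i)))"
    by (rule PiM_density)
      (auto simp: density_base[OF \<theta>] intro!: prob_space_prob_density pert_prob_density[OF \<theta>])
  also have "(\<lambda>x. \<Prod>i\<in>{1..n}. ennreal (1 + D * pert \<theta> (x i))) = (\<lambda>x. ennreal (lik n \<theta> x))"
    unfolding lik_def using factor_bounds(1)[OF \<theta>] by (intro ext prod_ennreal)
  finally have Q: "sample_law \<sigma> (\<lambda>_ x. flat_density D x + pert \<theta> x) n = density (sample n) (\<lambda>x. ennreal (lik n \<theta> x))" .
  \<comment> \<open>The unperturbed sample gets the density 1, so that the rule for a product of two
    densities covers both samples.\<close>
  have P: "sample_law \<omega> (\<lambda>_. flat_density D) n = density (sample n) (\<lambda>_. 1)"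
    unfolding sample_law_const[OF w(1)] base_def density_1 ..
  have "prob_space (sample_law \<sigma> (\<lambda>_ x. flat_density D x + pert \<theta> x) n)"
    by (intro prob_space_sample_law w pert_prob_density \<theta>)
  then have sf: "sigma_finite_measure (density (sample n) (\<lambda>x. ennreal (lik n \<theta> x)))"
    unfolding Q by (rule prob_space_imp_sigma_finite)
  show ?thesis
    unfolding obs_law_def fst_conv snd_conv P Q
    using lik_measurable sf prob_space_imp_sigma_finite[OF prob_sample]
    by (subst pair_measure_density) (auto simp: case_prod_unfold)
qed

text \<open>The null set only has to contain the flat pair and the alternative the signed
  perturbations; \<open>likelihood_mixture_test\<close>, applied to the acceptance region of the
  given test, selects a sign vector on which that test does badly.\<close>

lemma total_error_lower:
  assumes w: "mixing_weights \<omega> n" "mixing_weights \<sigma> n"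
    and \<epsilon>: "\<epsilon> > 0" and chi2: "exp ((real n * D * \<delta>\<^sup>2)\<^sup>2 * real (card A)) \<le> 1 + \<epsilon>\<^sup>2"
    and \<Delta>: "\<Delta> \<in> tests n"
    and \<Theta>0: "((\<lambda>_. flat_density D), (\<lambda>_. flat_density D)) \<in> \<Theta>0"
    and \<Theta>1: "\<And>\<theta>. \<theta> \<in> signs \<Longrightarrow> ((\<lambda>_. flat_density D), (\<lambda>_ x. flat_density D x + pert \<theta> x)) \<in> \<Theta>1"
  shows "ennreal (1 - \<epsilon>) \<le> total_error \<omega> \<sigma> n \<Theta>0 \<Theta>1 \<Delta>"
proof -
  let ?N = "sample n \<Otimes>\<^sub>M sample n"
  interpret S: prob_space "sample n" by (rule prob_sample)
  interpret N: pair_prob_space "sample n" "sample n" by standard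
  define E where "E = {yz \<in> space ?N. \<Delta> yz = 0}"
  have sN: "sets ?N = sets ((\<Pi>\<^sub>M i\<in>{1..n}. borel) \<Otimes>\<^sub>M (\<Pi>\<^sub>M i\<in>{1..n}. borel))"
    by (intro sets_pair_measure_cong sets_PiM_cong) (auto simp: sets_base)
  have \<Delta>m: "\<Delta> \<in> measurable ?N (count_space {0, 1})"
    using \<Delta> unfolding tests_def measurable_cong_sets[OF sN refl] .
  have E: "E \<in> sets ?N"
  proof -
    have "\<Delta> -` {0} \<inter> space ?N \<in> sets ?N" using \<Delta>m by (rule measurable_sets) simp
    also have "\<Delta> -` {0} \<inter> space ?N = E" by (auto simp: E_def)
    finally show ?thesis .
  qed
  \<comment> \<open>By their codomain, tests take only the values 0 and 1 on the sample space, so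
    rejection is the complement of \<open>E\<close>.\<close>
  have Ec: "{yz \<in> space ?N. \<Delta> yz = 1} = space ?N - E"
  proof -
    have "\<Delta> yz = 0 \<or> \<Delta> yz = 1" if "yz \<in> space ?N" for yz
      using measurable_space[OF \<Delta>m that] by simp
    then have "{yz \<in> space ?N. \<Delta> yz = 1} = {yz \<in> space ?N. \<Delta> yz \<noteq> 0}"
      by (intro Collect_cong) (metis one_neq_zero)
    then show ?thesis unfolding E_def by blast
  qed
  have lm: "(\<lambda>yz. lik n \<theta> (snd yz)) \<in> borel_measurable ?N" for \<theta>
    using lik_measurable by measurable
  have lb: "\<bar>lik n \<theta> z\<bar> \<le> 2 ^ n" if "\<theta> \<in> signs" for \<theta> z
    using lik_bounds[OF that, of n z] by simp
  have lb2: "\<bar>lik n \<theta> z * lik n \<theta>' z\<bar> \<le> 2 ^ n * 2 ^ n" if "\<theta> \<in> signs" "\<theta>' \<in> signs" for \<theta> \<theta>' z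
    unfolding abs_mult by (intro mult_mono lb that) auto
  have "\<exists>\<theta>\<in>signs. 1 - \<epsilon> \<le> N.prob (space ?N - E) + N.expectation (\<lambda>yz. lik n \<theta> (snd yz) * indicat_real E yz)"
  proof (rule N.likelihood_mixture_test[OF finite_signs signs_nonempty E \<epsilon>])
    show "integrable ?N (\<lambda>yz. lik n \<theta> (snd yz))" if "\<theta> \<in> signs" for \<theta>
      using lm lb[OF that] by (rule N.integrable_bounded)
    show "N.expectation (\<lambda>yz. lik n \<theta> (snd yz)) = 1" if "\<theta> \<in> signs" for \<theta>
      by (rule trans[OF integral_snd_prob[OF prob_sample prob_sample lik_measurable lb[OF that]]
            lik_integral[OF that]])
    show "integrable ?N (\<lambda>yz. lik n \<theta> (snd yz) * lik n \<theta>' (snd yz))" if "\<theta> \<in> signs" "\<theta>' \<in> signs" for \<theta> \<theta>'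
      using borel_measurable_times[OF lm lm] lb2[OF that] by (rule N.integrable_bounded)
    have "N.expectation (\<lambda>yz. lik n \<theta> (snd yz) * lik n \<theta>' (snd yz)) = (LINT z|sample n. lik n \<theta> z * lik n \<theta>' z)"
      if "\<theta> \<in> signs" "\<theta>' \<in> signs" for \<theta> \<theta>'
      using integral_snd_prob[OF prob_sample prob_sample
          borel_measurable_times[OF lik_measurable lik_measurable] lb2[OF that]] .
    then show "(\<Sum>\<theta>\<in>signs. \<Sum>\<theta>'\<in>signs. N.expectation (\<lambda>yz. lik n \<theta> (snd yz) * lik n \<theta>' (snd yz)))
        \<le> (1 + \<epsilon>\<^sup>2) * (real (card signs))\<^sup>2"
      using sum_lik_second_moment[OF chi2] by (simp cong: sum.cong)
  qed
  then obtain \<theta> where \<theta>: "\<theta> \<in> signs"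
    and le: "1 - \<epsilon> \<le> N.prob (space ?N - E) + N.expectation (\<lambda>yz. lik n \<theta> (snd yz) * indicat_real E yz)" by blast
  let ?pq0 = "((\<lambda>_::'a. flat_density D), (\<lambda>_::'a. flat_density D))"
  let ?pq1 = "((\<lambda>_::'a. flat_density D), (\<lambda>_::'a. \<lambda>x. flat_density D x + pert \<theta> x))"
  let ?M = "obs_law \<omega> \<sigma> n"
  have I: "ennreal (N.prob (space ?N - E)) \<le> (SUP pq\<in>\<Theta>0. emeasure (?M pq) {yz \<in> space (?M pq). \<Delta> yz = 1})"
  proof (rule SUP_upper2[OF \<Theta>0])
    show "ennreal (N.prob (space ?N - E)) \<le> emeasure (?M ?pq0) {yz \<in> space (?M ?pq0). \<Delta> yz = 1}"
      unfolding obs_law_flat[OF w] Ec N.emeasure_eq_measure ..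
  qed
  have II: "ennreal (N.expectation (\<lambda>yz. lik n \<theta> (snd yz) * indicat_real E yz))
      \<le> (SUP pq\<in>\<Theta>1. emeasure (?M pq) {yz \<in> space (?M pq). \<Delta> yz = 0})"
  proof (rule SUP_upper2[OF \<Theta>1[OF \<theta>]])
    have "emeasure (?M ?pq1) {yz \<in> space (?M ?pq1). \<Delta> yz = 0} = (\<integral>\<^sup>+yz. ennreal (lik n \<theta> (snd yz)) * indicator E yz \<partial>?N)"
      unfolding obs_law_pert[OF w \<theta>] space_density E_def[symmetric]
      using lm E by (intro emeasure_density) auto
    also have "\<dots> = (\<integral>\<^sup>+yz. ennreal (lik n \<theta> (snd yz) * indicat_real E yz) \<partial>?N)"
      by (intro nn_integral_cong) (simp add: indicator_def)
    also have "\<dots> = ennreal (N.expectation (\<lambda>yz. lik n \<theta> (snd yz) * indicat_real E yz))"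
      using lm E lb[OF \<theta>] lik_bounds(1)[OF \<theta>]
      by (intro nn_integral_eq_integral integrable_real_mult_indicator N.integrable_bounded[where B="2 ^ n"]) auto
    finally show "ennreal (N.expectation (\<lambda>yz. lik n \<theta> (snd yz) * indicat_real E yz))
       \<le> emeasure (?M ?pq1) {yz \<in> space (?M ?pq1). \<Delta> yz = 0}" by simp
  qed
  have "ennreal (1 - \<epsilon>) \<le> ennreal (N.prob (space ?N - E) + N.expectation (\<lambda>yz. lik n \<theta> (snd yz) * indicat_real E yz))"
    using le by (rule ennreal_leI)
  also have "\<dots> = ennreal (N.prob (space ?N - E)) + ennreal (N.expectation (\<lambda>yz. lik n \<theta> (snd yz) * indicat_real E yz))"
    using lik_bounds(1)[OF \<theta>] by (intro ennreal_plus Bochner_Integration.integral_nonneg) auto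
  also have "\<dots> \<le> total_error \<omega> \<sigma> n \<Theta>0 \<Theta>1 \<Delta>"
    unfolding total_error_def by (intro add_mono I II)
  finally show ?thesis .
qed

end

lemma sep_rate_tendsto_0:
  assumes "s > 0"
  shows "(\<lambda>n. sep_rate s n) \<longlonglongrightarrow> 0"
  unfolding sep_rate_def using assms
  by (intro tendsto_neg_powr filterlim_real_sequentially) (simp add: field_simps)

context wavelets
begin

lemma lower_bound:
  fixes \<omega> \<sigma> :: "nat \<Rightarrow> 'm::finite \<Rightarrow> nat \<Rightarrow> real"
  assumes R: "R > 0" and s: "s > 0" and \<gamma>: "0 < \<gamma>" "\<gamma> < 1"
    and w: "\<And>n. mixing_weights (\<omega> n) n" "\<And>n. mixing_weights (\<sigma> n) n"
    and \<A>: "prob_densities \<inter> Linf_ball R \<subseteq> \<A>"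
  shows "\<exists>c\<^sub>\<gamma>>0. \<forall>C. 0 < C \<and> C < c\<^sub>\<gamma> \<longrightarrow>
      liminf (\<lambda>n. INF \<Delta>\<in>tests n.
        total_error (\<omega> n) (\<sigma> n) n (Theta0 R) (Theta1 \<A> \<psi> R C n s) \<Delta>)
      > ennreal \<gamma>"
proof -
  \<comment> \<open>Halving the gap leaves 1 - \<epsilon> strictly above \<gamma>, so that the
    inequality for the limit inferior is strict.\<close>
  define \<epsilon> where "\<epsilon> = (1 - \<gamma>) / 2"
  have \<epsilon>: "0 < \<epsilon>" "\<gamma> < 1 - \<epsilon>" using \<gamma> by (auto simp: \<epsilon>_def field_simps)
  \<comment> \<open>The first summand bounds flat density plus perturbation by 2/D <= R, the second
    puts the flat density into the L2-ball, and the rest makes room for 2^J wavelets inside [0, D)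
    at every level.\<close>
  define D where "D = 2 / R + 1 / R\<^sup>2 + 2 * of_int \<lceil>L\<rceil> + 1"
  have cL: "1 \<le> \<lceil>L\<rceil>" using L_pos by linarith
  have D0: "D > 0" and D1: "2 / R \<le> D" and D2: "1 / R\<^sup>2 \<le> D" and D3: "2 * of_int \<lceil>L\<rceil> + 1 \<le> D"
    using R cL by (auto simp: D_def intro!: add_nonneg_pos add_nonneg_nonneg)
  have DR: "2 / D \<le> R" "1 / D \<le> R" "1 / D \<le> R\<^sup>2"
    using D0 D1 D2 R by (auto simp: field_simps)
  define \<eta> where "\<eta> = ln (1 + \<epsilon>\<^sup>2)"
  have \<eta>: "\<eta> > 0" unfolding \<eta>_def using \<epsilon> by (intro ln_gt_zero) simp
  \<comment> \<open>The bound 1 allows replacing C^2 and C^4 by C, the second entry bounds the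
    chi-square exponent by \<open>\<eta>\<close>, and the third gives the Besov condition.\<close>
  define c where "c = min 1 (min (\<eta> / D\<^sup>2) (R / 2 powr (2 * s)))"
  have c: "c > 0" using \<eta> D0 R by (simp add: c_def)
  have "liminf (\<lambda>n. INF \<Delta>\<in>tests n.
        total_error (\<omega> n) (\<sigma> n) n (Theta0 R) (Theta1 \<A> \<psi> R C n s) \<Delta>) > ennreal \<gamma>"
    if C: "0 < C" "C < c" for C
  proof -
    have C1: "C \<le> 1" "C * D\<^sup>2 \<le> \<eta>" "C * 2 powr (2 * s) \<le> R"
      using C D0 by (auto simp: c_def field_simps)
    have "(\<lambda>n. C * bump_amp * sep_rate s n) \<longlonglongrightarrow> C * bump_amp * 0"
      by (intro tendsto_intros sep_rate_tendsto_0 s)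
    \<comment> \<open>Since \<delta> 2^(J/2) = C r for the amplitude chosen below, this is the
      condition of \<open>flat_perturbation\<close> that keeps the perturbation below the flat
      density.\<close>
    then have small: "\<forall>\<^sub>F n in sequentially. C * bump_amp * sep_rate s n < 1 / D"
      using D0 by (intro order_tendstoD(2)) auto
    have "\<forall>\<^sub>F n in sequentially. ennreal (1 - \<epsilon>) \<le>
       (INF \<Delta>\<in>tests n. total_error (\<omega> n) (\<sigma> n) n (Theta0 R) (Theta1 \<A> \<psi> R C n s) \<Delta>)"
      using small eventually_gt_at_top[of 0]
    proof eventually_elim
      case (elim n)
      define r where "r = sep_rate s n"
      define J where "J = level s n"
      \<comment> \<open>2^J consecutive positions, all with coefficients of modulus
        \<open>\<delta>\<close>, which is chosen so that 2^J \<delta>^2 = C^2 r^2, the squared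
        separation.\<close>
      define A where "A = {\<lceil>L\<rceil>..<\<lceil>L\<rceil> + 2 ^ J}"
      define \<delta> where "\<delta> = C * r / 2 powr (real J / 2)"
      have r: "r > 0" using elim by (simp add: r_def sep_rate_pos)
      have cardA: "card A = 2 ^ J" by (simp add: A_def nat_power_eq)
      have \<delta>2: "\<delta>\<^sup>2 = C\<^sup>2 * r\<^sup>2 / 2 ^ J"
        by (simp only: \<delta>_def power_divide power_mult_distrib powr_half_power2)
      interpret flat_perturbation \<phi> \<psi> L D J A \<delta>
      proof unfold_locales
        show "D > 0" by (rule D0)
        show "finite A" by (simp add: A_def)
        show "0 \<le> \<delta>" using C r by (simp add: \<delta>_def)
        show "\<delta> * 2 powr (real J / 2) * bump_amp \<le> 1 / D"
          using elim by (simp add: \<delta>_def r_def mult_ac)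
        fix k assume "k \<in> A"
        then have k: "\<lceil>L\<rceil> \<le> k" "k \<le> \<lceil>L\<rceil> + 2 ^ J" by (auto simp: A_def)
        have "L \<le> of_int k" using k(1) by linarith
        moreover have "of_int k + L \<le> D * 2 ^ J"
        proof -
          have "real_of_int k \<le> of_int (\<lceil>L\<rceil> + 2 ^ J)" using k(2) by (simp only: of_int_le_iff)
          then have "real_of_int k \<le> of_int \<lceil>L\<rceil> + 2 ^ J" by simp
          then have "of_int k + L \<le> 2 * of_int \<lceil>L\<rceil> + 2 ^ J" using le_of_int_ceiling[of L] by linarith
          also have "\<dots> \<le> 2 * of_int \<lceil>L\<rceil> * 2 ^ J + 2 ^ J" using cL by simp
          also have "\<dots> = (2 * of_int \<lceil>L\<rceil> + 1) * 2 ^ J" by (simp add: distrib_right)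
          also have "\<dots> \<le> D * 2 ^ J" using D3 by (intro mult_right_mono) auto
          finally show ?thesis .
        qed
        ultimately show "L \<le> of_int k \<and> of_int k + L \<le> D * 2 ^ J" by blast
      qed
      have sumc: "(\<Sum>k\<in>A. (if k \<in> A then \<delta> * \<theta> k else 0)\<^sup>2) = C\<^sup>2 * r\<^sup>2" if "\<theta> \<in> signs" for \<theta>
      proof -
        have "(\<Sum>k\<in>A. (if k \<in> A then \<delta> * \<theta> k else 0)\<^sup>2) = (\<Sum>k\<in>A. \<delta>\<^sup>2)"
          by (intro sum.cong refl) (simp add: power_mult_distrib signs_square[OF that])
        then show ?thesis by (simp add: cardA \<delta>2)
      qed
      show ?case
      proof (rule INF_greatest)
        fix \<Delta> assume \<Delta>: "\<Delta> \<in> tests n"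
        show "ennreal (1 - \<epsilon>) \<le> total_error (\<omega> n) (\<sigma> n) n (Theta0 R) (Theta1 \<A> \<psi> R C n s) \<Delta>"
        proof (rule total_error_lower[OF w \<epsilon>(1) _ \<Delta>])
          show "((\<lambda>_. flat_density D), (\<lambda>_. flat_density D)) \<in> Theta0 R"
            by (rule flat_Theta0[OF D0 DR(2,3)])
          show "((\<lambda>_. flat_density D), (\<lambda>_ x. flat_density D x + pert \<theta> x)) \<in> Theta1 \<A> \<psi> R C n s"
            if \<theta>: "\<theta> \<in> signs" for \<theta>
          proof -
            have "2 powr (2 * real J * s) * (C\<^sup>2 * r\<^sup>2) \<le> R"
            proof -
              have "2 powr (2 * real J * s) * (C\<^sup>2 * r\<^sup>2) = C\<^sup>2 * (2 powr (2 * real J * s) * r\<^sup>2)" by simp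
              also have "\<dots> \<le> C\<^sup>2 * 2 powr (2 * s)"
                unfolding r_def J_def using elim s by (intro mult_left_mono level_sep_rate(4)) auto
              also have "\<dots> \<le> C * 2 powr (2 * s)"
                using C C1(1) by (intro mult_right_mono) (auto simp: power2_eq_square)
              finally show ?thesis using C1(3) by linarith
            qed
            moreover have "sqrt (C\<^sup>2 * r\<^sup>2) = C * r"
              using C r by (simp add: real_sqrt_mult)
            ultimately have besov: "2 powr (2 * real J * s) * (\<Sum>k\<in>A. (if k \<in> A then \<delta> * \<theta> k else 0)\<^sup>2) \<le> R"
              and sep: "C * sep_rate s n \<le> sqrt (\<Sum>k\<in>A. (if k \<in> A then \<delta> * \<theta> k else 0)\<^sup>2)"
              unfolding sumc[OF \<theta>] r_def by simp_all
            note in_alternative = flat_bump_Theta1[OF finite_A D0 DR(1) less_imp_le[OF s] A_supp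
                pert_bound[OF \<theta>, unfolded pert_def] besov sep, folded pert_def]
            show ?thesis using in_alternative \<A> unfolding Theta1_def by blast
          qed
          show "exp ((real n * D * \<delta>\<^sup>2)\<^sup>2 * real (card A)) \<le> 1 + \<epsilon>\<^sup>2"
          proof -
            have "(real n * D * \<delta>\<^sup>2)\<^sup>2 * real (card A) = D\<^sup>2 * C ^ 4 * ((real n)\<^sup>2 * r ^ 4 / 2 ^ J)"
              unfolding \<delta>2 cardA by (simp add: power2_eq_square power4_eq_xxxx)
            also have "\<dots> \<le> D\<^sup>2 * C ^ 4 * 1"
              using level_sep_rate(1)[of n s] elim s
              by (intro mult_left_mono) (auto simp: r_def J_def divide_le_eq)
            also have "\<dots> \<le> D\<^sup>2 * C"
              using C C1(1) power_decreasing[of 1 4 C] by (simp add: mult_left_mono)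
            also have "\<dots> \<le> \<eta>" using C1(2) by (simp add: mult.commute)
            finally have "exp ((real n * D * \<delta>\<^sup>2)\<^sup>2 * real (card A)) \<le> exp \<eta>" by simp
            also have "exp \<eta> = 1 + \<epsilon>\<^sup>2" unfolding \<eta>_def by (rule exp_ln) (simp add: add_pos_nonneg)
            finally show ?thesis .
          qed
        qed
      qed
    qed
    then have "ennreal (1 - \<epsilon>) \<le> liminf (\<lambda>n. INF \<Delta>\<in>tests n.
        total_error (\<omega> n) (\<sigma> n) n (Theta0 R) (Theta1 \<A> \<psi> R C n s) \<Delta>)"
      by (rule Liminf_bounded)
    moreover have "ennreal \<gamma> < ennreal (1 - \<epsilon>)" using \<epsilon> \<gamma> by (simp add: ennreal_less_iff)
    ultimately show ?thesis by (rule less_le_trans[rotated])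
  qed
  with c show ?thesis by blast
qed

end

section \<open>Unbounded components\<close>

text \<open>With at least two components, those which are not separated may be concentrated on a set of
  diameter of order \<open>2\<^sup>-\<^sup>j\<close>. For a fixed sample size the variance of \<open>T\<^sub>j\<close> is then of order \<open>4\<^sup>j\<close>: with
  probability bounded away from 0 all observations are far apart and \<open>T\<^sub>j = 0\<close>, and with probability
  bounded away from 0 exactly two of them, with correlated dual weights, fall into that set.\<close>

lemma emeasure_lborel_finite:
  fixes S :: "real set"
  assumes "S \<subseteq> {-a..a}"
  shows "emeasure lborel S < \<infinity>"
proof -
  have "emeasure lborel S \<le> emeasure lborel {-a..a}" using assms by (intro emeasure_mono) auto
  also have "\<dots> < \<infinity>" by (cases "-a \<le> a") auto
  finally show ?thesis .
qed

context wavelets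
begin

lemma not_AE_phi_zero: "\<not> (AE x in lborel. \<phi> x = 0)"
proof
  assume "AE x in lborel. \<phi> x = 0"
  then have "inner_L2 \<phi> \<phi> = inner_L2 (\<lambda>_. 0) \<phi>"
    by (intro inner_L2_cong_AE) auto
  then have "inner_L2 \<phi> \<phi> = 0" by (simp add: inner_L2_def)
  moreover have "inner_L2 (dilate \<phi> 0 0) (dilate \<phi> 0 0) = 1"
    using onf.e_orth[of "Inl 0" 0 "Inl 0"] by simp
  ultimately show False by (simp add: dilate_0_0)
qed

text \<open>The scaling function need not be continuous, so a small interval would not do as a
  cluster. A level set |\<phi>| >= 1/(m+1) of positive measure is cut according to the signs of all
  relevant translates; on a piece of positive measure no cancellation can occur in the sum over
  \<open>k\<close>, and its term at 0 is bounded away from 0.\<close>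

lemma exists_cluster_set:
  obtains S d where "S \<in> sets borel" "S \<subseteq> {-L..L}" "0 < measure lborel S" "0 < d"
    "\<And>u u' k. u \<in> S \<Longrightarrow> u' \<in> S \<Longrightarrow> 0 \<le> \<phi> (u - of_int k) * \<phi> (u' - of_int k)"
    "\<And>u u'. u \<in> S \<Longrightarrow> u' \<in> S \<Longrightarrow> d \<le> \<phi> u * \<phi> u'"
proof -
  define U where "U m = {x. 1 / (real m + 1) \<le> \<bar>\<phi> x\<bar>}" for m :: nat
  have Um: "U m \<in> sets borel" for m unfolding U_def by measurable
  have "\<exists>m. U m \<notin> null_sets lborel"
  proof (rule ccontr)
    assume "\<not> ?thesis"
    then have "AE x in lborel. \<forall>m. x \<notin> U m"
      by (auto simp: AE_all_countable intro: AE_not_in)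
    then have "AE x in lborel. \<phi> x = 0"
    proof eventually_elim
      case (elim x)
      show ?case
      proof (rule ccontr)
        assume "\<phi> x \<noteq> 0"
        then obtain m where "inverse (real (Suc m)) < \<bar>\<phi> x\<bar>" using reals_Archimedean[of "\<bar>\<phi> x\<bar>"] by auto
        then have "x \<in> U m" by (simp add: U_def inverse_eq_divide add.commute)
        with elim show False by blast
      qed
    qed
    then show False using not_AE_phi_zero by blast
  qed
  then obtain m where m: "U m \<notin> null_sets lborel" by blast
  \<comment> \<open>For u in [-L, L] the value of \<phi> at u - k is nonzero only if |k| <= 2L, so
    finitely many sign conditions decide all translates.\<close>
  define W where "W = {k::int. \<bar>0 - of_int k\<bar> \<le> 2 * L}"
  have W: "finite W" unfolding W_def using L_pos by (intro card_int_interval_le) auto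
  define V where "V P = {x \<in> U m. \<forall>k\<in>W. (k \<in> P) = (0 \<le> \<phi> (x - of_int k))}" for P
  have Vm: "V P \<in> sets borel" for P
  proof -
    have "{x \<in> space borel. \<forall>k\<in>W. (k \<in> P) = (0 \<le> \<phi> (x - of_int k))} \<in> sets borel"
      using W by (intro sets.sets_Collect_finite_All) measurable
    then have "U m \<inter> {x \<in> space borel. \<forall>k\<in>W. (k \<in> P) = (0 \<le> \<phi> (x - of_int k))} \<in> sets borel"
      using Um by (intro sets.Int)
    also have "U m \<inter> {x \<in> space borel. \<forall>k\<in>W. (k \<in> P) = (0 \<le> \<phi> (x - of_int k))} = V P"
      by (auto simp: V_def)
    finally show ?thesis .
  qed
  have UV: "U m = (\<Union>P\<in>Pow W. V P)"
  proof
    show "U m \<subseteq> (\<Union>P\<in>Pow W. V P)"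
    proof
      fix x assume "x \<in> U m"
      then have "x \<in> V {k\<in>W. 0 \<le> \<phi> (x - of_int k)}" by (auto simp: V_def)
      then show "x \<in> (\<Union>P\<in>Pow W. V P)" by (rule UN_I[rotated]) simp
    qed
  qed (auto simp: V_def)
  have "\<exists>P\<in>Pow W. V P \<notin> null_sets lborel"
  proof (rule ccontr)
    assume "\<not> ?thesis"
    then have "(\<Union>P\<in>Pow W. V P) \<in> null_sets lborel" using W by (intro null_sets.finite_UN) auto
    with m show False unfolding UV by blast
  qed
  then obtain P where P: "V P \<notin> null_sets lborel" by blast
  have sub: "V P \<subseteq> {-L..L}"
  proof
    fix x assume "x \<in> V P"
    then have "1 / (real m + 1) \<le> \<bar>\<phi> x\<bar>" by (simp add: V_def U_def)
    moreover have "0 < 1 / (real m + 1)" by simp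
    ultimately have "\<phi> x \<noteq> 0" by linarith
    then show "x \<in> {-L..L}" using phi_supp[of x] by simp
  qed
  have fin: "emeasure lborel (V P) < \<infinity>" using sub by (rule emeasure_lborel_finite)
  have pos: "0 < measure lborel (V P)"
  proof -
    have "emeasure lborel (V P) \<noteq> 0" using P Vm by (simp add: null_sets_def)
    then show ?thesis using fin by (simp add: measure_def enn2real_positive_iff zero_less_iff_neq_zero)
  qed
  have sgn: "0 \<le> \<phi> (u - of_int k) * \<phi> (u' - of_int k)" if u: "u \<in> V P" "u' \<in> V P" for u u' k
  proof (cases "k \<in> W")
    case True
    then have "(0 \<le> \<phi> (u - of_int k)) = (0 \<le> \<phi> (u' - of_int k))" using u by (auto simp: V_def)
    then show ?thesis by (auto simp: zero_le_mult_iff)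
  next
    case False
    have "-L \<le> u" "u \<le> L" using sub u(1) by auto
    then have "\<phi> (u - of_int k) = 0" using phi_supp[of "u - of_int k"] False by (force simp: W_def)
    then show ?thesis by simp
  qed
  have low: "(1 / (real m + 1))\<^sup>2 \<le> \<phi> u * \<phi> u'" if u: "u \<in> V P" "u' \<in> V P" for u u'
  proof -
    have "1 / (real m + 1) \<le> \<bar>\<phi> u\<bar>" "1 / (real m + 1) \<le> \<bar>\<phi> u'\<bar>" using u by (auto simp: V_def U_def)
    then have "(1 / (real m + 1)) * (1 / (real m + 1)) \<le> \<bar>\<phi> u\<bar> * \<bar>\<phi> u'\<bar>" by (intro mult_mono) auto
    also have "\<dots> = \<phi> u * \<phi> u'" using sgn[OF u, of 0] by (simp flip: abs_mult)
    finally show ?thesis by (simp add: power2_eq_square)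
  qed
  show thesis
    by (rule that[of "V P" "(1 / (real m + 1))\<^sup>2"]) (use Vm sub pos sgn low in auto)
qed

lemma dilate_phi_mult_far:
  assumes "2 * L < 2 ^ j * \<bar>x - x'\<bar>"
  shows "dilate \<phi> j k x * dilate \<phi> j k x' = 0"
proof (rule ccontr)
  assume "\<not> ?thesis"
  then have "\<bar>2 ^ j * x - of_int k\<bar> \<le> L" "\<bar>2 ^ j * x' - of_int k\<bar> \<le> L"
    using dilate_phi_supp[of j k x] dilate_phi_supp[of j k x'] by auto
  then have "\<bar>2 ^ j * x - 2 ^ j * x'\<bar> \<le> 2 * L" by linarith
  also have "2 ^ j * x - 2 ^ j * x' = 2 ^ j * (x - x')" by (simp add: right_diff_distrib)
  finally show False using assms by (simp add: abs_mult)
qed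

text \<open>Products of values at far points vanish for every \<open>k\<close>, so only the two
  orderings of the pair i1, i2 survive, whence the factor 2. The two values with the same index may
  be close, as the statistic omits the diagonal. The pair itself may also be far apart, in which
  case the formula yields 0.\<close>

lemma T_stat_one_pair:
  assumes i: "i1 \<in> {1..n}" "i2 \<in> {1..n}" "i1 \<noteq> i2"
    and S: "finite S" "(\<Union>i\<in>{1..n}. active j (fst yz i) \<union> active j (snd yz i)) \<subseteq> S"
    and yz_far: "\<And>i i'. i \<in> {1..n} \<Longrightarrow> i' \<in> {1..n} \<Longrightarrow> i \<noteq> i' \<Longrightarrow> 2 * L < 2 ^ j * \<bar>fst yz i - snd yz i'\<bar>"
    and zz_far: "\<And>i i'. i \<in> {1..n} \<Longrightarrow> i' \<in> {1..n} \<Longrightarrow> i \<noteq> i' \<Longrightarrow> 2 * L < 2 ^ j * \<bar>snd yz i - snd yz i'\<bar>"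
    and yy_far: "\<And>i i'. i \<in> {1..n} \<Longrightarrow> i' \<in> {1..n} \<Longrightarrow> i \<noteq> i' \<Longrightarrow> {i, i'} \<noteq> {i1, i2} \<Longrightarrow>
      2 * L < 2 ^ j * \<bar>fst yz i - fst yz i'\<bar>"
  shows "T_stat \<phi> \<omega> \<sigma> n j yz = 2 / (real n)\<^sup>2 * (\<Sum>l\<in>UNIV. dual_weight \<omega> n l i1 * dual_weight \<omega> n l i2)
    * (\<Sum>k\<in>S. dilate \<phi> j k (fst yz i1) * dilate \<phi> j k (fst yz i2))"
proof -
  define a where "a = dual_weight \<omega> n"
  define b where "b = dual_weight \<sigma> n"
  define X where "X l k i i' = a l i * a l i' * (dilate \<phi> j k (fst yz i) * dilate \<phi> j k (fst yz i'))" for l k i i'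
  have prod: "obs_term \<phi> \<omega> \<sigma> n j l k i yz * obs_term \<phi> \<omega> \<sigma> n j l k i' yz
      = (if {i, i'} = {i1, i2} then X l k i1 i2 else 0)"
    if ii: "i \<in> {1..n}" "i' \<in> {1..n}" "i \<noteq> i'" for l k i i'
  proof -
    have z: "dilate \<phi> j k (fst yz i) * dilate \<phi> j k (snd yz i') = 0"
      "dilate \<phi> j k (fst yz i') * dilate \<phi> j k (snd yz i) = 0"
      "dilate \<phi> j k (snd yz i) * dilate \<phi> j k (snd yz i') = 0"
      using ii by (intro dilate_phi_mult_far yz_far zz_far; auto)+
    have "obs_term \<phi> \<omega> \<sigma> n j l k i yz * obs_term \<phi> \<omega> \<sigma> n j l k i' yz
      = X l k i i' - a l i * b l i' * (dilate \<phi> j k (fst yz i) * dilate \<phi> j k (snd yz i'))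
       - a l i' * b l i * (dilate \<phi> j k (fst yz i') * dilate \<phi> j k (snd yz i))
       + b l i * b l i' * (dilate \<phi> j k (snd yz i) * dilate \<phi> j k (snd yz i'))"
      by (simp add: obs_term_def a_def b_def X_def algebra_simps)
    then have "obs_term \<phi> \<omega> \<sigma> n j l k i yz * obs_term \<phi> \<omega> \<sigma> n j l k i' yz = X l k i i'"
      unfolding z by simp
    moreover have "X l k i i' = 0" if "{i, i'} \<noteq> {i1, i2}"
      unfolding X_def dilate_phi_mult_far[OF yy_far[OF ii that]] by simp
    moreover have "X l k i i' = X l k i1 i2" if "{i, i'} = {i1, i2}"
      using that by (auto simp: X_def doubleton_eq_iff)
    ultimately show ?thesis by auto
  qed
  have pairs: "(\<Sum>i\<in>{1..n}. \<Sum>i'\<in>{1..n} - {i}. obs_term \<phi> \<omega> \<sigma> n j l k i yz * obs_term \<phi> \<omega> \<sigma> n j l k i' yz)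
      = 2 * X l k i1 i2" for l k
  proof -
    have "(\<Sum>i'\<in>{1..n} - {i}. obs_term \<phi> \<omega> \<sigma> n j l k i yz * obs_term \<phi> \<omega> \<sigma> n j l k i' yz)
        = (if i \<in> {i1, i2} then X l k i1 i2 else 0)" if "i \<in> {1..n}" for i
    proof -
      have "(\<Sum>i'\<in>{1..n} - {i}. obs_term \<phi> \<omega> \<sigma> n j l k i yz * obs_term \<phi> \<omega> \<sigma> n j l k i' yz)
          = (\<Sum>i'\<in>{1..n} - {i}. if {i, i'} = {i1, i2} then X l k i1 i2 else 0)"
        using that by (intro sum.cong refl prod) auto
      also have "\<dots> = (\<Sum>i'\<in>{1..n} - {i}. if i' = (if i = i1 then i2 else i1) then (if i \<in> {i1, i2} then X l k i1 i2 else 0) else 0)"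
        using i(3) by (intro sum.cong refl) (auto simp: doubleton_eq_iff)
      also have "\<dots> = (if i \<in> {i1, i2} then X l k i1 i2 else 0)"
        using i by (auto simp: sum.delta)
      finally show ?thesis .
    qed
    then have "(\<Sum>i\<in>{1..n}. \<Sum>i'\<in>{1..n} - {i}. obs_term \<phi> \<omega> \<sigma> n j l k i yz * obs_term \<phi> \<omega> \<sigma> n j l k i' yz)
       = (\<Sum>i\<in>{1..n}. if i \<in> {i1, i2} then X l k i1 i2 else 0)"
      by (intro sum.cong refl)
    also have "\<dots> = (\<Sum>i\<in>{i1, i2}. X l k i1 i2)"
      using i by (intro sum.mono_neutral_cong_right) auto
    finally show ?thesis using i(3) by simp
  qed
  have "T_stat \<phi> \<omega> \<sigma> n j yz = 1 / (real n)\<^sup>2 * (\<Sum>l\<in>UNIV. \<Sum>k\<in>S. 2 * X l k i1 i2)"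
    unfolding T_stat_eq_T_trunc[OF S] T_trunc_def pairs ..
  also have "(\<Sum>l\<in>UNIV. \<Sum>k\<in>S. 2 * X l k i1 i2) = 2 * (\<Sum>l\<in>UNIV. a l i1 * a l i2)
      * (\<Sum>k\<in>S. dilate \<phi> j k (fst yz i1) * dilate \<phi> j k (fst yz i2))"
    by (simp only: mult.assoc sum_product) (simp add: X_def sum_distrib_left mult_ac)
  finally show ?thesis by (simp add: a_def)
qed

end

section \<open>Lower estimates of probabilities and variances\<close>

lemma measure_density_ge:
  assumes f: "f \<in> prob_densities" and B: "B \<in> sets borel" "emeasure lborel B < \<infinity>"
    and c: "0 \<le> c" "\<And>x. x \<in> B \<Longrightarrow> c \<le> f x"
  shows "c * measure lborel B \<le> measure (density lborel (\<lambda>x. ennreal (f x))) B"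
proof -
  interpret prob_space "density lborel (\<lambda>x. ennreal (f x))" by (rule prob_space_prob_density[OF f])
  have [measurable]: "f \<in> borel_measurable borel" by (rule prob_densities_measurable[OF f])
  have "ennreal (c * measure lborel B) = ennreal c * emeasure lborel B"
    using c(1) B(2) by (simp add: ennreal_mult emeasure_eq_ennreal_measure less_top)
  also have "\<dots> = (\<integral>\<^sup>+x. ennreal c * indicator B x \<partial>lborel)"
    using B(1) by (simp add: nn_integral_cmult_indicator)
  also have "\<dots> \<le> (\<integral>\<^sup>+x. ennreal (f x) * indicator B x \<partial>lborel)"
    using c(2) by (intro nn_integral_mono) (auto simp: indicator_def intro: ennreal_leI)
  also have "\<dots> = emeasure (density lborel (\<lambda>x. ennreal (f x))) B"
    using B(1) by (simp add: emeasure_density)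
  finally show ?thesis by (simp add: emeasure_eq_measure)
qed

lemma (in finite_prob_product) measure_box_ge:
  assumes A: "\<And>i. i \<in> I \<Longrightarrow> A i \<in> sets (N i)" and \<beta>: "0 \<le> \<beta>" "\<And>i. i \<in> I \<Longrightarrow> \<beta> \<le> measure (N i) (A i)"
  shows "\<beta> ^ card I \<le> measure (PiM I N) (Pi\<^sub>E I A)"
proof -
  interpret P: prob_space "PiM I N" by (rule prob_space_PiM_N)
  have "emeasure (PiM I N) (Pi\<^sub>E I A) = (\<Prod>i\<in>I. emeasure (N i) (A i))"
    using A by (rule emeasure_box)
  also have "\<dots> = (\<Prod>i\<in>I. ennreal (measure (N i) (A i)))"
    using prob_N by (intro prod.cong refl) (simp add: finite_measure.emeasure_eq_measure prob_space_def)
  finally have "emeasure (PiM I N) (Pi\<^sub>E I A) = (\<Prod>i\<in>I. ennreal (measure (N i) (A i)))" .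
  then have "measure (PiM I N) (Pi\<^sub>E I A) = (\<Prod>i\<in>I. measure (N i) (A i))"
    by (simp add: prod_ennreal P.emeasure_eq_measure prod_nonneg)
  moreover have "(\<Prod>i\<in>I. \<beta>) \<le> (\<Prod>i\<in>I. measure (N i) (A i))"
    using \<beta> by (intro prod_mono) auto
  ultimately show ?thesis by simp
qed

lemma (in prob_space) variance_ge:
  fixes T :: "'a \<Rightarrow> real"
  assumes T: "T \<in> borel_measurable M" "integrable M T" "integrable M (\<lambda>x. (T x)\<^sup>2)"
    and B: "B \<in> events" and t: "0 \<le> t" "\<And>x. x \<in> B \<Longrightarrow> t \<le> \<bar>T x - expectation T\<bar>"
  shows "t\<^sup>2 * prob B \<le> variance T"
proof -
  have "t\<^sup>2 * prob B = expectation (\<lambda>x. t\<^sup>2 * indicat_real B x)" using B by simp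
  also have "\<dots> \<le> variance T"
  proof (rule integral_mono)
    show "integrable M (\<lambda>x. t\<^sup>2 * indicat_real B x)"
      using B by (intro integrable_mult_right integrable_real_indicator) (auto simp: emeasure_eq_measure)
    show "integrable M (\<lambda>x. (T x - expectation T)\<^sup>2)"
      using T by (simp add: power2_diff)
    show "t\<^sup>2 * indicat_real B x \<le> (T x - expectation T)\<^sup>2" for x
      using power_mono[OF t(2) t(1), of x 2] by (simp add: indicator_def)
  qed
  finally show ?thesis .
qed

text \<open>Wherever the mean lies, it is at distance at least t/2 from the values of
  \<open>T\<close> on one of the two events.\<close>

lemma (in prob_space) variance_ge_two_events:
  fixes T :: "'a \<Rightarrow> real"
  assumes T: "T \<in> borel_measurable M" "integrable M T" "integrable M (\<lambda>x. (T x)\<^sup>2)"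
    and B0: "B0 \<in> events" "b \<le> prob B0" "\<And>x. x \<in> B0 \<Longrightarrow> T x = 0"
    and B1: "B1 \<in> events" "b \<le> prob B1" "\<And>x. x \<in> B1 \<Longrightarrow> t \<le> \<bar>T x\<bar>"
    and t: "0 \<le> t"
  shows "(t / 2)\<^sup>2 * b \<le> variance T"
proof (cases "t / 2 \<le> \<bar>expectation T\<bar>")
  case True
  have "(t / 2)\<^sup>2 * b \<le> (t / 2)\<^sup>2 * prob B0" using B0(2) by (intro mult_left_mono) auto
  also have "\<dots> \<le> variance T"
    using True B0(3) t by (intro variance_ge T B0(1)) auto
  finally show ?thesis .
next
  case False
  have "(t / 2)\<^sup>2 * b \<le> (t / 2)\<^sup>2 * prob B1" using B1(2) by (intro mult_left_mono) auto
  also have "\<dots> \<le> variance T"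
  proof (intro variance_ge T B1(1))
    fix x assume "x \<in> B1"
    with B1(3)[of x] False show "t / 2 \<le> \<bar>T x - expectation T\<bar>" by linarith
  qed (use t in simp)
  finally show ?thesis .
qed

text \<open>The uniform density on the contraction of \<open>S\<close> by the factor 2^(-j).\<close>

definition concentrated :: "real set \<Rightarrow> nat \<Rightarrow> real \<Rightarrow> real" where
  "concentrated S j x = 2 ^ j / measure lborel S * indicat_real S (2 ^ j * x)"

lemma integral_indicator_dilated:
  fixes S :: "real set"
  assumes "S \<in> sets borel" "emeasure lborel S < \<infinity>"
  shows "integrable lborel (\<lambda>x. indicat_real S (2 ^ j * x))"
    and "(LINT x|lborel. indicat_real S (2 ^ j * x)) = measure lborel S / 2 ^ j"
proof -
  have int: "integrable lborel (indicat_real S)"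
    using assms by (intro integrable_real_indicator) auto
  then show "integrable lborel (\<lambda>x. indicat_real S (2 ^ j * x))"
    using lborel_integrable_real_affine[OF int, of "2 ^ j" 0] by simp
  have "(LINT x|lborel. indicat_real S x) = 2 ^ j * (LINT x|lborel. indicat_real S (2 ^ j * x))"
    using lborel_integral_real_affine[of "2 ^ j" "indicat_real S" 0] by simp
  then show "(LINT x|lborel. indicat_real S (2 ^ j * x)) = measure lborel S / 2 ^ j"
    using assms by (simp add: field_simps)
qed

lemma concentrated_prob_density:
  assumes S: "S \<in> sets borel" "emeasure lborel S < \<infinity>" "0 < measure lborel S"
  shows "concentrated S j \<in> prob_densities"
proof (rule prob_densitiesI)
  have [measurable]: "S \<in> sets borel" by fact
  show "concentrated S j \<in> borel_measurable borel" unfolding concentrated_def[abs_def] by measurable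
  show "0 \<le> concentrated S j x" for x using S by (simp add: concentrated_def)
  show "integrable lborel (concentrated S j)" "(LINT x|lborel. concentrated S j x) = 1"
    unfolding concentrated_def[abs_def] using integral_indicator_dilated[OF S(1,2), of j] S(3) by auto
qed

lemma prob_densities_average:
  assumes "f \<in> prob_densities" "g \<in> prob_densities"
  shows "(\<lambda>x. (f x + g x) / 2) \<in> prob_densities"
proof (rule prob_densitiesI)
  have [measurable]: "f \<in> borel_measurable borel" "g \<in> borel_measurable borel"
    using assms by (auto intro: prob_densities_measurable)
  show "(\<lambda>x. (f x + g x) / 2) \<in> borel_measurable borel" by measurable
qed (use assms in \<open>auto simp: prob_densities_nonneg prob_densities_integrable prob_densities_integral\<close>)

lemma measure_pair_Times:
  assumes P: "prob_space P" and Q: "prob_space Q" and A: "A \<in> sets P" and B: "B \<in> sets Q"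
  shows "measure (P \<Otimes>\<^sub>M Q) (A \<times> B) = measure P A * measure Q B"
proof -
  interpret P: prob_space P by fact
  interpret Q: prob_space Q by fact
  interpret PQ: pair_prob_space P Q by standard
  have "emeasure (P \<Otimes>\<^sub>M Q) (A \<times> B) = emeasure P A * emeasure Q B"
    using A B by (rule Q.emeasure_pair_measure_Times)
  then show ?thesis
    by (simp add: PQ.P.emeasure_eq_measure P.emeasure_eq_measure Q.emeasure_eq_measure flip: ennreal_mult)
qed

lemma mixture_ge:
  assumes "mixing_weights w n" "i \<in> {1..n}" "\<And>u. c \<le> p u x"
  shows "c \<le> mixture w p i x"
proof -
  have "c = (\<Sum>u\<in>UNIV. w u i * c)"
    using assms(1,2) by (simp add: mixing_weights_def flip: sum_distrib_right)
  also have "\<dots> \<le> mixture w p i x"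
    unfolding mixture_def using assms by (intro sum_mono mult_left_mono) (auto simp: mixing_weights_def)
  finally show ?thesis .
qed

lemma mixture_ge_component:
  assumes "mixing_weights w n" "i \<in> {1..n}" "\<And>u. 0 \<le> p u x"
  shows "w v i * p v x \<le> mixture w p i x"
  unfolding mixture_def using assms
  by (intro member_le_sum[of v UNIV "\<lambda>u. w u i * p u x"]) (auto simp: mixing_weights_def)

context wavelets
begin

text \<open>\<open>\<beta>\<close> is a lower bound for the probability that one observation falls
  into its cell or, for i1 and i2 in the first sample, into the cluster. Neither
  \<open>\<beta>\<close> nor \<open>\<tau>\<close> depends on \<open>j\<close>, so the estimate
  grows like 4^j. The condition on \<open>j\<close> makes the interaction distance 2L / 2^j less
  than half the cell width.\<close>

lemma variance_concentrated:
  fixes \<omega> \<sigma> :: "'m::finite \<Rightarrow> nat \<Rightarrow> real"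
  assumes S: "S \<in> sets borel" "S \<subseteq> {-L..L}" "0 < measure lborel S"
    and d: "0 < d" "\<And>u u' k. u \<in> S \<Longrightarrow> u' \<in> S \<Longrightarrow> 0 \<le> \<phi> (u - of_int k) * \<phi> (u' - of_int k)"
      "\<And>u u'. u \<in> S \<Longrightarrow> u' \<in> S \<Longrightarrow> d \<le> \<phi> u * \<phi> u'"
    and spread: "spread_weights \<omega> n K" "spread_weights \<sigma> n K"
    and i: "i1 \<in> {1..n}" "i2 \<in> {1..n}" "i1 \<noteq> i2" and v: "v \<noteq> u\<^sub>0" "0 < \<omega> v i1" "0 < \<omega> v i2"
    and D: "0 < D" and g: "g \<in> prob_densities" "\<And>x. flat_density D x / 2 \<le> g x"
    and h_eq: "h = D / (2 * (real n + 1))" and j: "4 * L < 2 ^ j * h"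
    and \<beta>_eq: "\<beta> = min (h / (2 * D)) (min (\<omega> v i1 / 2) (\<omega> v i2 / 2))"
    and \<tau>_eq: "\<tau> = \<bar>2 / (real n)\<^sup>2 * (\<Sum>l\<in>UNIV. dual_weight \<omega> n l i1 * dual_weight \<omega> n l i2)\<bar>"
    and m_eq: "m = (\<lambda>x. (flat_density D x + concentrated S j x) / 2)"
    and p_eq: "p = (\<lambda>u. if u = u\<^sub>0 then flat_density D else m)"
    and q_eq: "q = (\<lambda>u. if u = u\<^sub>0 then g else m)"
  shows "(\<tau> * (2 ^ j * d) / 2)\<^sup>2 * (\<beta> ^ n * \<beta> ^ n) \<le> prob_space.variance (obs_law \<omega> \<sigma> n (p, q)) (T_stat \<phi> \<omega> \<sigma> n j)"
proof -
  have finS: "emeasure lborel S < \<infinity>" using S(2) by (rule emeasure_lborel_finite)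
  have dens_m: "m \<in> prob_densities" unfolding m_eq
    by (intro prob_densities_average flat_prob_density D concentrated_prob_density S finS)
  have dens: "p u \<in> prob_densities" "q u \<in> prob_densities" for u
    using dens_m g(1) flat_prob_density[OF D] by (auto simp: p_eq q_eq)
  interpret mixture_model \<phi> \<psi> L \<omega> \<sigma> n K p q
    using spread dens wavelets_axioms by (intro mixture_model.intro mixture_model_axioms.intro)
  have f0: "0 \<le> flat_density D x" for x using D by (simp add: flat_density_def)
  have c0: "0 \<le> concentrated S j x" for x using S(3) by (simp add: concentrated_def)
  have m_ge: "flat_density D x / 2 \<le> m x" "concentrated S j x / 2 \<le> m x" for x
    using f0[of x] c0[of x] by (auto simp: m_eq)
  have p_ge: "flat_density D x / 2 \<le> p u x" and q_ge: "flat_density D x / 2 \<le> q u x" for u x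
    using f0[of x] m_ge(1)[of x] g(2)[of x] by (auto simp: p_eq q_eq)
  have h0: "0 < h" using D by (simp add: h_eq)
  \<comment> \<open>Intervals of width \<open>h\<close> separated by gaps of width \<open>h\<close>,
    inside [0, D) for indices up to n. Starting at index 1 keeps them away from the cluster near
    0.\<close>
  define cell where "cell i = {2 * real i * h .. 2 * real i * h + h}" for i
  define clus where "clus = {x. 2 ^ j * x \<in> S}"
  define Y where "Y i = (if i \<in> {i1, i2} then clus else cell i)" for i
  have cell_borel: "cell i \<in> sets borel" for i by (simp add: cell_def)
  have clus_borel: "clus \<in> sets borel"
  proof -
    have [measurable]: "S \<in> sets borel" by fact
    show ?thesis unfolding clus_def by measurable
  qed
  have pow1: "(1::real) \<le> 2 ^ j" by simp
  have cell_flat: "flat_density D x = 1 / D" if "x \<in> cell i" "i \<in> {1..n}" for x i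
  proof -
    have "0 \<le> x" using that h0 by (auto simp: cell_def intro: order_trans[rotated])
    moreover have "x < D"
    proof -
      have "x \<le> (2 * real i + 1) * h" using that by (simp add: cell_def distrib_right)
      also have "\<dots> < (2 * (real n + 1)) * h" using that h0 by (intro mult_strict_right_mono) auto
      also have "\<dots> = D" by (simp add: h_eq)
      finally show ?thesis .
    qed
    ultimately show ?thesis by (simp add: flat_density_def)
  qed
  have cell_meas: "measure lborel (cell i) = h" "emeasure lborel (cell i) < \<infinity>" for i
    using h0 by (auto simp: cell_def)
  have clus_fin: "emeasure lborel clus < \<infinity>"
  proof -
    have "clus \<subseteq> {-L..L}"
    proof
      fix x assume "x \<in> clus"
      then have "\<bar>2 ^ j * x\<bar> \<le> L" using S(2) by (auto simp: clus_def abs_le_iff)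
      moreover have "1 * \<bar>x\<bar> \<le> 2 ^ j * \<bar>x\<bar>" by (intro mult_right_mono pow1) simp
      ultimately have "\<bar>x\<bar> \<le> L" by (simp add: abs_mult)
      then show "x \<in> {-L..L}" by (auto simp: abs_le_iff)
    qed
    then show ?thesis by (rule emeasure_lborel_finite)
  qed
  have clus_meas: "measure lborel clus = measure lborel S / 2 ^ j"
  proof -
    have "(\<lambda>x. indicat_real S (2 ^ j * x)) = indicat_real clus" by (auto simp: clus_def indicator_def)
    then show ?thesis using integral_indicator_dilated(2)[OF S(1) finS, of j] clus_borel by simp
  qed
  have \<beta>0: "0 < \<beta>" using h0 D v by (simp add: \<beta>_eq)
  let ?F = "\<lambda>i. density lborel (\<lambda>x. ennreal (mixture \<omega> p i x))"
  let ?G = "\<lambda>i. density lborel (\<lambda>x. ennreal (mixture \<sigma> q i x))"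
  have cellF: "\<beta> \<le> measure (?F i) (cell i)" and cellG: "\<beta> \<le> measure (?G i) (cell i)" if "i \<in> {1..n}" for i
  proof -
    have "1 / (2 * D) \<le> mixture \<omega> p i x" "1 / (2 * D) \<le> mixture \<sigma> q i x" if x: "x \<in> cell i" for x
      using mixture_ge[OF mixing(1) \<open>i \<in> {1..n}\<close>, where p=p and x=x, OF p_ge]
        mixture_ge[OF mixing(2) \<open>i \<in> {1..n}\<close>, where p=q and x=x, OF q_ge]
        cell_flat[OF x \<open>i \<in> {1..n}\<close>] by (auto simp: mult.commute)
    then have "1 / (2 * D) * measure lborel (cell i) \<le> measure (?F i) (cell i)"
      "1 / (2 * D) * measure lborel (cell i) \<le> measure (?G i) (cell i)"
      using D measure_density_ge[OF mixture_prob_density[OF mixing(1) that dens(1)] cell_borel cell_meas(2), of "1 / (2 * D)" i]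
        measure_density_ge[OF mixture_prob_density[OF mixing(2) that dens(2)] cell_borel cell_meas(2), of "1 / (2 * D)" i]
      by simp_all
    moreover have "\<beta> \<le> 1 / (2 * D) * measure lborel (cell i)" by (simp add: \<beta>_eq cell_meas)
    ultimately show "\<beta> \<le> measure (?F i) (cell i)" "\<beta> \<le> measure (?G i) (cell i)" by linarith+
  qed
  have clusF: "\<beta> \<le> measure (?F i) clus" if ii: "i \<in> {i1, i2}" for i
  proof -
    have i': "i \<in> {1..n}" and vi: "0 < \<omega> v i" using ii i v by auto
    have "\<omega> v i / 2 * (2 ^ j / measure lborel S) \<le> mixture \<omega> p i x" if "x \<in> clus" for x
    proof -
      have "concentrated S j x = 2 ^ j / measure lborel S" using that by (simp add: concentrated_def clus_def)
      moreover have "p v = m" using v(1) by (simp add: p_eq)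
      ultimately have "\<omega> v i * (2 ^ j / measure lborel S / 2) \<le> \<omega> v i * p v x"
        using m_ge(2)[of x] vi by (intro mult_left_mono) auto
      also have "\<dots> \<le> mixture \<omega> p i x"
        using mixing(1) i' prob_densities_nonneg[OF dens(1)] by (rule mixture_ge_component)
      finally show ?thesis by simp
    qed
    then have "\<omega> v i / 2 * (2 ^ j / measure lborel S) * measure lborel clus \<le> measure (?F i) clus"
      using vi S(3) by (intro measure_density_ge mixture_prob_density[OF mixing(1) i' dens(1)] clus_borel clus_fin) auto
    moreover have "\<omega> v i / 2 * (2 ^ j / measure lborel S) * measure lborel clus = \<omega> v i / 2"
      using S(3) by (simp add: clus_meas)
    moreover have "\<beta> \<le> \<omega> v i / 2" using ii by (auto simp: \<beta>_eq)
    ultimately show ?thesis by linarith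
  qed
  have YF: "\<beta> \<le> measure (?F i) (Y i)" if "i \<in> {1..n}" for i
    using clusF cellF[OF that] by (auto simp: Y_def)
  have Y_borel: "Y i \<in> sets borel" for i using cell_borel clus_borel by (simp add: Y_def)
  let ?P = "sample_law \<omega> p n" and ?Q = "sample_law \<sigma> q n"
  have P: "prob_space ?P" and Q: "prob_space ?Q" by (intro prob_space_sample_law mixing dens)+
  interpret P: finite_prob_product "{1..n}" ?F by (intro sample_finite_prob_product mixing dens)
  interpret Q: finite_prob_product "{1..n}" ?G by (intro sample_finite_prob_product mixing dens)
  define B0 where "B0 = Pi\<^sub>E {1..n} cell \<times> Pi\<^sub>E {1..n} cell"
  define B1 where "B1 = Pi\<^sub>E {1..n} Y \<times> Pi\<^sub>E {1..n} cell"
  have setP: "Pi\<^sub>E {1..n} A \<in> sets ?P" and setQ: "Pi\<^sub>E {1..n} A \<in> sets ?Q" if "\<And>i. A i \<in> sets borel" for A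
    unfolding sets_sample_law using that by (auto intro!: sets_PiM_I_finite)
  have boxP: "\<beta> ^ n \<le> measure ?P (Pi\<^sub>E {1..n} A)"
    if "\<And>i. A i \<in> sets borel" "\<And>i. i \<in> {1..n} \<Longrightarrow> \<beta> \<le> measure (?F i) (A i)" for A
    using P.measure_box_ge[of A \<beta>] that \<beta>0 by (simp add: sample_law_eq)
  have boxQ: "\<beta> ^ n \<le> measure ?Q (Pi\<^sub>E {1..n} A)"
    if "\<And>i. A i \<in> sets borel" "\<And>i. i \<in> {1..n} \<Longrightarrow> \<beta> \<le> measure (?G i) (A i)" for A
    using Q.measure_box_ge[of A \<beta>] that \<beta>0 by (simp add: sample_law_eq)
  have Meq: "M = ?P \<Otimes>\<^sub>M ?Q" by (simp add: obs_law_def)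
  have B0: "B0 \<in> sets M" "\<beta> ^ n * \<beta> ^ n \<le> measure M B0"
    unfolding B0_def Meq
    using setP[OF cell_borel] setQ[OF cell_borel] boxP[OF cell_borel cellF] boxQ[OF cell_borel cellG] \<beta>0
    by (auto simp: measure_pair_Times[OF P Q] intro!: mult_mono)
  have B1: "B1 \<in> sets M" "\<beta> ^ n * \<beta> ^ n \<le> measure M B1"
    unfolding B1_def Meq
    using setP[OF Y_borel] setQ[OF cell_borel] boxP[OF Y_borel YF] boxQ[OF cell_borel cellG] \<beta>0
    by (auto simp: measure_pair_Times[OF P Q] intro!: mult_mono)
  have far_cells: "2 * L < 2 ^ j * \<bar>x - x'\<bar>" if "x \<in> cell i" "x' \<in> cell i'" "i \<noteq> i'" for x x' i i'
  proof -
    have "h \<le> \<bar>x - x'\<bar>"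
    proof -
      have "h \<le> y' - y" if "y \<in> cell k" "y' \<in> cell k'" "k < k'" for y y' k k'
      proof -
        have "2 * (real k + 1) * h \<le> 2 * real k' * h" using that h0 by (intro mult_right_mono) auto
        then have "2 * real k * h + 2 * h \<le> 2 * real k' * h" by (simp add: algebra_simps)
        then show ?thesis using that by (simp add: cell_def)
      qed
      then show ?thesis using that by (metis abs_ge_self abs_minus_commute linorder_neqE_nat order_trans)
    qed
    then have "2 ^ j * h \<le> 2 ^ j * \<bar>x - x'\<bar>" by (rule mult_left_mono) simp
    then show ?thesis using j L_pos by linarith
  qed
  have far_clus: "2 * L < 2 ^ j * \<bar>x - x'\<bar>" if "x \<in> clus" "x' \<in> cell i" "i \<in> {1..n}" for x x' i
  proof -
    have "2 ^ j * x \<le> L" using that S(2) by (auto simp: clus_def)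
    moreover have "2 ^ j * (2 * h) \<le> 2 ^ j * x'"
    proof (rule mult_left_mono)
      have "2 * 1 * h \<le> 2 * real i * h" using that h0 by (intro mult_right_mono mult_left_mono) auto
      then show "2 * h \<le> x'" using that by (simp add: cell_def)
    qed simp
    moreover have "2 ^ j * x' - 2 ^ j * x \<le> 2 ^ j * \<bar>x - x'\<bar>"
      unfolding right_diff_distrib[symmetric] by (intro mult_left_mono) auto
    ultimately show ?thesis using j L_pos by linarith
  qed
  \<comment> \<open>The position 0 is inserted so that the term bounded below by \<open>d\<close> is
    present in the sum \<open>V\<close>.\<close>
  define ind where "ind yz = insert 0 (\<Union>i\<in>{1..n}. active j (fst yz i) \<union> active j (snd yz i))" for yz :: observation
  define V where "V yz = (\<Sum>k\<in>ind yz. dilate \<phi> j k (fst yz i1) * dilate \<phi> j k (fst yz i2))" for yz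
  have fin_ind: "finite (ind yz)" for yz by (simp add: ind_def finite_active)
  let ?T = "T_stat \<phi> \<omega> \<sigma> n j"
  let ?s = "2 / (real n)\<^sup>2 * (\<Sum>l\<in>UNIV. dual_weight \<omega> n l i1 * dual_weight \<omega> n l i2)"
  have T0: "?T yz = 0" if "yz \<in> B0" for yz
  proof -
    have mem: "fst yz i \<in> cell i" "snd yz i \<in> cell i" if "i \<in> {1..n}" for i
      using that \<open>yz \<in> B0\<close> by (auto simp: B0_def PiE_iff)
    have "?T yz = ?s * V yz"
      unfolding V_def
    proof (intro T_stat_one_pair i fin_ind)
      fix k k' assume k: "k \<in> {1..n}" "k' \<in> {1..n}" "k \<noteq> k'"
      show "2 * L < 2 ^ j * \<bar>fst yz k - snd yz k'\<bar>" "2 * L < 2 ^ j * \<bar>snd yz k - snd yz k'\<bar>"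
        "2 * L < 2 ^ j * \<bar>fst yz k - fst yz k'\<bar>"
        by (rule far_cells[OF mem(1)[OF k(1)] mem(2)[OF k(2)] k(3)],
            rule far_cells[OF mem(2)[OF k(1)] mem(2)[OF k(2)] k(3)],
            rule far_cells[OF mem(1)[OF k(1)] mem(1)[OF k(2)] k(3)])
    qed (auto simp: ind_def)
    also have "V yz = 0"
      unfolding V_def 
      by (intro sum.neutral ballI dilate_phi_mult_far far_cells[OF mem(1)[OF i(1)] mem(1)[OF i(2)] i(3)])
    finally show ?thesis by simp
  qed
  have T1: "\<tau> * (2 ^ j * d) \<le> \<bar>?T yz\<bar>" if "yz \<in> B1" for yz
  proof -
    have memY: "fst yz i \<in> Y i" and memZ: "snd yz i \<in> cell i" if "i \<in> {1..n}" for i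
      using that \<open>yz \<in> B1\<close> by (auto simp: B1_def PiE_iff)
    have "?T yz = ?s * V yz"
      unfolding V_def
    proof (intro T_stat_one_pair i fin_ind)
      fix k k' assume k: "k \<in> {1..n}" "k' \<in> {1..n}" "k \<noteq> k'"
      show "2 * L < 2 ^ j * \<bar>fst yz k - snd yz k'\<bar>"
        using memY[OF k(1)] memZ[OF k(2)] far_clus[of "fst yz k" "snd yz k'" k'] far_cells[of "fst yz k" k "snd yz k'" k'] k
        by (auto simp: Y_def split: if_splits)
      show "2 * L < 2 ^ j * \<bar>snd yz k - snd yz k'\<bar>"
        using memZ k by (intro far_cells[of _ k _ k'])
      assume kk: "{k, k'} \<noteq> {i1, i2}"
      then consider "k \<notin> {i1, i2}" "k' \<notin> {i1, i2}" | "k \<in> {i1, i2}" "k' \<notin> {i1, i2}" | "k \<notin> {i1, i2}" "k' \<in> {i1, i2}"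
        using k(3) by auto
      then show "2 * L < 2 ^ j * \<bar>fst yz k - fst yz k'\<bar>"
      proof cases
        case 1
        then have "fst yz k \<in> cell k" "fst yz k' \<in> cell k'"
          using memY[OF k(1)] memY[OF k(2)] by (auto simp: Y_def)
        then show ?thesis using k(3) by (rule far_cells)
      next
        case 2
        then show ?thesis using memY[OF k(1)] memY[OF k(2)] k far_clus[of "fst yz k" "fst yz k'" k'] by (auto simp: Y_def)
      next
        case 3
        then show ?thesis using memY[OF k(1)] memY[OF k(2)] k far_clus[of "fst yz k'" "fst yz k" k]
          by (auto simp: Y_def abs_minus_commute)
      qed
    qed (auto simp: ind_def)
    moreover have "2 ^ j * d \<le> V yz"
    proof -
      define u u' where "u = 2 ^ j * fst yz i1" and "u' = 2 ^ j * fst yz i2"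
      have u: "u \<in> S" "u' \<in> S"
        using memY[OF i(1)] memY[OF i(2)] by (auto simp: Y_def clus_def u_def u'_def)
      have dd: "dilate \<phi> j k (fst yz i1) * dilate \<phi> j k (fst yz i2) = 2 ^ j * (\<phi> (u - of_int k) * \<phi> (u' - of_int k))" for k
        by (simp add: dilate_def u_def u'_def powr_half_power2(1)[symmetric] power2_eq_square)
      \<comment> \<open>The term at 0 alone suffices, as by the choice of \<open>S\<close> no term
        is negative.\<close>
      have "2 ^ j * d \<le> 2 ^ j * (\<phi> (u - of_int 0) * \<phi> (u' - of_int 0))"
        using d(3)[OF u] by (intro mult_left_mono) auto
      also have "\<dots> \<le> (\<Sum>k\<in>ind yz. 2 ^ j * (\<phi> (u - of_int k) * \<phi> (u' - of_int k)))"
        using fin_ind d(2)[OF u] by (intro member_le_sum) (auto simp: ind_def)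
      finally show ?thesis by (simp only: V_def dd)
    qed
    moreover have "0 \<le> 2 ^ j * d" using d(1) by simp
    ultimately have T_eq: "?T yz = ?s * V yz" and V_ge: "2 ^ j * d \<le> V yz" and V0: "0 \<le> V yz" by linarith+
    have "\<bar>?T yz\<bar> = \<tau> * V yz" unfolding T_eq \<tau>_eq using V0 by (subst abs_mult) simp
    moreover have "\<tau> * (2 ^ j * d) \<le> \<tau> * V yz" using V_ge by (rule mult_left_mono) (simp add: \<tau>_eq)
    ultimately show ?thesis by simp
  qed
  show ?thesis
  proof (rule M.variance_ge_two_events[OF T_stat_measurable_M T_stat_integrable(2,1) B0 T0 B1 T1])
    show "0 \<le> \<tau> * (2 ^ j * d)" using d(1) by (simp add: \<tau>_eq)
  qed
qed

lemma zero_besov: "0 < R \<Longrightarrow> 0 \<le> s \<Longrightarrow> (\<lambda>x. 0) \<in> besov_body \<psi> s R"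
  using bump_besov[of "{}" 0 s "\<lambda>_. 0" R] by (simp add: bump_def[abs_def])

text \<open>The order of choices matters: \<open>n\<close> comes first and fixes the weights, the
  indices i1, i2 and the constants \<open>\<beta>\<close> and \<open>\<tau>\<close>; then
  \<open>j\<close> is taken large, so that a variance of order 4^j exceeds a bound of order 2^j.
  Component \<open>u\<^sub>0\<close> carries a fixed separation, which puts the pair into the
  alternative; all others are partly concentrated and equal in both samples.\<close>

lemma not_variance_bound_prob_densities:
  fixes \<omega> \<sigma> :: "nat \<Rightarrow> 'm::finite \<Rightarrow> nat \<Rightarrow> real"
  assumes R: "R > 0" and s: "s > 0" and K: "0 < K" and M2: "CARD('m) \<noteq> 1"
    and \<omega>: "\<forall>\<^sub>F n in sequentially. spread_weights (\<omega> n) n K"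
    and \<sigma>: "\<forall>\<^sub>F n in sequentially. spread_weights (\<sigma> n) n K"
  shows "\<not> variance_bound prob_densities \<phi> \<psi> R s \<omega> \<sigma> K C\<^sub>T"
proof
  assume var: "variance_bound prob_densities \<phi> \<psi> R s \<omega> \<sigma> K C\<^sub>T"
  obtain S d where S: "S \<in> sets borel" "S \<subseteq> {-L..L}" "0 < measure lborel S"
    and d: "0 < d" "\<And>u u' k. u \<in> S \<Longrightarrow> u' \<in> S \<Longrightarrow> 0 \<le> \<phi> (u - of_int k) * \<phi> (u' - of_int k)"
      "\<And>u u'. u \<in> S \<Longrightarrow> u' \<in> S \<Longrightarrow> d \<le> \<phi> u * \<phi> u'"
    by (rule exists_cluster_set) blast
  obtain v u\<^sub>0 :: 'm where v: "v \<noteq> u\<^sub>0"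
  proof -
    have "\<not> (\<forall>v u\<^sub>0 :: 'm. v = u\<^sub>0)"
    proof
      assume "\<forall>v u\<^sub>0 :: 'm. v = u\<^sub>0"
      then have "(UNIV :: 'm set) = {undefined}" by blast
      then have "CARD('m) = 1" by (metis card_1_singleton_iff One_nat_def)
      with M2 show False by simp
    qed
    then show thesis using that by blast
  qed
  define D where "D = 2 / R + 2 * of_int \<lceil>L\<rceil> + 1"
  have cL: "1 \<le> \<lceil>L\<rceil>" using L_pos by linarith
  have D: "0 < D" "2 / R \<le> D" "2 * of_int \<lceil>L\<rceil> + 1 \<le> D"
    using R cL by (auto simp: D_def intro!: add_nonneg_pos add_nonneg_nonneg)
  have DR: "2 / D \<le> R" using D R by (simp add: field_simps)
  \<comment> \<open>The first entry keeps the perturbed density above half of the flat one, as the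
    cells require; the second puts the level-0 perturbation into the Besov body, where the condition
    reads \<delta>^2 <= R.\<close>
  define \<delta> where "\<delta> = min (1 / (2 * D * bump_amp)) (sqrt R)"
  have \<delta>0: "0 < \<delta>" using D(1) bump_amp_pos R by (simp add: \<delta>_def)
  have \<delta>D: "\<delta> * bump_amp \<le> 1 / (2 * D)"
  proof -
    have "\<delta> * bump_amp \<le> 1 / (2 * D * bump_amp) * bump_amp"
      using bump_amp_pos by (intro mult_right_mono) (auto simp: \<delta>_def)
    then show ?thesis using bump_amp_pos by simp
  qed
  have \<delta>R: "\<delta>\<^sup>2 \<le> R"
    using power_mono[of \<delta> "sqrt R" 2] \<delta>0 R by (simp add: \<delta>_def)
  define b where "b = bump 0 {\<lceil>L\<rceil>} (\<lambda>_. \<delta>)"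
  have b_half: "\<bar>b x\<bar> \<le> 1 / (2 * D)" for x
    using bump_bounded[of "{\<lceil>L\<rceil>}" "\<lambda>_. \<delta>" \<delta> 0 x] \<delta>D \<delta>0 by (simp add: b_def)
  have b_le: "\<bar>b x\<bar> \<le> 1 / D" for x
  proof -
    have "1 / (2 * D) \<le> 1 / D" using D(1) by (simp add: field_simps)
    then show ?thesis using b_half[of x] by linarith
  qed
  have supp: "L \<le> of_int k \<and> of_int k + L \<le> D * 2 ^ 0" if "k \<in> {\<lceil>L\<rceil>}" for k :: int
  proof -
    have "L \<le> of_int \<lceil>L\<rceil>" by (rule le_of_int_ceiling)
    moreover have "of_int \<lceil>L\<rceil> + L \<le> D" using D(3) \<open>L \<le> of_int \<lceil>L\<rceil>\<close> by linarith
    ultimately show ?thesis using that by simp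
  qed
  define g where "g x = flat_density D x + b x" for x
  have g_half: "flat_density D x / 2 \<le> g x" for x
  proof (cases "b x = 0")
    case True
    then show ?thesis using D(1) by (simp add: g_def flat_density_def)
  next
    case False
    then have "0 \<le> x \<and> x < D" unfolding b_def by (rule bump_supp[of "{\<lceil>L\<rceil>}" D 0, rotated]) (rule supp)
    then have "flat_density D x = 1 / D" by (simp add: flat_density_def)
    then show ?thesis using b_half[of x] by (simp add: g_def abs_le_iff)
  qed
  have "\<forall>\<^sub>F n in sequentially. sep_rate s n < \<delta>"
    using sep_rate_tendsto_0[OF s] \<delta>0 by (rule order_tendstoD(2))
  moreover have "\<forall>\<^sub>F n in sequentially. real CARD('m) / K < real n"
    by (rule eventually_gt_at_top[THEN eventually_compose_filterlim[OF _ filterlim_real_sequentially]])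
  moreover note variance_boundD[OF var zero_less_one]
  ultimately have "\<forall>\<^sub>F n in sequentially. sep_rate s n < \<delta> \<and> real CARD('m) / K < real n
    \<and> (\<forall>(p, q) \<in> Theta0 R \<union> Theta1 prob_densities \<psi> R 1 n s. \<forall>j.
        prob_space.variance (obs_law (\<omega> n) (\<sigma> n) n (p, q)) (T_stat \<phi> (\<omega> n) (\<sigma> n) n j)
        \<le> C\<^sub>T * variance_rate n p q j * ((real CARD('m))\<^sup>2 / K\<^sup>2))
    \<and> spread_weights (\<omega> n) n K \<and> spread_weights (\<sigma> n) n K"
    using \<omega> \<sigma> by (intro eventually_conj)
  then obtain n where sep: "sep_rate s n < \<delta>" and nK: "real CARD('m) / K < real n"
    and bound: "\<And>p q j. (p, q) \<in> Theta1 prob_densities \<psi> R 1 n s \<Longrightarrow>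
        prob_space.variance (obs_law (\<omega> n) (\<sigma> n) n (p, q)) (T_stat \<phi> (\<omega> n) (\<sigma> n) n j)
        \<le> C\<^sub>T * variance_rate n p q j * ((real CARD('m))\<^sup>2 / K\<^sup>2)"
    and spread: "spread_weights (\<omega> n) n K" "spread_weights (\<sigma> n) n K"
    using eventually_happens[of _ sequentially] by fastforce
  interpret W: spread_weights "\<omega> n" n K by fact
  have "real CARD('m) < K * real n" using nK K by (simp add: field_simps)
  then obtain i1 i2 where i: "i1 \<in> {1..n}" "i2 \<in> {1..n}" "i1 \<noteq> i2" and \<omega>v: "0 < \<omega> n v i1" "0 < \<omega> n v i2"
    and corr: "(\<Sum>l\<in>UNIV. dual_weight (\<omega> n) n l i1 * dual_weight (\<omega> n) n l i2) \<noteq> 0"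
    using W.exists_correlated_dual_weights[of v] by blast
  have n1: "1 \<le> real n" using W.n_pos by simp
  define h where "h = D / (2 * (real n + 1))"
  define \<beta> where "\<beta> = min (h / (2 * D)) (min (\<omega> n v i1 / 2) (\<omega> n v i2 / 2))"
  define \<tau> where "\<tau> = \<bar>2 / (real n)\<^sup>2 * (\<Sum>l\<in>UNIV. dual_weight (\<omega> n) n l i1 * dual_weight (\<omega> n) n l i2)\<bar>"
  have h0: "0 < h" using D(1) by (simp add: h_def)
  have \<beta>0: "0 < \<beta>" using h0 D(1) \<omega>v by (simp add: \<beta>_def)
  have \<tau>0: "0 < \<tau>" using corr n1 by (simp add: \<tau>_def)
  define c where "c = (\<tau> * d / 2)\<^sup>2 * (\<beta> ^ n * \<beta> ^ n)"
  have c0: "0 < c" using \<tau>0 d(1) \<beta>0 by (simp add: c_def)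
  define c' where "c' = \<bar>C\<^sub>T\<bar> * (1 + (\<Sum>l\<in>(UNIV::'m set). \<delta>\<^sup>2) + (\<Sum>l\<in>(UNIV::'m set). \<delta>)) * ((real CARD('m))\<^sup>2 / K\<^sup>2)"
  \<comment> \<open>One bound for two requirements: cells wide compared with 2L / 2^j, and
    \<open>c * 2 ^ j\<close> beyond \<open>c'\<close>.\<close>
  obtain j :: nat where jbig: "4 * L / h + c' / c < 2 ^ j"
    using real_arch_pow[of 2 "4 * L / h + c' / c"] by auto
  have c'0: "0 \<le> c'" unfolding c'_def using \<delta>0 by (intro mult_nonneg_nonneg add_nonneg_nonneg sum_nonneg) auto
  have j1: "4 * L < 2 ^ j * h"
  proof -
    have "4 * L / h < 2 ^ j" using jbig c0 c'0 by (smt (verit) divide_nonneg_pos)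
    then show ?thesis using h0 by (simp add: field_simps)
  qed
  have j2: "c' < c * 2 ^ j"
  proof -
    have "c' / c < 2 ^ j" using jbig h0 L_pos by (smt (verit) divide_nonneg_pos)
    then show ?thesis using c0 by (simp add: field_simps)
  qed
  \<comment> \<open>Half flat, so that every cell keeps a fixed probability; half concentrated, so
    that the cluster receives at least half the weight of the component.\<close>
  define m where "m = (\<lambda>x. (flat_density D x + concentrated S j x) / 2)"
  define p where "p = (\<lambda>u. if u = u\<^sub>0 then flat_density D else m)"
  define q where "q = (\<lambda>u. if u = u\<^sub>0 then g else m)"
  have alt: "flat_density D \<in> prob_densities \<inter> Linf_ball R"
      "g \<in> prob_densities \<inter> Linf_ball R"
      "(\<lambda>x. flat_density D x - g x) \<in> besov_body \<psi> s R"
      "(flat_density D, g) \<in> Lambda R 1 n s"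
    using flat_bump_Theta1[of "{\<lceil>L\<rceil>}" D R s 0 "\<lambda>_. \<delta>" 1 n, OF _ D(1) DR less_imp_le[OF s] supp b_le[unfolded b_def]]
      \<delta>R \<delta>0 sep unfolding g_def[abs_def] b_def by (auto simp: real_sqrt_abs)
  have finS: "emeasure lborel S < \<infinity>" using S(2) by (rule emeasure_lborel_finite)
  have dens_m: "m \<in> prob_densities" unfolding m_def
    by (intro prob_densities_average flat_prob_density D concentrated_prob_density S finS)
  have pq: "(p, q) \<in> Theta1 prob_densities \<psi> R 1 n s"
    unfolding Theta1_def using alt dens_m zero_besov[OF R less_imp_le[OF s]]
    by (auto simp: p_def q_def intro!: exI[of _ u\<^sub>0])
  have norm_le: "norm_L2 (\<lambda>x. p l x - q l x) \<le> \<delta>" for l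
  proof (cases "l = u\<^sub>0")
    case True
    have "(\<lambda>x. p l x - q l x) = bump 0 {\<lceil>L\<rceil>} (\<lambda>_. - \<delta>)"
      by (simp add: True p_def q_def g_def b_def bump_def fun_eq_iff)
    then have "(norm_L2 (\<lambda>x. p l x - q l x))\<^sup>2 = \<delta>\<^sup>2"
      unfolding norm_L2_sq by (simp add: inner_bump_bump power2_eq_square)
    then have "(norm_L2 (\<lambda>x. p l x - q l x))\<^sup>2 \<le> \<delta>\<^sup>2" by simp
    then show ?thesis using \<delta>0 by (rule power2_le_imp_le[OF _ less_imp_le])
  next
    case False
    then show ?thesis using \<delta>0 by (simp add: p_def q_def norm_L2_def)
  qed
  have "c * (2 ^ j)\<^sup>2 = (\<tau> * (2 ^ j * d) / 2)\<^sup>2 * (\<beta> ^ n * \<beta> ^ n)"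
    by (simp add: c_def power_mult_distrib power_divide)
  also have "\<dots> \<le> prob_space.variance (obs_law (\<omega> n) (\<sigma> n) n (p, q)) (T_stat \<phi> (\<omega> n) (\<sigma> n) n j)"
    using S d spread i v \<omega>v D(1) IntD1[OF alt(2)] g_half h_def j1 \<beta>_def \<tau>_def m_def p_def q_def
    by (rule variance_concentrated)
  also have "\<dots> \<le> C\<^sub>T * variance_rate n p q j * ((real CARD('m))\<^sup>2 / K\<^sup>2)"
    by (rule bound[OF pq])
  \<comment> \<open>At fixed separation every term of the variance bound is at most of order 2^j.
    The sign of \<open>C\<^sub>T\<close> is arbitrary here, hence the absolute value.\<close>
  also have "\<dots> \<le> \<bar>C\<^sub>T\<bar> * (2 ^ j * 1 + 2 ^ j * (\<Sum>l\<in>(UNIV::'m set). \<delta>\<^sup>2) + 2 ^ j * (\<Sum>l\<in>(UNIV::'m set). \<delta>)) * ((real CARD('m))\<^sup>2 / K\<^sup>2)"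
    unfolding variance_rate_def
  proof (intro mult_right_mono mult_mono add_mono sum_mono)
    have p1: "(1::real) \<le> 2 ^ j" by simp
    show "2 ^ j / (real n)\<^sup>2 \<le> 2 ^ j * 1" using n1 by (simp add: divide_le_eq)
    have "1 / real n \<le> 1" using n1 by simp
    then show "1 / real n \<le> 2 ^ j" using p1 by linarith
    have "2 ^ j / real n ^ 3 \<le> 2 ^ j" using n1 by (simp add: divide_le_eq)
    also have "\<dots> \<le> (2 ^ j)\<^sup>2" using p1 by (simp add: power2_eq_square)
    finally have "sqrt (2 ^ j / real n ^ 3) \<le> sqrt ((2 ^ j)\<^sup>2)" by (rule real_sqrt_le_mono)
    then show "sqrt (2 ^ j / real n ^ 3) \<le> 2 ^ j" unfolding real_sqrt_abs by simp
    show "norm_L2 (\<lambda>x. p l x - q l x) \<le> \<delta>" for l by (rule norm_le)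
    show "(norm_L2 (\<lambda>x. p l x - q l x))\<^sup>2 \<le> \<delta>\<^sup>2" for l
      by (intro power_mono norm_le norm_L2_nonneg)
  qed (auto simp: norm_L2_nonneg intro!: add_nonneg_nonneg sum_nonneg mult_nonneg_nonneg divide_nonneg_nonneg)
  also have "\<dots> = c' * 2 ^ j" by (simp add: c'_def algebra_simps)
  finally have "(c * 2 ^ j) * 2 ^ j \<le> c' * 2 ^ j" by (simp add: power2_eq_square mult.assoc)
  then have "c * 2 ^ j \<le> c'" by (rule mult_right_le_imp_le) simp
  with j2 show False by linarith
qed

end

section \<open>Assembly of the two bounds\<close>

lemma eventually_spread_weights:
  fixes w :: "nat \<Rightarrow> 'm::finite \<Rightarrow> nat \<Rightarrow> real"
  assumes "0 < K" "\<And>n. mixing_weights (w n) n"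
    and "\<forall>\<^sub>F n in sequentially. smallest_eigenvalue (gram (w n) n) \<ge> K * real n"
  shows "\<forall>\<^sub>F n in sequentially. spread_weights (w n) n K"
  using assms(3) eventually_gt_at_top[of 0]
  by eventually_elim (use assms(1,2) in \<open>simp add: spread_weights_def\<close>)

text \<open>With a single component the separated one is the only one, and \<open>Lambda\<close>
  bounds it by \<open>R\<close> whatever \<open>\<A>\<close> is.\<close>

lemma Theta1_bounded_component:
  fixes p q :: "'m::finite \<Rightarrow> real \<Rightarrow> real"
  assumes \<A>: "\<A> = prob_densities \<inter> Linf_ball R \<or> CARD('m) = 1"
    and pq: "(p, q) \<in> Theta1 \<A> \<psi> R C n s"
  shows "p u \<in> prob_densities \<inter> Linf_ball R \<and> q u \<in> prob_densities \<inter> Linf_ball R"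
  using \<A>
proof
  assume "\<A> = prob_densities \<inter> Linf_ball R"
  with pq show ?thesis by (auto simp: Theta1_def)
next
  assume "CARD('m) = 1"
  then obtain x :: 'm where "UNIV = {x}" by (auto simp: card_1_singleton_iff)
  then have all_eq: "u' = u" for u' by (metis UNIV_I singletonD)
  obtain u' where "(p u', q u') \<in> Lambda R C n s" using pq by (auto simp: Theta1_def)
  then have "(p u, q u) \<in> Lambda R C n s" by (simp only: all_eq[of u'])
  then show ?thesis by (simp add: Lambda_def)
qed

theorem corollary2p2:
  fixes \<phi> \<psi> :: "real \<Rightarrow> real" and L R K s :: real
    and \<omega> \<sigma> :: "nat \<Rightarrow> 'm::finite \<Rightarrow> nat \<Rightarrow> real"
    and \<A> :: "(real \<Rightarrow> real) set"
  assumes "L > 0" and "wavelet_system \<phi> \<psi> L"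
    and "R > 0" and "0 < K" and "K < 1" and "s > 0"
    and "\<And>n. mixing_weights (\<omega> n) n" and "\<And>n. mixing_weights (\<sigma> n) n"
    and "\<forall>\<^sub>F n in sequentially. smallest_eigenvalue (gram (\<omega> n) n) \<ge> K * real n"
    and "\<forall>\<^sub>F n in sequentially. smallest_eigenvalue (gram (\<sigma> n) n) \<ge> K * real n"
    and "\<A> = prob_densities \<or> \<A> = prob_densities \<inter> Linf_ball R"
  shows "\<forall>\<gamma>. 0 < \<gamma> \<and> \<gamma> < 1 \<longrightarrow>
    (\<forall>C\<^sub>T>0. variance_bound \<A> \<phi> \<psi> R s \<omega> \<sigma> K C\<^sub>T \<longrightarrow>
      (\<exists>C\<^sub>\<gamma>. \<forall>C>C\<^sub>\<gamma>.
        limsup (\<lambda>n. total_error (\<omega> n) (\<sigma> n) n (Theta0 R) (Theta1 \<A> \<psi> R C n s)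
          (Delta_star \<phi> (\<omega> n) (\<sigma> n) n s (threshold_const C\<^sub>T \<gamma> L R CARD('m) K)))
        \<le> ennreal \<gamma>)) \<and>
    (\<exists>c\<^sub>\<gamma>>0. \<forall>C. 0 < C \<and> C < c\<^sub>\<gamma> \<longrightarrow>
      liminf (\<lambda>n. INF \<Delta>\<in>tests n.
        total_error (\<omega> n) (\<sigma> n) n (Theta0 R) (Theta1 \<A> \<psi> R C n s) \<Delta>)
      > ennreal \<gamma>)"
proof (intro allI impI conjI)
  fix \<gamma> :: real assume \<gamma>: "0 < \<gamma> \<and> \<gamma> < 1"
  have wav: "wavelets \<phi> \<psi> L" using assms(1,2) by (rule wavelets.intro)
  interpret wavelets \<phi> \<psi> L by (rule wav)
  have spread: "\<forall>\<^sub>F n in sequentially. spread_weights (\<omega> n) n K" "\<forall>\<^sub>F n in sequentially. spread_weights (\<sigma> n) n K"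
    using assms by (auto intro: eventually_spread_weights)
  show "\<exists>c\<^sub>\<gamma>>0. \<forall>C. 0 < C \<and> C < c\<^sub>\<gamma> \<longrightarrow>
      liminf (\<lambda>n. INF \<Delta>\<in>tests n.
        total_error (\<omega> n) (\<sigma> n) n (Theta0 R) (Theta1 \<A> \<psi> R C n s) \<Delta>)
      > ennreal \<gamma>"
    using assms \<gamma> by (intro lower_bound) auto
  fix C\<^sub>T :: real assume C\<^sub>T: "C\<^sub>T > 0" and var: "variance_bound \<A> \<phi> \<psi> R s \<omega> \<sigma> K C\<^sub>T"
  \<comment> \<open>The assumed variance bound excludes the literal alternative with two or more
    components.\<close>
  have bounded: "\<A> = prob_densities \<inter> Linf_ball R \<or> CARD('m) = 1"
    using not_variance_bound_prob_densities[OF \<open>R > 0\<close> \<open>s > 0\<close> \<open>0 < K\<close> _ spread] var assms(11) by blast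
  show "\<exists>C\<^sub>\<gamma>. \<forall>C>C\<^sub>\<gamma>.
        limsup (\<lambda>n. total_error (\<omega> n) (\<sigma> n) n (Theta0 R) (Theta1 \<A> \<psi> R C n s)
          (Delta_star \<phi> (\<omega> n) (\<sigma> n) n s (threshold_const C\<^sub>T \<gamma> L R CARD('m) K)))
        \<le> ennreal \<gamma>"
    using Theta1_bounded_component[OF bounded] \<gamma>
    by (intro upper_bound[OF wav \<open>R > 0\<close> \<open>s > 0\<close> spread _ C\<^sub>T _ var]) auto
qed

end
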